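(* Let $\mathcal K$ be a 2-category with finite products, let $(T,\eta,\mu,t,\Gamma)$ be a pseudo commutative, strong 2-monad on $\mathcal K$ (not assumed symmetric), and let $A_1,\dots,A_n$ be objects of $\mathcal K$. Let $B_n$ be the symmetric group $\Sigma_n$ regarded as a poset (hence a category) with the weak right order. For $\sigma\in\Sigma_n$ put $\omega_\sigma=T(\sigma)\circ\omega_{A_{\sigma(1)},\dots,A_{\sigma(n)}}\circ\sigma^{-1}\colon TA_1\times\cdots\times TA_n\to T(A_1\times\cdots\times A_n)$. Then there is a functor $$\Omega\colon B_n\to\mathcal K\bigl(TA_1\times\cdots\times TA_n,\;T(A_1\times\cdots\times A_n)\bigr)$$ with $\Omega(\mathrm{id})=\omega_{A_1,\dots,A_n}$, $\Omega(\sigma)=\omega_\sigma$ for all $\sigma$, and such that, whenever $\ell(\sigma)<\ell(\sigma\sigma_i)$, $\Omega(\sigma<\sigma\sigma_i)\colon\omega_\sigma\Rightarrow\omega_{\sigma\sigma_i}$ is the 2-cell $$T(\sigma)\circ\omega_{A_{\sigma(1)},\dots,A_{\sigma(i-1)},\,A_{\sigma(i)}\times A_{\sigma(i+1)},\,A_{\sigma(i+2)},\dots,A_{\sigma(n)}}\circ\bigl(1\times\Gamma_{A_{\sigma(i)},A_{\sigma(i+1)}}\times1\bigr)\circ\sigma^{-1}.$$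
   Context: **Conventions.** $\mathcal K$ is a 2-category with finite products $\times$ and terminal object $1$; associativity isomorphisms are suppressed; $1$ also denotes identities. $\beta\cdot\alpha$ is vertical composition ($\alpha$ first); $\circ$ is composition of 1-cells and whiskering. **Strong 2-monads.** A strong 2-monad $(T,\eta,\mu,t)$ is a strict 2-monad $(T,\eta,\mu)$ on $\mathcal K$ with a 2-natural $t_{A,B}\colon A\times TB\to T(A\times B)$ such that, with $l_A\colon 1\times A\cong A$: $T(l_A)\circ t_{1,A}=l_{TA}$; $t_{A,B\times C}\circ(1\times t_{B,C})=t_{A\times B,C}$; $t\circ(1\times\eta)=\eta$; $t\circ(1\times\mu)=\mu\circ Tt\circ t$. Write $t_2=t$ and let $t_1\colon TA\times B\to T(A\times B)$ be the composite $TA\times B\cong B\times TA\xrightarrow{t}T(B\times A)\cong T(A\times B)$. Write $\omega_{A,B}=\mu\circ Tt_2\circ t_1$ and $\omega'_{A,B}=\mu\circ Tt_1\circ t_2$, 1-cells $TA\times TB\to T(A\times B)$. Put $\omega_{A_1}=1_{TA_1}$ and $\omega_{A_1,\dots,A_n}=\omega_{A_1\times\cdots\times A_{n-1},A_n}\circ(\omega_{A_1,\dots,A_{n-1}}\times1)\colon TA_1\times\cdots\times TA_n\to T(A_1\times\cdots\times A_n)$ (this iterated $\omega$ is associative). **Pseudo commutativity.** A pseudo commutativity $\Gamma$ is an invertible modification with components $\Gamma_{A,B}\colon\omega_{A,B}\Rightarrow\omega'_{A,B}$ (so $T(f\times g)\circ\Gamma_{A,B}=\Gamma_{A',B'}\circ(Tf\times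 Tg)$) such that: (1) $\Gamma_{A\times B,C}\circ(t_2\times1_{TC})=t_2\circ(1_A\times\Gamma_{B,C})$; (2) $\Gamma_{A,B\times C}\circ(1_{TA}\times t_2)=\Gamma_{A\times B,C}\circ(t_1\times1_{TC})$; (3) $\Gamma_{A,B\times C}\circ(1_{TA}\times t_1)=t_1\circ(\Gamma_{A,B}\times1_C)$; (4) $\Gamma_{A,B}\circ(\eta_A\times1)$ is an identity; (5) $\Gamma_{A,B}\circ(1\times\eta_B)$ is an identity; (6) $\Gamma_{A,B}\circ(\mu_A\times1)=(\mu\circ Tt_1\circ\Gamma_{TA,B})\cdot(\mu\circ T\Gamma_{A,B}\circ t_1)$; (7) $\Gamma_{A,B}\circ(1\times\mu_B)=(\mu\circ T\Gamma_{A,B}\circ t_2)\cdot(\mu\circ Tt_2\circ\Gamma_{A,TB})$. **Permutations.** For $\sigma\in\Sigma_n$ also write $\sigma\colon X_{\sigma(1)}\times\cdots\times X_{\sigma(n)}\to X_1\times\cdots\times X_n$ for the canonical permutation isomorphism (used with $X_k=A_k$ or $X_k=TA_k$). $\sigma_i$ is the transposition of $i$ and $i+1$. $\ell(\sigma)$ is the number of inversions of $\sigma$, i.e. pairs $i<j$ with $\sigma(i)>\sigma(j)$; equivalently the minimal length of a word for $\sigma$ in the $\sigma_i$. The weak right order on $\Sigma_n$ is the partial order generated by $\sigma<\sigma\sigma_i$ whenever $\ell(\sigma)<\ell(\sigma\sigma_i)$. Note that $\omega'_{A,B}$ equals $TA\times TB\cong TB\times TA\xrightarrow{\omega_{B,A}}T(B\times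 A)\cong T(A\times B)$, so the displayed 2-cell does have target $\omega_{\sigma\sigma_i}$. *)

theory Defs
  imports "HOL-Combinatorics.Permutations"
begin

section \<open>Categories and functors\<close>

record ('o, 'm) cat =
  Obj :: "'o set"
  Arr :: "'m set"
  Dom :: "'m \<Rightarrow> 'o"
  Cod :: "'m \<Rightarrow> 'o"
  Id :: "'o \<Rightarrow> 'm"
  Comp :: "'m \<Rightarrow> 'm \<Rightarrow> 'm"

locale category =
  fixes C :: "('o, 'm) cat"
  assumes Dom_closed: "f \<in> Arr C \<Longrightarrow> Dom C f \<in> Obj C"
    and Cod_closed: "f \<in> Arr C \<Longrightarrow> Cod C f \<in> Obj C"
    and Id_closed: "x \<in> Obj C \<Longrightarrow> Id C x \<in> Arr C"
    and Dom_Id: "x \<in> Obj C \<Longrightarrow> Dom C (Id C x) = x"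
    and Cod_Id: "x \<in> Obj C \<Longrightarrow> Cod C (Id C x) = x"
    and Comp_closed: "\<lbrakk>f \<in> Arr C; g \<in> Arr C; Dom C g = Cod C f\<rbrakk> \<Longrightarrow> Comp C g f \<in> Arr C"
    and Dom_Comp: "\<lbrakk>f \<in> Arr C; g \<in> Arr C; Dom C g = Cod C f\<rbrakk> \<Longrightarrow> Dom C (Comp C g f) = Dom C f"
    and Cod_Comp: "\<lbrakk>f \<in> Arr C; g \<in> Arr C; Dom C g = Cod C f\<rbrakk> \<Longrightarrow> Cod C (Comp C g f) = Cod C g"
    and Comp_Id_right: "f \<in> Arr C \<Longrightarrow> Comp C f (Id C (Dom C f)) = f"
    and Comp_Id_left: "f \<in> Arr C \<Longrightarrow> Comp C (Id C (Cod C f)) f = f"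
    and Comp_assoc: "\<lbrakk>f \<in> Arr C; g \<in> Arr C; h \<in> Arr C; Dom C g = Cod C f; Dom C h = Cod C g\<rbrakk>
      \<Longrightarrow> Comp C (Comp C h g) f = Comp C h (Comp C g f)"

locale cat_functor =
  source: category C + target: category D
  for C :: "('o, 'm) cat" and D :: "('p, 'k) cat" +
  fixes Fo :: "'o \<Rightarrow> 'p" and Fm :: "'m \<Rightarrow> 'k"
  assumes map_Obj: "x \<in> Obj C \<Longrightarrow> Fo x \<in> Obj D"
    and map_Arr: "f \<in> Arr C \<Longrightarrow> Fm f \<in> Arr D"
    and map_Dom: "f \<in> Arr C \<Longrightarrow> Dom D (Fm f) = Fo (Dom C f)"
    and map_Cod: "f \<in> Arr C \<Longrightarrow> Cod D (Fm f) = Fo (Cod C f)"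
    and map_Id: "x \<in> Obj C \<Longrightarrow> Fm (Id C x) = Id D (Fo x)"
    and map_Comp: "\<lbrakk>f \<in> Arr C; g \<in> Arr C; Dom C g = Cod C f\<rbrakk>
      \<Longrightarrow> Fm (Comp C g f) = Comp D (Fm g) (Fm f)"

text \<open>A preordered set as a category: the unique arrow from \<open>x\<close> to \<open>y\<close> is the pair \<open>(x, y)\<close>.\<close>

definition order_cat :: "'a set \<Rightarrow> 'a rel \<Rightarrow> ('a, 'a \<times> 'a) cat" where
  "order_cat S R = \<lparr>Obj = S, Arr = {(x, y). x \<in> S \<and> y \<in> S \<and> (x, y) \<in> R},
     Dom = fst, Cod = snd, Id = (\<lambda>x. (x, x)), Comp = (\<lambda>g f. (fst f, snd g))\<rparr>"


section \<open>Strict 2-categories\<close>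

record ('o, 'f, 'c) two_cat =
  ob :: "'o set"
  arr :: "'f set"
  cell :: "'c set"
  dom1 :: "'f \<Rightarrow> 'o"
  cod1 :: "'f \<Rightarrow> 'o"
  dom2 :: "'c \<Rightarrow> 'f"
  cod2 :: "'c \<Rightarrow> 'f"
  id1 :: "'o \<Rightarrow> 'f"
  id2 :: "'f \<Rightarrow> 'c"
  comp1 :: "'f \<Rightarrow> 'f \<Rightarrow> 'f"  (infixr "\<odot>\<index>" 75)
  vcomp :: "'c \<Rightarrow> 'c \<Rightarrow> 'c"  (infixr "\<bullet>\<index>" 70)
  hcomp :: "'c \<Rightarrow> 'c \<Rightarrow> 'c"  (infixr "\<star>\<index>" 75)

text \<open>
  A 2-category is presented by three categories: objects and 1-cells; 1-cells and 2-cells under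
  vertical composition; objects and 2-cells under horizontal composition.  All compositions are
  in applicative order (the right-hand argument comes first).
\<close>

definition one_cat :: "('o, 'f, 'c, 'x) two_cat_scheme \<Rightarrow> ('o, 'f) cat" where
  "one_cat K = \<lparr>Obj = ob K, Arr = arr K, Dom = dom1 K, Cod = cod1 K, Id = id1 K, Comp = comp1 K\<rparr>"

definition vert_cat :: "('o, 'f, 'c, 'x) two_cat_scheme \<Rightarrow> ('f, 'c) cat" where
  "vert_cat K = \<lparr>Obj = arr K, Arr = cell K, Dom = dom2 K, Cod = cod2 K, Id = id2 K, Comp = vcomp K\<rparr>"

definition horiz_cat :: "('o, 'f, 'c, 'x) two_cat_scheme \<Rightarrow> ('o, 'c) cat" where
  "horiz_cat K = \<lparr>Obj = ob K, Arr = cell K, Dom = (\<lambda>\<alpha>. dom1 K (dom2 K \<alpha>)),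
     Cod = (\<lambda>\<alpha>. cod1 K (dom2 K \<alpha>)), Id = (\<lambda>A. id2 K (id1 K A)), Comp = hcomp K\<rparr>"

definition hom_cat :: "('o, 'f, 'c, 'x) two_cat_scheme \<Rightarrow> 'o \<Rightarrow> 'o \<Rightarrow> ('f, 'c) cat" where
  "hom_cat K A B =
    \<lparr>Obj = {f \<in> arr K. dom1 K f = A \<and> cod1 K f = B},
     Arr = {\<alpha> \<in> cell K. dom1 K (dom2 K \<alpha>) = A \<and> cod1 K (dom2 K \<alpha>) = B},
     Dom = dom2 K, Cod = cod2 K, Id = id2 K, Comp = vcomp K\<rparr>"

locale two_category =
  fixes K :: "('o, 'f, 'c, 'x) two_cat_scheme" (structure)
  assumes one_category: "category (one_cat K)"
    and vert_category: "category (vert_cat K)"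
    and horiz_category: "category (horiz_cat K)"
    and parallel_dom: "\<alpha> \<in> cell K \<Longrightarrow> dom1 K (cod2 K \<alpha>) = dom1 K (dom2 K \<alpha>)"
    and parallel_cod: "\<alpha> \<in> cell K \<Longrightarrow> cod1 K (cod2 K \<alpha>) = cod1 K (dom2 K \<alpha>)"
    and dom2_hcomp: "\<lbrakk>\<alpha> \<in> cell K; \<beta> \<in> cell K; dom1 K (dom2 K \<beta>) = cod1 K (dom2 K \<alpha>)\<rbrakk>
      \<Longrightarrow> dom2 K (\<beta> \<star> \<alpha>) = dom2 K \<beta> \<odot> dom2 K \<alpha>"
    and cod2_hcomp: "\<lbrakk>\<alpha> \<in> cell K; \<beta> \<in> cell K; dom1 K (dom2 K \<beta>) = cod1 K (dom2 K \<alpha>)\<rbrakk>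
      \<Longrightarrow> cod2 K (\<beta> \<star> \<alpha>) = cod2 K \<beta> \<odot> cod2 K \<alpha>"
    and hcomp_id2: "\<lbrakk>f \<in> arr K; g \<in> arr K; dom1 K g = cod1 K f\<rbrakk>
      \<Longrightarrow> id2 K g \<star> id2 K f = id2 K (g \<odot> f)"
    and interchange: "\<lbrakk>\<alpha> \<in> cell K; \<alpha>' \<in> cell K; \<beta> \<in> cell K; \<beta>' \<in> cell K;
        dom2 K \<alpha>' = cod2 K \<alpha>; dom2 K \<beta>' = cod2 K \<beta>; dom1 K (dom2 K \<beta>) = cod1 K (dom2 K \<alpha>)\<rbrakk>
      \<Longrightarrow> (\<beta>' \<bullet> \<beta>) \<star> (\<alpha>' \<bullet> \<alpha>) = (\<beta>' \<star> \<alpha>') \<bullet> (\<beta> \<star> \<alpha>)"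

definition lwhisker :: "('o, 'f, 'c, 'x) two_cat_scheme \<Rightarrow> 'f \<Rightarrow> 'c \<Rightarrow> 'c"  (infixr "\<rhd>\<index>" 75)
  where "f \<rhd>\<^bsub>K\<^esub> \<alpha> = id2 K f \<star>\<^bsub>K\<^esub> \<alpha>"

definition rwhisker :: "('o, 'f, 'c, 'x) two_cat_scheme \<Rightarrow> 'c \<Rightarrow> 'f \<Rightarrow> 'c"  (infixr "\<lhd>\<index>" 75)
  where "\<alpha> \<lhd>\<^bsub>K\<^esub> f = \<alpha> \<star>\<^bsub>K\<^esub> id2 K f"

definition inv1 :: "('o, 'f, 'c, 'x) two_cat_scheme \<Rightarrow> 'f \<Rightarrow> 'f" where
  "inv1 K f = (THE g. g \<in> arr K \<and> dom1 K g = cod1 K f \<and> cod1 K g = dom1 K f \<and>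
     g \<odot>\<^bsub>K\<^esub> f = id1 K (dom1 K f) \<and> f \<odot>\<^bsub>K\<^esub> g = id1 K (cod1 K f))"

definition invertible2 :: "('o, 'f, 'c, 'x) two_cat_scheme \<Rightarrow> 'c \<Rightarrow> bool" where
  "invertible2 K \<alpha> \<longleftrightarrow> (\<exists>\<beta> \<in> cell K. dom2 K \<beta> = cod2 K \<alpha> \<and> cod2 K \<beta> = dom2 K \<alpha> \<and>
     \<beta> \<bullet>\<^bsub>K\<^esub> \<alpha> = id2 K (dom2 K \<alpha>) \<and> \<alpha> \<bullet>\<^bsub>K\<^esub> \<beta> = id2 K (cod2 K \<alpha>))"


section \<open>Finite products\<close>

record ('o, 'f, 'c) fp_two_cat = "('o, 'f, 'c) two_cat" +
  one :: "'o"
  prd :: "'o \<Rightarrow> 'o \<Rightarrow> 'o"  (infixr "\<otimes>\<index>" 80)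
  pr1 :: "'o \<Rightarrow> 'o \<Rightarrow> 'f"
  pr2 :: "'o \<Rightarrow> 'o \<Rightarrow> 'f"

text \<open>
  Products are strict 2-limits: \<open>K(X, A \<otimes> B) \<rightarrow> K(X, A) \<times> K(X, B)\<close> is an isomorphism of
  categories, that is, bijective on 1-cells and on 2-cells; and \<open>K(X, 1)\<close> is the terminal
  category.
\<close>

locale fp_two_category = two_category K
  for K :: "('o, 'f, 'c) fp_two_cat" (structure) +
  assumes one_ob: "one K \<in> ob K"
    and one_universal1: "X \<in> ob K \<Longrightarrow> \<exists>!h. h \<in> arr K \<and> dom1 K h = X \<and> cod1 K h = one K"
    and one_universal2: "X \<in> ob K \<Longrightarrow>
      \<exists>!\<gamma>. \<gamma> \<in> cell K \<and> dom1 K (dom2 K \<gamma>) = X \<and> cod1 K (dom2 K \<gamma>) = one K"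
    and prd_ob: "\<lbrakk>A \<in> ob K; B \<in> ob K\<rbrakk> \<Longrightarrow> A \<otimes> B \<in> ob K"
    and pr1_arr: "\<lbrakk>A \<in> ob K; B \<in> ob K\<rbrakk> \<Longrightarrow>
      pr1 K A B \<in> arr K \<and> dom1 K (pr1 K A B) = A \<otimes> B \<and> cod1 K (pr1 K A B) = A"
    and pr2_arr: "\<lbrakk>A \<in> ob K; B \<in> ob K\<rbrakk> \<Longrightarrow>
      pr2 K A B \<in> arr K \<and> dom1 K (pr2 K A B) = A \<otimes> B \<and> cod1 K (pr2 K A B) = B"
    and prd_universal1: "\<lbrakk>f \<in> arr K; g \<in> arr K; dom1 K f = dom1 K g\<rbrakk> \<Longrightarrow>
      \<exists>!h. h \<in> arr K \<and> dom1 K h = dom1 K f \<and> cod1 K h = cod1 K f \<otimes> cod1 K g \<and>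
        pr1 K (cod1 K f) (cod1 K g) \<odot> h = f \<and> pr2 K (cod1 K f) (cod1 K g) \<odot> h = g"
    and prd_universal2: "\<lbrakk>\<alpha> \<in> cell K; \<beta> \<in> cell K; dom1 K (dom2 K \<alpha>) = dom1 K (dom2 K \<beta>);
        A = cod1 K (dom2 K \<alpha>); B = cod1 K (dom2 K \<beta>)\<rbrakk> \<Longrightarrow>
      \<exists>!\<gamma>. \<gamma> \<in> cell K \<and> dom1 K (dom2 K \<gamma>) = dom1 K (dom2 K \<alpha>) \<and>
        cod1 K (dom2 K \<gamma>) = A \<otimes> B \<and> pr1 K A B \<rhd> \<gamma> = \<alpha> \<and> pr2 K A B \<rhd> \<gamma> = \<beta>"

definition pair1 :: "('o, 'f, 'c) fp_two_cat \<Rightarrow> 'f \<Rightarrow> 'f \<Rightarrow> 'f" where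
  "pair1 K f g = (THE h. h \<in> arr K \<and> dom1 K h = dom1 K f \<and>
     cod1 K h = cod1 K f \<otimes>\<^bsub>K\<^esub> cod1 K g \<and>
     pr1 K (cod1 K f) (cod1 K g) \<odot>\<^bsub>K\<^esub> h = f \<and> pr2 K (cod1 K f) (cod1 K g) \<odot>\<^bsub>K\<^esub> h = g)"

definition pair2 :: "('o, 'f, 'c) fp_two_cat \<Rightarrow> 'c \<Rightarrow> 'c \<Rightarrow> 'c" where
  "pair2 K \<alpha> \<beta> = (let A = cod1 K (dom2 K \<alpha>); B = cod1 K (dom2 K \<beta>) in
     THE \<gamma>. \<gamma> \<in> cell K \<and> dom1 K (dom2 K \<gamma>) = dom1 K (dom2 K \<alpha>) \<and>
       cod1 K (dom2 K \<gamma>) = A \<otimes>\<^bsub>K\<^esub> B \<and> pr1 K A B \<rhd>\<^bsub>K\<^esub> \<gamma> = \<alpha> \<and> pr2 K A B \<rhd>\<^bsub>K\<^esub> \<gamma> = \<beta>)"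

definition prod1 :: "('o, 'f, 'c) fp_two_cat \<Rightarrow> 'f \<Rightarrow> 'f \<Rightarrow> 'f"  (infixr "\<otimes>\<^sub>1\<index>" 80) where
  "f \<otimes>\<^sub>1\<^bsub>K\<^esub> g = pair1 K (f \<odot>\<^bsub>K\<^esub> pr1 K (dom1 K f) (dom1 K g)) (g \<odot>\<^bsub>K\<^esub> pr2 K (dom1 K f) (dom1 K g))"

definition prod2 :: "('o, 'f, 'c) fp_two_cat \<Rightarrow> 'c \<Rightarrow> 'c \<Rightarrow> 'c"  (infixr "\<otimes>\<^sub>2\<index>" 80) where
  "\<alpha> \<otimes>\<^sub>2\<^bsub>K\<^esub> \<beta> = (let A = dom1 K (dom2 K \<alpha>); B = dom1 K (dom2 K \<beta>) in
     pair2 K (\<alpha> \<lhd>\<^bsub>K\<^esub> pr1 K A B) (\<beta> \<lhd>\<^bsub>K\<^esub> pr2 K A B))"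

definition swap :: "('o, 'f, 'c) fp_two_cat \<Rightarrow> 'o \<Rightarrow> 'o \<Rightarrow> 'f" where
  "swap K A B = pair1 K (pr2 K A B) (pr1 K A B)"

text \<open>The associativity isomorphism from \<open>(A \<otimes> B) \<otimes> C\<close> to \<open>A \<otimes> (B \<otimes> C)\<close>.\<close>

definition assoc :: "('o, 'f, 'c) fp_two_cat \<Rightarrow> 'o \<Rightarrow> 'o \<Rightarrow> 'o \<Rightarrow> 'f" where
  "assoc K A B C = (let p = pr1 K (A \<otimes>\<^bsub>K\<^esub> B) C in
     pair1 K (pr1 K A B \<odot>\<^bsub>K\<^esub> p) (pair1 K (pr2 K A B \<odot>\<^bsub>K\<^esub> p) (pr2 K (A \<otimes>\<^bsub>K\<^esub> B) C)))"

text \<open>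
  Families are indexed by \<open>1, \<dots>, n\<close> and their products are bracketed to the left,
  \<open>((X 1 \<otimes> X 2) \<otimes> \<dots>) \<otimes> X n\<close>; the value of the functions below at \<open>n = 0\<close> is irrelevant, and is
  left unspecified where no canonical choice exists.
\<close>

fun nprod :: "('o, 'f, 'c) fp_two_cat \<Rightarrow> (nat \<Rightarrow> 'o) \<Rightarrow> nat \<Rightarrow> 'o" where
  "nprod K X 0 = one K"
| "nprod K X (Suc 0) = X 1"
| "nprod K X (Suc (Suc n)) = nprod K X (Suc n) \<otimes>\<^bsub>K\<^esub> X (Suc (Suc n))"

fun nproj :: "('o, 'f, 'c) fp_two_cat \<Rightarrow> (nat \<Rightarrow> 'o) \<Rightarrow> nat \<Rightarrow> nat \<Rightarrow> 'f" where
  "nproj K X (Suc 0) k = id1 K (X 1)"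
| "nproj K X (Suc (Suc n)) k =
     (if k = Suc (Suc n) then pr2 K (nprod K X (Suc n)) (X (Suc (Suc n)))
      else nproj K X (Suc n) k \<odot>\<^bsub>K\<^esub> pr1 K (nprod K X (Suc n)) (X (Suc (Suc n))))"

fun ntuple :: "('o, 'f, 'c) fp_two_cat \<Rightarrow> (nat \<Rightarrow> 'f) \<Rightarrow> nat \<Rightarrow> 'f" where
  "ntuple K f (Suc 0) = f 1"
| "ntuple K f (Suc (Suc n)) = pair1 K (ntuple K f (Suc n)) (f (Suc (Suc n)))"

fun nprod2 :: "('o, 'f, 'c) fp_two_cat \<Rightarrow> (nat \<Rightarrow> 'c) \<Rightarrow> nat \<Rightarrow> 'c" where
  "nprod2 K \<alpha> (Suc 0) = \<alpha> 1"
| "nprod2 K \<alpha> (Suc (Suc n)) = nprod2 K \<alpha> (Suc n) \<otimes>\<^sub>2\<^bsub>K\<^esub> \<alpha> (Suc (Suc n))"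

text \<open>
  The canonical isomorphism from \<open>X (\<sigma> 1) \<otimes> \<dots> \<otimes> X (\<sigma> n)\<close> to \<open>X 1 \<otimes> \<dots> \<otimes> X n\<close>: the factor
  \<open>X k\<close> of the codomain is in position \<open>inv \<sigma> k\<close> of the domain.
\<close>

definition perm1 :: "('o, 'f, 'c) fp_two_cat \<Rightarrow> (nat \<Rightarrow> 'o) \<Rightarrow> nat \<Rightarrow> (nat \<Rightarrow> nat) \<Rightarrow> 'f" where
  "perm1 K X n \<sigma> = ntuple K (\<lambda>k. nproj K (X \<circ> \<sigma>) n (inv \<sigma> k)) n"

text \<open>
  The family \<open>x 1, \<dots>, x (i - 1), y, x (i + 2), x (i + 3), \<dots>\<close>, in which \<open>y\<close> has replaced both
  \<open>x i\<close> and \<open>x (i + 1)\<close>.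
\<close>

definition merge :: "nat \<Rightarrow> (nat \<Rightarrow> 'a) \<Rightarrow> 'a \<Rightarrow> nat \<Rightarrow> 'a" where
  "merge i x y = (\<lambda>k. if k < i then x k else if k = i then y else x (Suc k))"

text \<open>
  The canonical isomorphism from \<open>X 1 \<otimes> \<dots> \<otimes> X n\<close> to
  \<open>X 1 \<otimes> \<dots> \<otimes> (X i \<otimes> X (i + 1)) \<otimes> \<dots> \<otimes> X n\<close>, the latter being a product of \<open>n - 1\<close> factors.
\<close>

definition group1 :: "('o, 'f, 'c) fp_two_cat \<Rightarrow> (nat \<Rightarrow> 'o) \<Rightarrow> nat \<Rightarrow> nat \<Rightarrow> 'f" where
  "group1 K X n i =
     ntuple K (merge i (nproj K X n) (pair1 K (nproj K X n i) (nproj K X n (Suc i)))) (n - 1)"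


section \<open>Strong 2-monads\<close>

record ('o, 'f, 'c) strong_monad =
  T0 :: "'o \<Rightarrow> 'o"
  T1 :: "'f \<Rightarrow> 'f"
  T2 :: "'c \<Rightarrow> 'c"
  eta :: "'o \<Rightarrow> 'f"
  mu :: "'o \<Rightarrow> 'f"
  str :: "'o \<Rightarrow> 'o \<Rightarrow> 'f"

locale strong_two_monad = fp_two_category K
  for K :: "('o, 'f, 'c) fp_two_cat" (structure) +
  fixes M :: "('o, 'f, 'c) strong_monad"
  assumes T_one_functor: "cat_functor (one_cat K) (one_cat K) (T0 M) (T1 M)"
    and T_vert_functor: "cat_functor (vert_cat K) (vert_cat K) (T1 M) (T2 M)"
    and T_horiz_functor: "cat_functor (horiz_cat K) (horiz_cat K) (T0 M) (T2 M)"
    and eta_arr: "A \<in> ob K \<Longrightarrow>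
      eta M A \<in> arr K \<and> dom1 K (eta M A) = A \<and> cod1 K (eta M A) = T0 M A"
    and eta_natural1: "f \<in> arr K \<Longrightarrow> T1 M f \<odot> eta M (dom1 K f) = eta M (cod1 K f) \<odot> f"
    and eta_natural2: "\<alpha> \<in> cell K \<Longrightarrow>
      T2 M \<alpha> \<lhd> eta M (dom1 K (dom2 K \<alpha>)) = eta M (cod1 K (dom2 K \<alpha>)) \<rhd> \<alpha>"
    and mu_arr: "A \<in> ob K \<Longrightarrow>
      mu M A \<in> arr K \<and> dom1 K (mu M A) = T0 M (T0 M A) \<and> cod1 K (mu M A) = T0 M A"
    and mu_natural1: "f \<in> arr K \<Longrightarrow>
      T1 M f \<odot> mu M (dom1 K f) = mu M (cod1 K f) \<odot> T1 M (T1 M f)"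
    and mu_natural2: "\<alpha> \<in> cell K \<Longrightarrow>
      T2 M \<alpha> \<lhd> mu M (dom1 K (dom2 K \<alpha>)) = mu M (cod1 K (dom2 K \<alpha>)) \<rhd> T2 M (T2 M \<alpha>)"
    and mu_eta: "A \<in> ob K \<Longrightarrow> mu M A \<odot> eta M (T0 M A) = id1 K (T0 M A)"
    and mu_T_eta: "A \<in> ob K \<Longrightarrow> mu M A \<odot> T1 M (eta M A) = id1 K (T0 M A)"
    and mu_mu: "A \<in> ob K \<Longrightarrow> mu M A \<odot> mu M (T0 M A) = mu M A \<odot> T1 M (mu M A)"
    and str_arr: "\<lbrakk>A \<in> ob K; B \<in> ob K\<rbrakk> \<Longrightarrow>
      str M A B \<in> arr K \<and> dom1 K (str M A B) = A \<otimes> T0 M B \<and> cod1 K (str M A B) = T0 M (A \<otimes> B)"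
    and str_natural1: "\<lbrakk>f \<in> arr K; g \<in> arr K\<rbrakk> \<Longrightarrow>
      T1 M (f \<otimes>\<^sub>1 g) \<odot> str M (dom1 K f) (dom1 K g) =
      str M (cod1 K f) (cod1 K g) \<odot> (f \<otimes>\<^sub>1 T1 M g)"
    and str_natural2: "\<lbrakk>\<alpha> \<in> cell K; \<beta> \<in> cell K\<rbrakk> \<Longrightarrow>
      T2 M (\<alpha> \<otimes>\<^sub>2 \<beta>) \<lhd> str M (dom1 K (dom2 K \<alpha>)) (dom1 K (dom2 K \<beta>)) =
      str M (cod1 K (dom2 K \<alpha>)) (cod1 K (dom2 K \<beta>)) \<rhd> (\<alpha> \<otimes>\<^sub>2 T2 M \<beta>)"
    and str_one: "A \<in> ob K \<Longrightarrow> T1 M (pr2 K (one K) A) \<odot> str M (one K) A = pr2 K (one K) (T0 M A)"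
    and str_assoc: "\<lbrakk>A \<in> ob K; B \<in> ob K; C \<in> ob K\<rbrakk> \<Longrightarrow>
      str M A (B \<otimes> C) \<odot> (id1 K A \<otimes>\<^sub>1 str M B C) \<odot> assoc K A B (T0 M C) =
      T1 M (assoc K A B C) \<odot> str M (A \<otimes> B) C"
    and str_eta: "\<lbrakk>A \<in> ob K; B \<in> ob K\<rbrakk> \<Longrightarrow> str M A B \<odot> (id1 K A \<otimes>\<^sub>1 eta M B) = eta M (A \<otimes> B)"
    and str_mu: "\<lbrakk>A \<in> ob K; B \<in> ob K\<rbrakk> \<Longrightarrow>
      str M A B \<odot> (id1 K A \<otimes>\<^sub>1 mu M B) = mu M (A \<otimes> B) \<odot> T1 M (str M A B) \<odot> str M A (T0 M B)"

text \<open>The strength \<open>t\<^sub>2\<close> is \<^const>\<open>str\<close>; \<open>t\<^sub>1\<close> is its conjugate by the symmetry.\<close>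

definition str1 :: "('o, 'f, 'c) fp_two_cat \<Rightarrow> ('o, 'f, 'c) strong_monad \<Rightarrow> 'o \<Rightarrow> 'o \<Rightarrow> 'f" where
  "str1 K M A B = T1 M (swap K B A) \<odot>\<^bsub>K\<^esub> str M B A \<odot>\<^bsub>K\<^esub> swap K (T0 M A) B"

definition omega :: "('o, 'f, 'c) fp_two_cat \<Rightarrow> ('o, 'f, 'c) strong_monad \<Rightarrow> 'o \<Rightarrow> 'o \<Rightarrow> 'f" where
  "omega K M A B = mu M (A \<otimes>\<^bsub>K\<^esub> B) \<odot>\<^bsub>K\<^esub> T1 M (str M A B) \<odot>\<^bsub>K\<^esub> str1 K M A (T0 M B)"

definition omega' :: "('o, 'f, 'c) fp_two_cat \<Rightarrow> ('o, 'f, 'c) strong_monad \<Rightarrow> 'o \<Rightarrow> 'o \<Rightarrow> 'f" where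
  "omega' K M A B = mu M (A \<otimes>\<^bsub>K\<^esub> B) \<odot>\<^bsub>K\<^esub> T1 M (str1 K M A B) \<odot>\<^bsub>K\<^esub> str M (T0 M A) B"

fun nomega ::
  "('o, 'f, 'c) fp_two_cat \<Rightarrow> ('o, 'f, 'c) strong_monad \<Rightarrow> (nat \<Rightarrow> 'o) \<Rightarrow> nat \<Rightarrow> 'f" where
  "nomega K M A (Suc 0) = id1 K (T0 M (A 1))"
| "nomega K M A (Suc (Suc n)) = omega K M (nprod K A (Suc n)) (A (Suc (Suc n))) \<odot>\<^bsub>K\<^esub>
     (nomega K M A (Suc n) \<otimes>\<^sub>1\<^bsub>K\<^esub> id1 K (T0 M (A (Suc (Suc n)))))"


section \<open>Pseudo commutativity\<close>

text \<open>
  \<open>\<Gamma>\<close> is compared only on 1-cells in \<open>G_modification\<close> because that is all a modification between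
  2-natural transformations requires.  In \<open>G_1\<close>, \<open>G_2\<close> and \<open>G_3\<close> the two sides are matched along
  the associativity isomorphisms.
\<close>

locale pseudo_commutative_monad = strong_two_monad K M
  for K :: "('o, 'f, 'c) fp_two_cat" (structure) and M :: "('o, 'f, 'c) strong_monad" +
  fixes \<Gamma> :: "'o \<Rightarrow> 'o \<Rightarrow> 'c"
  assumes G_cell: "\<lbrakk>A \<in> ob K; B \<in> ob K\<rbrakk> \<Longrightarrow>
      \<Gamma> A B \<in> cell K \<and> dom2 K (\<Gamma> A B) = omega K M A B \<and> cod2 K (\<Gamma> A B) = omega' K M A B"
    and G_invertible: "\<lbrakk>A \<in> ob K; B \<in> ob K\<rbrakk> \<Longrightarrow> invertible2 K (\<Gamma> A B)"
    and G_modification: "\<lbrakk>f \<in> arr K; g \<in> arr K\<rbrakk> \<Longrightarrow>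
      T1 M (f \<otimes>\<^sub>1 g) \<rhd> \<Gamma> (dom1 K f) (dom1 K g) =
      \<Gamma> (cod1 K f) (cod1 K g) \<lhd> (T1 M f \<otimes>\<^sub>1 T1 M g)"
    and G_1: "\<lbrakk>A \<in> ob K; B \<in> ob K; C \<in> ob K\<rbrakk> \<Longrightarrow>
      T1 M (assoc K A B C) \<rhd> (\<Gamma> (A \<otimes> B) C \<lhd> (str M A B \<otimes>\<^sub>1 id1 K (T0 M C))) =
      (str M A (B \<otimes> C) \<rhd> (id2 K (id1 K A) \<otimes>\<^sub>2 \<Gamma> B C)) \<lhd> assoc K A (T0 M B) (T0 M C)"
    and G_2: "\<lbrakk>A \<in> ob K; B \<in> ob K; C \<in> ob K\<rbrakk> \<Longrightarrow>
      (\<Gamma> A (B \<otimes> C) \<lhd> (id1 K (T0 M A) \<otimes>\<^sub>1 str M B C)) \<lhd> assoc K (T0 M A) B (T0 M C) =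
      T1 M (assoc K A B C) \<rhd> (\<Gamma> (A \<otimes> B) C \<lhd> (str1 K M A B \<otimes>\<^sub>1 id1 K (T0 M C)))"
    and G_3: "\<lbrakk>A \<in> ob K; B \<in> ob K; C \<in> ob K\<rbrakk> \<Longrightarrow>
      (\<Gamma> A (B \<otimes> C) \<lhd> (id1 K (T0 M A) \<otimes>\<^sub>1 str1 K M B C)) \<lhd> assoc K (T0 M A) (T0 M B) C =
      T1 M (assoc K A B C) \<rhd> (str1 K M (A \<otimes> B) C \<rhd> (\<Gamma> A B \<otimes>\<^sub>2 id2 K (id1 K C)))"
    and G_4: "\<lbrakk>A \<in> ob K; B \<in> ob K\<rbrakk> \<Longrightarrow>
      \<exists>f \<in> arr K. \<Gamma> A B \<lhd> (eta M A \<otimes>\<^sub>1 id1 K (T0 M B)) = id2 K f"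
    and G_5: "\<lbrakk>A \<in> ob K; B \<in> ob K\<rbrakk> \<Longrightarrow>
      \<exists>f \<in> arr K. \<Gamma> A B \<lhd> (id1 K (T0 M A) \<otimes>\<^sub>1 eta M B) = id2 K f"
    and G_6: "\<lbrakk>A \<in> ob K; B \<in> ob K\<rbrakk> \<Longrightarrow>
      \<Gamma> A B \<lhd> (mu M A \<otimes>\<^sub>1 id1 K (T0 M B)) =
      ((mu M (A \<otimes> B) \<odot> T1 M (str1 K M A B)) \<rhd> \<Gamma> (T0 M A) B) \<bullet>
      (mu M (A \<otimes> B) \<rhd> (T2 M (\<Gamma> A B) \<lhd> str1 K M (T0 M A) (T0 M B)))"
    and G_7: "\<lbrakk>A \<in> ob K; B \<in> ob K\<rbrakk> \<Longrightarrow>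
      \<Gamma> A B \<lhd> (id1 K (T0 M A) \<otimes>\<^sub>1 mu M B) =
      (mu M (A \<otimes> B) \<rhd> (T2 M (\<Gamma> A B) \<lhd> str M (T0 M A) (T0 M B))) \<bullet>
      ((mu M (A \<otimes> B) \<odot> T1 M (str M A B)) \<rhd> \<Gamma> A (T0 M B))"


section \<open>The weak right order\<close>

definition inversions :: "nat \<Rightarrow> (nat \<Rightarrow> nat) \<Rightarrow> nat" where
  "inversions n \<sigma> = card {(i, j). 1 \<le> i \<and> i < j \<and> j \<le> n \<and> \<sigma> j < \<sigma> i}"

definition symmetric_group :: "nat \<Rightarrow> (nat \<Rightarrow> nat) set" where
  "symmetric_group n = {\<sigma>. \<sigma> permutes {1..n}}"

definition weak_right_order :: "nat \<Rightarrow> (nat \<Rightarrow> nat) rel" where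
  "weak_right_order n =
    {(\<sigma>, \<sigma> \<circ> transpose i (Suc i)) | \<sigma> i. \<sigma> \<in> symmetric_group n \<and> 1 \<le> i \<and> i < n \<and>
       inversions n \<sigma> < inversions n (\<sigma> \<circ> transpose i (Suc i))}\<^sup>*"

definition weak_order_cat ::
  "nat \<Rightarrow> (nat \<Rightarrow> nat, (nat \<Rightarrow> nat) \<times> (nat \<Rightarrow> nat)) cat" where
  "weak_order_cat n = order_cat (symmetric_group n) (weak_right_order n)"


section \<open>The 1-cells and generating 2-cells indexed by permutations\<close>

definition omega_perm ::
  "('o, 'f, 'c) fp_two_cat \<Rightarrow> ('o, 'f, 'c) strong_monad \<Rightarrow> (nat \<Rightarrow> 'o) \<Rightarrow> nat \<Rightarrow>
   (nat \<Rightarrow> nat) \<Rightarrow> 'f" where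
  "omega_perm K M A n \<sigma> =
     T1 M (perm1 K A n \<sigma>) \<odot>\<^bsub>K\<^esub> nomega K M (A \<circ> \<sigma>) n \<odot>\<^bsub>K\<^esub> inv1 K (perm1 K (T0 M \<circ> A) n \<sigma>)"

text \<open>
  The 2-cell \<open>1 \<times> \<Gamma> \<times> 1\<close> on \<open>T X\<^sub>1 \<times> \<dots> \<times> T X\<^sub>n\<close>, with \<open>\<Gamma>\<close> in positions \<open>i\<close> and \<open>i + 1\<close>;
  the regrouping of its domain is made explicit, and its codomain is the left-bracketed product
  \<open>T X\<^sub>1 \<times> \<dots> \<times> T (X\<^sub>i \<times> X\<^sub>i\<^sub>+\<^sub>1) \<times> \<dots> \<times> T X\<^sub>n\<close>.
\<close>

definition one_Gamma_one ::
  "('o, 'f, 'c) fp_two_cat \<Rightarrow> ('o, 'f, 'c) strong_monad \<Rightarrow> ('o \<Rightarrow> 'o \<Rightarrow> 'c) \<Rightarrow>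
   (nat \<Rightarrow> 'o) \<Rightarrow> nat \<Rightarrow> nat \<Rightarrow> 'c" where
  "one_Gamma_one K M \<Gamma> X n i =
     nprod2 K (merge i (\<lambda>k. id2 K (id1 K (T0 M (X k)))) (\<Gamma> (X i) (X (Suc i)))) (n - 1)
       \<lhd>\<^bsub>K\<^esub> group1 K (T0 M \<circ> X) n i"

definition Omega_step ::
  "('o, 'f, 'c) fp_two_cat \<Rightarrow> ('o, 'f, 'c) strong_monad \<Rightarrow> ('o \<Rightarrow> 'o \<Rightarrow> 'c) \<Rightarrow>
   (nat \<Rightarrow> 'o) \<Rightarrow> nat \<Rightarrow> (nat \<Rightarrow> nat) \<Rightarrow> nat \<Rightarrow> 'c" where
  "Omega_step K M \<Gamma> A n \<sigma> i = (let X = A \<circ> \<sigma> in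
     (T1 M (perm1 K A n \<sigma>) \<odot>\<^bsub>K\<^esub> T1 M (inv1 K (group1 K X n i)) \<odot>\<^bsub>K\<^esub>
        nomega K M (merge i X (X i \<otimes>\<^bsub>K\<^esub> X (Suc i))) (n - 1))
     \<rhd>\<^bsub>K\<^esub> (one_Gamma_one K M \<Gamma> X n i \<lhd>\<^bsub>K\<^esub> inv1 K (perm1 K (T0 M \<circ> A) n \<sigma>)))"

end

theory Submission
  imports Defs
begin

text \<open>
  \<open>\<Omega>\<close> sends a relation of the weak order to the composite of the generating 2-cells along any ascending
  path.  Two ascending paths with the same ends are related by commuting squares (transpositions at
  distance at least 2) and hexagons (adjacent transpositions): a confluence argument, using that
  \<open>\<sigma> \<le> \<tau>\<close> if and only if the value inversions of \<open>\<sigma>\<close> are among those of \<open>\<tau>\<close>.  The squares commute by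
  interchange.  For the hexagons, \<open>\<omega> = \<mu> \<circ> T t\<^sub>2 \<circ> t\<^sub>1\<close> and axioms (7), (3), (2), (1) express
  \<open>\<Gamma> \<circ> (1 \<times> \<omega>)\<close> on \<open>A, B \<times> C\<close> by \<open>\<Gamma>\<close> on \<open>A, B\<close> and on \<open>A, C\<close>; evaluating \<open>\<Gamma> \<circ> (1 \<times> \<Gamma>)\<close> by interchange
  in two ways then gives the Yang-Baxter equation.
\<close>

text \<open>Two obstacles shape the proof. First, \<open>\<Gamma>\<close> is not symmetric: crossing
  an edge of the symmetric group and coming back need not give an identity, so a 2-cell depends on a
  word and not only on its ends. Only ascending words are therefore compared, and two such words
  with the same ends are linked by braid relations alone, without the relation that a transposition
  squares to the identity. Second, products are bracketed explicitly to the left, so the Yang-Baxter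
  equation on three factors has to be transported into a long product and through a permutation. No
  coherence theorem is invoked: a 1-cell into a product is determined by its components, and every
  iterated \<open>\<omega>\<close> is followed by \<open>T\<close> of such a 1-cell, so a change of
  bracketing or of order becomes an equation between families of projections. The confluence
  argument terminates because each ascending step adds one value inversion, so that the number of
  value inversions of the end which are still missing decreases.\<close>

section \<open>2-cells under horizontal composition\<close>

text \<open>
  A 1-cell \<open>f\<close> is represented throughout by its identity 2-cell, so that one calculus of 2-cells under
  \<open>\<star>\<close>, a category with finite products, covers 1-cells and 2-cells at once.  Accordingly the vertical
  source and target \<open>vsrc\<close> and \<open>vtrg\<close> are identity 2-cells, and \<open>vsrc \<alpha> = \<alpha>\<close> says that \<open>\<alpha>\<close> is a 1-cell.
\<close>

context two_category
begin

definition src :: "'c \<Rightarrow> 'o" where "src \<alpha> = dom1 K (dom2 K \<alpha>)"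
definition trg :: "'c \<Rightarrow> 'o" where "trg \<alpha> = cod1 K (dom2 K \<alpha>)"
definition vsrc :: "'c \<Rightarrow> 'c" where "vsrc \<alpha> = id2 K (dom2 K \<alpha>)"
definition vtrg :: "'c \<Rightarrow> 'c" where "vtrg \<alpha> = id2 K (cod2 K \<alpha>)"
definition hid :: "'o \<Rightarrow> 'c" where "hid X = id2 K (id1 K X)"

lemmas one_facts [simp] =
  category.Dom_closed[OF one_category, unfolded one_cat_def, simplified]
  category.Cod_closed[OF one_category, unfolded one_cat_def, simplified]
  category.Id_closed[OF one_category, unfolded one_cat_def, simplified]
  category.Dom_Id[OF one_category, unfolded one_cat_def, simplified]
  category.Cod_Id[OF one_category, unfolded one_cat_def, simplified]
  category.Comp_closed[OF one_category, unfolded one_cat_def, simplified]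
  category.Dom_Comp[OF one_category, unfolded one_cat_def, simplified]
  category.Cod_Comp[OF one_category, unfolded one_cat_def, simplified]

lemmas comp1_assoc = category.Comp_assoc[OF one_category, unfolded one_cat_def, simplified]

lemma comp1_id [simp]:
  "\<lbrakk>f \<in> arr K; dom1 K f = X\<rbrakk> \<Longrightarrow> f \<odot> id1 K X = f"
  "\<lbrakk>f \<in> arr K; cod1 K f = X\<rbrakk> \<Longrightarrow> id1 K X \<odot> f = f"
  using category.Comp_Id_right[OF one_category] category.Comp_Id_left[OF one_category]
  by (auto simp: one_cat_def)

lemmas vert_facts [simp] =
  category.Dom_closed[OF vert_category, unfolded vert_cat_def, simplified]
  category.Cod_closed[OF vert_category, unfolded vert_cat_def, simplified]
  category.Id_closed[OF vert_category, unfolded vert_cat_def, simplified]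
  category.Dom_Id[OF vert_category, unfolded vert_cat_def, simplified]
  category.Cod_Id[OF vert_category, unfolded vert_cat_def, simplified]

lemma src_ob [simp]: "\<alpha> \<in> cell K \<Longrightarrow> src \<alpha> \<in> ob K"
  and trg_ob [simp]: "\<alpha> \<in> cell K \<Longrightarrow> trg \<alpha> \<in> ob K"
  by (simp_all add: src_def trg_def)

lemma src_id2 [simp]: "f \<in> arr K \<Longrightarrow> src (id2 K f) = dom1 K f"
  and trg_id2 [simp]: "f \<in> arr K \<Longrightarrow> trg (id2 K f) = cod1 K f"
  and vsrc_id2 [simp]: "f \<in> arr K \<Longrightarrow> vsrc (id2 K f) = id2 K f"
  and vtrg_id2 [simp]: "f \<in> arr K \<Longrightarrow> vtrg (id2 K f) = id2 K f"
  by (simp_all add: src_def trg_def vsrc_def vtrg_def)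

lemma hid_cell [simp]: "X \<in> ob K \<Longrightarrow> hid X \<in> cell K"
  and src_hid [simp]: "X \<in> ob K \<Longrightarrow> src (hid X) = X"
  and trg_hid [simp]: "X \<in> ob K \<Longrightarrow> trg (hid X) = X"
  and vsrc_hid [simp]: "X \<in> ob K \<Longrightarrow> vsrc (hid X) = hid X"
  and vtrg_hid [simp]: "X \<in> ob K \<Longrightarrow> vtrg (hid X) = hid X"
  by (simp_all add: hid_def)

lemma hcomp_cell [simp]: "\<lbrakk>\<alpha> \<in> cell K; \<beta> \<in> cell K; src \<beta> = trg \<alpha>\<rbrakk> \<Longrightarrow> \<beta> \<star> \<alpha> \<in> cell K"
  and src_hcomp [simp]: "\<lbrakk>\<alpha> \<in> cell K; \<beta> \<in> cell K; src \<beta> = trg \<alpha>\<rbrakk> \<Longrightarrow> src (\<beta> \<star> \<alpha>) = src \<alpha>"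
  and trg_hcomp [simp]: "\<lbrakk>\<alpha> \<in> cell K; \<beta> \<in> cell K; src \<beta> = trg \<alpha>\<rbrakk> \<Longrightarrow> trg (\<beta> \<star> \<alpha>) = trg \<beta>"
  using category.Comp_closed[OF horiz_category] category.Dom_Comp[OF horiz_category]
    category.Cod_Comp[OF horiz_category]
  by (auto simp: horiz_cat_def src_def trg_def)

lemma hcomp_hid [simp]: "\<lbrakk>\<alpha> \<in> cell K; src \<alpha> = X\<rbrakk> \<Longrightarrow> \<alpha> \<star> hid X = \<alpha>"
  and hid_hcomp [simp]: "\<lbrakk>\<alpha> \<in> cell K; trg \<alpha> = X\<rbrakk> \<Longrightarrow> hid X \<star> \<alpha> = \<alpha>"
  using category.Comp_Id_right[OF horiz_category] category.Comp_Id_left[OF horiz_category]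
  by (auto simp: horiz_cat_def src_def trg_def hid_def)

lemma hcomp_assoc [simp]:
  "\<lbrakk>\<alpha> \<in> cell K; \<beta> \<in> cell K; \<gamma> \<in> cell K; src \<beta> = trg \<alpha>; src \<gamma> = trg \<beta>\<rbrakk>
    \<Longrightarrow> (\<gamma> \<star> \<beta>) \<star> \<alpha> = \<gamma> \<star> (\<beta> \<star> \<alpha>)"
  using category.Comp_assoc[OF horiz_category] by (auto simp: horiz_cat_def src_def trg_def)

lemma id2_comp1: "\<lbrakk>f \<in> arr K; g \<in> arr K; dom1 K g = cod1 K f\<rbrakk> \<Longrightarrow>
    id2 K (g \<odot> f) = id2 K g \<star> id2 K f"
  by (simp add: hcomp_id2)

lemma id2_inj: "\<lbrakk>f \<in> arr K; g \<in> arr K; id2 K f = id2 K g\<rbrakk> \<Longrightarrow> f = g"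
  by (metis vert_facts(4))

text \<open>A 1-cell is recovered from its identity 2-cell, so vertical composability can be
  expressed without leaving the calculus of 2-cells.\<close>

lemma vsrc_eq_iff: "\<lbrakk>\<alpha> \<in> cell K; \<beta> \<in> cell K\<rbrakk> \<Longrightarrow> vsrc \<beta> = vtrg \<alpha> \<longleftrightarrow> dom2 K \<beta> = cod2 K \<alpha>"
  unfolding vsrc_def vtrg_def using id2_inj by force

lemma vsrc_cell [simp]: "\<alpha> \<in> cell K \<Longrightarrow> vsrc \<alpha> \<in> cell K"
  and vtrg_cell [simp]: "\<alpha> \<in> cell K \<Longrightarrow> vtrg \<alpha> \<in> cell K"
  and src_vsrc [simp]: "\<alpha> \<in> cell K \<Longrightarrow> src (vsrc \<alpha>) = src \<alpha>"
  and trg_vsrc [simp]: "\<alpha> \<in> cell K \<Longrightarrow> trg (vsrc \<alpha>) = trg \<alpha>"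
  and src_vtrg [simp]: "\<alpha> \<in> cell K \<Longrightarrow> src (vtrg \<alpha>) = src \<alpha>"
  and trg_vtrg [simp]: "\<alpha> \<in> cell K \<Longrightarrow> trg (vtrg \<alpha>) = trg \<alpha>"
  and vsrc_vsrc [simp]: "\<alpha> \<in> cell K \<Longrightarrow> vsrc (vsrc \<alpha>) = vsrc \<alpha>"
  and vtrg_vsrc [simp]: "\<alpha> \<in> cell K \<Longrightarrow> vtrg (vsrc \<alpha>) = vsrc \<alpha>"
  and vsrc_vtrg [simp]: "\<alpha> \<in> cell K \<Longrightarrow> vsrc (vtrg \<alpha>) = vtrg \<alpha>"
  and vtrg_vtrg [simp]: "\<alpha> \<in> cell K \<Longrightarrow> vtrg (vtrg \<alpha>) = vtrg \<alpha>"
  by (simp_all add: vsrc_def vtrg_def src_def trg_def parallel_dom parallel_cod)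

lemma vtrg_if_vsrc: "\<lbrakk>\<alpha> \<in> cell K; vsrc \<alpha> = \<alpha>\<rbrakk> \<Longrightarrow> vtrg \<alpha> = \<alpha>"
  by (metis vtrg_vsrc)

lemma vsrc_hcomp [simp]:
  "\<lbrakk>\<alpha> \<in> cell K; \<beta> \<in> cell K; src \<beta> = trg \<alpha>\<rbrakk> \<Longrightarrow> vsrc (\<beta> \<star> \<alpha>) = vsrc \<beta> \<star> vsrc \<alpha>"
  and vtrg_hcomp [simp]:
  "\<lbrakk>\<alpha> \<in> cell K; \<beta> \<in> cell K; src \<beta> = trg \<alpha>\<rbrakk> \<Longrightarrow> vtrg (\<beta> \<star> \<alpha>) = vtrg \<beta> \<star> vtrg \<alpha>"
  by (simp_all add: vsrc_def vtrg_def src_def trg_def dom2_hcomp cod2_hcomp hcomp_id2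
      parallel_dom parallel_cod)

lemma vcomp_cell [simp]: "\<lbrakk>\<alpha> \<in> cell K; \<beta> \<in> cell K; vsrc \<beta> = vtrg \<alpha>\<rbrakk> \<Longrightarrow> \<beta> \<bullet> \<alpha> \<in> cell K"
  and dom2_vcomp: "\<lbrakk>\<alpha> \<in> cell K; \<beta> \<in> cell K; vsrc \<beta> = vtrg \<alpha>\<rbrakk> \<Longrightarrow> dom2 K (\<beta> \<bullet> \<alpha>) = dom2 K \<alpha>"
  and cod2_vcomp: "\<lbrakk>\<alpha> \<in> cell K; \<beta> \<in> cell K; vsrc \<beta> = vtrg \<alpha>\<rbrakk> \<Longrightarrow> cod2 K (\<beta> \<bullet> \<alpha>) = cod2 K \<beta>"
  using category.Comp_closed[OF vert_category] category.Dom_Comp[OF vert_category]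
    category.Cod_Comp[OF vert_category]
  by (auto simp: vert_cat_def vsrc_eq_iff)

lemma src_vcomp [simp]: "\<lbrakk>\<alpha> \<in> cell K; \<beta> \<in> cell K; vsrc \<beta> = vtrg \<alpha>\<rbrakk> \<Longrightarrow> src (\<beta> \<bullet> \<alpha>) = src \<alpha>"
  and trg_vcomp [simp]: "\<lbrakk>\<alpha> \<in> cell K; \<beta> \<in> cell K; vsrc \<beta> = vtrg \<alpha>\<rbrakk> \<Longrightarrow> trg (\<beta> \<bullet> \<alpha>) = trg \<alpha>"
  and vsrc_vcomp [simp]: "\<lbrakk>\<alpha> \<in> cell K; \<beta> \<in> cell K; vsrc \<beta> = vtrg \<alpha>\<rbrakk> \<Longrightarrow> vsrc (\<beta> \<bullet> \<alpha>) = vsrc \<alpha>"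
  and vtrg_vcomp [simp]: "\<lbrakk>\<alpha> \<in> cell K; \<beta> \<in> cell K; vsrc \<beta> = vtrg \<alpha>\<rbrakk> \<Longrightarrow> vtrg (\<beta> \<bullet> \<alpha>) = vtrg \<beta>"
  by (simp_all add: src_def trg_def vsrc_def vtrg_def dom2_vcomp cod2_vcomp
      flip: vsrc_eq_iff)

lemma vcomp_vsrc [simp]: "\<alpha> \<in> cell K \<Longrightarrow> \<alpha> \<bullet> vsrc \<alpha> = \<alpha>"
  and vtrg_vcomp_left [simp]: "\<alpha> \<in> cell K \<Longrightarrow> vtrg \<alpha> \<bullet> \<alpha> = \<alpha>"
  using category.Comp_Id_right[OF vert_category] category.Comp_Id_left[OF vert_category]
  by (auto simp: vert_cat_def vsrc_def vtrg_def)

lemma vcomp_id [simp]: "\<lbrakk>\<alpha> \<in> cell K; vsrc \<alpha> = \<alpha>\<rbrakk> \<Longrightarrow> \<alpha> \<bullet> \<alpha> = \<alpha>"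
  by (metis vcomp_vsrc)

lemma vcomp_assoc:
  "\<lbrakk>\<alpha> \<in> cell K; \<beta> \<in> cell K; \<gamma> \<in> cell K; vsrc \<beta> = vtrg \<alpha>; vsrc \<gamma> = vtrg \<beta>\<rbrakk>
    \<Longrightarrow> (\<gamma> \<bullet> \<beta>) \<bullet> \<alpha> = \<gamma> \<bullet> (\<beta> \<bullet> \<alpha>)"
  using category.Comp_assoc[OF vert_category] by (auto simp: vert_cat_def vsrc_eq_iff)

lemma vcomp_hcomp:
  "\<lbrakk>\<alpha> \<in> cell K; \<alpha>' \<in> cell K; \<beta> \<in> cell K; \<beta>' \<in> cell K; vsrc \<alpha>' = vtrg \<alpha>; vsrc \<beta>' = vtrg \<beta>;
     src \<beta> = trg \<alpha>\<rbrakk> \<Longrightarrow> (\<beta>' \<bullet> \<beta>) \<star> (\<alpha>' \<bullet> \<alpha>) = (\<beta>' \<star> \<alpha>') \<bullet> (\<beta> \<star> \<alpha>)"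
  by (rule interchange) (auto simp: vsrc_eq_iff src_def trg_def)

text \<open>Interchange with \<open>\<beta> = \<beta> \<bullet> \<beta>\<close>, which holds because
  \<open>\<beta>\<close> is a 1-cell.\<close>

lemma hcomp_vcomp:
  "\<lbrakk>\<alpha> \<in> cell K; \<alpha>' \<in> cell K; \<beta> \<in> cell K; vsrc \<alpha>' = vtrg \<alpha>; vsrc \<beta> = \<beta>; src \<beta> = trg \<alpha>\<rbrakk>
    \<Longrightarrow> \<beta> \<star> (\<alpha>' \<bullet> \<alpha>) = (\<beta> \<star> \<alpha>') \<bullet> (\<beta> \<star> \<alpha>)"
  using vcomp_hcomp[of \<alpha> \<alpha>' \<beta> \<beta>] by (simp add: vtrg_if_vsrc)

lemma vcomp_hcomp_id:
  "\<lbrakk>\<alpha> \<in> cell K; \<beta> \<in> cell K; \<beta>' \<in> cell K; vsrc \<beta>' = vtrg \<beta>; vsrc \<alpha> = \<alpha>; src \<beta> = trg \<alpha>\<rbrakk>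
    \<Longrightarrow> (\<beta>' \<bullet> \<beta>) \<star> \<alpha> = (\<beta>' \<star> \<alpha>) \<bullet> (\<beta> \<star> \<alpha>)"
  using vcomp_hcomp[of \<alpha> \<alpha> \<beta> \<beta>'] by (simp add: vtrg_if_vsrc)

end

section \<open>Binary products of 2-cells\<close>

context fp_two_category
begin

definition p1 :: "'o \<Rightarrow> 'o \<Rightarrow> 'c" where "p1 A B = id2 K (pr1 K A B)"
definition p2 :: "'o \<Rightarrow> 'o \<Rightarrow> 'c" where "p2 A B = id2 K (pr2 K A B)"
abbreviation pair :: "'c \<Rightarrow> 'c \<Rightarrow> 'c" where "pair \<equiv> pair2 K"

lemmas prd_ob' [simp] = prd_ob

lemma pr_arr [simp]:
  "\<lbrakk>A \<in> ob K; B \<in> ob K\<rbrakk> \<Longrightarrow> pr1 K A B \<in> arr K"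
  "\<lbrakk>A \<in> ob K; B \<in> ob K\<rbrakk> \<Longrightarrow> dom1 K (pr1 K A B) = A \<otimes> B"
  "\<lbrakk>A \<in> ob K; B \<in> ob K\<rbrakk> \<Longrightarrow> cod1 K (pr1 K A B) = A"
  "\<lbrakk>A \<in> ob K; B \<in> ob K\<rbrakk> \<Longrightarrow> pr2 K A B \<in> arr K"
  "\<lbrakk>A \<in> ob K; B \<in> ob K\<rbrakk> \<Longrightarrow> dom1 K (pr2 K A B) = A \<otimes> B"
  "\<lbrakk>A \<in> ob K; B \<in> ob K\<rbrakk> \<Longrightarrow> cod1 K (pr2 K A B) = B"
  using pr1_arr pr2_arr by auto

lemma p_cell [simp]:
  "\<lbrakk>A \<in> ob K; B \<in> ob K\<rbrakk> \<Longrightarrow> p1 A B \<in> cell K"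
  "\<lbrakk>A \<in> ob K; B \<in> ob K\<rbrakk> \<Longrightarrow> src (p1 A B) = A \<otimes> B"
  "\<lbrakk>A \<in> ob K; B \<in> ob K\<rbrakk> \<Longrightarrow> trg (p1 A B) = A"
  "\<lbrakk>A \<in> ob K; B \<in> ob K\<rbrakk> \<Longrightarrow> vsrc (p1 A B) = p1 A B"
  "\<lbrakk>A \<in> ob K; B \<in> ob K\<rbrakk> \<Longrightarrow> vtrg (p1 A B) = p1 A B"
  "\<lbrakk>A \<in> ob K; B \<in> ob K\<rbrakk> \<Longrightarrow> p2 A B \<in> cell K"
  "\<lbrakk>A \<in> ob K; B \<in> ob K\<rbrakk> \<Longrightarrow> src (p2 A B) = A \<otimes> B"
  "\<lbrakk>A \<in> ob K; B \<in> ob K\<rbrakk> \<Longrightarrow> trg (p2 A B) = B"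
  "\<lbrakk>A \<in> ob K; B \<in> ob K\<rbrakk> \<Longrightarrow> vsrc (p2 A B) = p2 A B"
  "\<lbrakk>A \<in> ob K; B \<in> ob K\<rbrakk> \<Longrightarrow> vtrg (p2 A B) = p2 A B"
  by (simp_all add: p1_def p2_def)

lemma pair_props:
  assumes "a \<in> cell K" "b \<in> cell K" "src b = src a"
  shows "pair a b \<in> cell K \<and> src (pair a b) = src a \<and> trg (pair a b) = trg a \<otimes> trg b \<and>
    p1 (trg a) (trg b) \<star> pair a b = a \<and> p2 (trg a) (trg b) \<star> pair a b = b"
proof -
  have "dom1 K (dom2 K a) = dom1 K (dom2 K b)" using assms by (simp add: src_def)
  from theI'[OF prd_universal2[OF assms(1,2) this refl refl]] show ?thesis
    by (simp add: pair2_def Let_def src_def trg_def p1_def p2_def lwhisker_def)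
qed

lemma pair_cell [simp]:
  "\<lbrakk>a \<in> cell K; b \<in> cell K; src b = src a\<rbrakk> \<Longrightarrow> pair a b \<in> cell K"
  "\<lbrakk>a \<in> cell K; b \<in> cell K; src b = src a\<rbrakk> \<Longrightarrow> src (pair a b) = src a"
  "\<lbrakk>a \<in> cell K; b \<in> cell K; src b = src a\<rbrakk> \<Longrightarrow> trg (pair a b) = trg a \<otimes> trg b"
  using pair_props by auto

lemma p_pair [simp]:
  "\<lbrakk>a \<in> cell K; b \<in> cell K; src b = src a; trg a = A; trg b = B\<rbrakk> \<Longrightarrow> p1 A B \<star> pair a b = a"
  "\<lbrakk>a \<in> cell K; b \<in> cell K; src b = src a; trg a = A; trg b = B\<rbrakk> \<Longrightarrow> p2 A B \<star> pair a b = b"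
  using pair_props by auto

lemma pair_unique:
  assumes "g \<in> cell K" "h \<in> cell K" "src h = src g" "trg g = A \<otimes> B" "trg h = A \<otimes> B"
    "A \<in> ob K" "B \<in> ob K" "p1 A B \<star> g = p1 A B \<star> h" "p2 A B \<star> g = p2 A B \<star> h"
  shows "g = h"
proof -
  let ?a = "p1 A B \<star> g" and ?b = "p2 A B \<star> g"
  have "?a \<in> cell K" "?b \<in> cell K" "dom1 K (dom2 K ?a) = dom1 K (dom2 K ?b)"
    "A = cod1 K (dom2 K ?a)" "B = cod1 K (dom2 K ?b)"
    using assms by (simp_all flip: src_def trg_def)
  from prd_universal2[OF this] show ?thesis
    using assms unfolding lwhisker_def p1_def[symmetric] p2_def[symmetric]
      src_def[symmetric] trg_def[symmetric]
    by (metis p_cell(1,2) src_hcomp)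
qed

lemma pair_hcomp [simp]:
  assumes "a \<in> cell K" "b \<in> cell K" "src b = src a" "w \<in> cell K" "src a = trg w"
  shows "pair a b \<star> w = pair (a \<star> w) (b \<star> w)"
proof (rule pair_unique[of _ _ "trg a" "trg b"])
  show "p1 (trg a) (trg b) \<star> pair a b \<star> w = p1 (trg a) (trg b) \<star> pair (a \<star> w) (b \<star> w)"
    using assms by (simp flip: hcomp_assoc)
  show "p2 (trg a) (trg b) \<star> pair a b \<star> w = p2 (trg a) (trg b) \<star> pair (a \<star> w) (b \<star> w)"
    using assms by (simp flip: hcomp_assoc)
qed (use assms in simp_all)

lemma pair_p [simp]:
  assumes "A \<in> ob K" "B \<in> ob K"
  shows "pair (p1 A B) (p2 A B) = hid (A \<otimes> B)"
  by (rule pair_unique[of _ _ A B]) (use assms in simp_all)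

lemma pair_p_hcomp [simp]:
  assumes "A \<in> ob K" "B \<in> ob K" "h \<in> cell K" "trg h = A \<otimes> B"
  shows "pair (p1 A B \<star> h) (p2 A B \<star> h) = h"
  by (rule pair_unique[of _ _ A B]) (use assms in simp_all)

text \<open>\<open>vsrc\<close> preserves horizontal composition and fixes the projections, so it
  passes through the universal property of the pairing.\<close>

lemma vsrc_pair [simp]:
  assumes "a \<in> cell K" "b \<in> cell K" "src b = src a"
  shows "vsrc (pair a b) = pair (vsrc a) (vsrc b)"
proof (rule pair_unique[of _ _ "trg a" "trg b"])
  show "p1 (trg a) (trg b) \<star> vsrc (pair a b) = p1 (trg a) (trg b) \<star> pair (vsrc a) (vsrc b)"
    using assms vsrc_hcomp[of "pair a b" "p1 (trg a) (trg b)"] by simp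
  show "p2 (trg a) (trg b) \<star> vsrc (pair a b) = p2 (trg a) (trg b) \<star> pair (vsrc a) (vsrc b)"
    using assms vsrc_hcomp[of "pair a b" "p2 (trg a) (trg b)"] by simp
qed (use assms in simp_all)

lemma vtrg_pair [simp]:
  assumes "a \<in> cell K" "b \<in> cell K" "src b = src a"
  shows "vtrg (pair a b) = pair (vtrg a) (vtrg b)"
proof (rule pair_unique[of _ _ "trg a" "trg b"])
  show "p1 (trg a) (trg b) \<star> vtrg (pair a b) = p1 (trg a) (trg b) \<star> pair (vtrg a) (vtrg b)"
    using assms vtrg_hcomp[of "pair a b" "p1 (trg a) (trg b)"] by simp
  show "p2 (trg a) (trg b) \<star> vtrg (pair a b) = p2 (trg a) (trg b) \<star> pair (vtrg a) (vtrg b)"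
    using assms vtrg_hcomp[of "pair a b" "p2 (trg a) (trg b)"] by simp
qed (use assms in simp_all)

lemma pair_vcomp:
  assumes "a \<in> cell K" "b \<in> cell K" "a' \<in> cell K" "b' \<in> cell K" "src b = src a"
    "vsrc a' = vtrg a" "vsrc b' = vtrg b"
  shows "pair (a' \<bullet> a) (b' \<bullet> b) = pair a' b' \<bullet> pair a b"
proof -
  have *: "src a' = src a" "src b' = src b" "trg a' = trg a" "trg b' = trg b"
    using assms by (metis src_vsrc src_vtrg trg_vsrc trg_vtrg)+
  show ?thesis
    by (rule pair_unique[of _ _ "trg a" "trg b"]) (use assms * in \<open>simp_all add: hcomp_vcomp\<close>)
qed

lemma pair1_props:
  assumes "f \<in> arr K" "g \<in> arr K" "dom1 K g = dom1 K f"
  shows "pair1 K f g \<in> arr K \<and> dom1 K (pair1 K f g) = dom1 K f \<and>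
    cod1 K (pair1 K f g) = cod1 K f \<otimes> cod1 K g \<and>
    pr1 K (cod1 K f) (cod1 K g) \<odot> pair1 K f g = f \<and> pr2 K (cod1 K f) (cod1 K g) \<odot> pair1 K f g = g"
  using theI'[OF prd_universal1[OF assms(1,2) assms(3)[symmetric]]] by (simp add: pair1_def)

lemma pair1_arr [simp]:
  "\<lbrakk>f \<in> arr K; g \<in> arr K; dom1 K g = dom1 K f\<rbrakk> \<Longrightarrow> pair1 K f g \<in> arr K"
  "\<lbrakk>f \<in> arr K; g \<in> arr K; dom1 K g = dom1 K f\<rbrakk> \<Longrightarrow> dom1 K (pair1 K f g) = dom1 K f"
  "\<lbrakk>f \<in> arr K; g \<in> arr K; dom1 K g = dom1 K f\<rbrakk> \<Longrightarrow> cod1 K (pair1 K f g) = cod1 K f \<otimes> cod1 K g"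
  using pair1_props by auto

text \<open>The bridge from the 1-dimensional universal property, used in the definitions, to the
  2-dimensional one, used in the proof.\<close>

lemma id2_pair1 [simp]:
  assumes "f \<in> arr K" "g \<in> arr K" "dom1 K g = dom1 K f"
  shows "id2 K (pair1 K f g) = pair (id2 K f) (id2 K g)"
proof (rule pair_unique[of _ _ "cod1 K f" "cod1 K g"])
  show "p1 (cod1 K f) (cod1 K g) \<star> id2 K (pair1 K f g) =
      p1 (cod1 K f) (cod1 K g) \<star> pair (id2 K f) (id2 K g)"
    using assms pair1_props[of f g] id2_comp1[of "pair1 K f g" "pr1 K (cod1 K f) (cod1 K g)"]
    by (simp flip: p1_def)
  show "p2 (cod1 K f) (cod1 K g) \<star> id2 K (pair1 K f g) =
      p2 (cod1 K f) (cod1 K g) \<star> pair (id2 K f) (id2 K g)"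
    using assms pair1_props[of f g] id2_comp1[of "pair1 K f g" "pr2 K (cod1 K f) (cod1 K g)"]
    by (simp flip: p2_def)
qed (use assms in simp_all)

lemma prod1_arr [simp]:
  "\<lbrakk>f \<in> arr K; g \<in> arr K\<rbrakk> \<Longrightarrow> f \<otimes>\<^sub>1 g \<in> arr K"
  "\<lbrakk>f \<in> arr K; g \<in> arr K\<rbrakk> \<Longrightarrow> dom1 K (f \<otimes>\<^sub>1 g) = dom1 K f \<otimes> dom1 K g"
  "\<lbrakk>f \<in> arr K; g \<in> arr K\<rbrakk> \<Longrightarrow> cod1 K (f \<otimes>\<^sub>1 g) = cod1 K f \<otimes> cod1 K g"
  by (simp_all add: prod1_def)

lemma prod2_eq: "a \<otimes>\<^sub>2 b = pair (a \<star> p1 (src a) (src b)) (b \<star> p2 (src a) (src b))"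
  by (simp add: prod2_def Let_def src_def rwhisker_def p1_def p2_def)

lemma id2_prod1: "\<lbrakk>f \<in> arr K; g \<in> arr K\<rbrakk> \<Longrightarrow> id2 K (f \<otimes>\<^sub>1 g) = id2 K f \<otimes>\<^sub>2 id2 K g"
  by (simp add: prod2_eq prod1_def id2_comp1 p1_def p2_def)

lemma swap_arr [simp]:
  "\<lbrakk>A \<in> ob K; B \<in> ob K\<rbrakk> \<Longrightarrow> swap K A B \<in> arr K"
  "\<lbrakk>A \<in> ob K; B \<in> ob K\<rbrakk> \<Longrightarrow> dom1 K (swap K A B) = A \<otimes> B"
  "\<lbrakk>A \<in> ob K; B \<in> ob K\<rbrakk> \<Longrightarrow> cod1 K (swap K A B) = B \<otimes> A"
  by (simp_all add: swap_def)

lemma id2_swap: "\<lbrakk>A \<in> ob K; B \<in> ob K\<rbrakk> \<Longrightarrow> id2 K (swap K A B) = pair (p2 A B) (p1 A B)"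
  by (simp add: swap_def p1_def p2_def)

lemma assoc_arr [simp]:
  "\<lbrakk>A \<in> ob K; B \<in> ob K; C \<in> ob K\<rbrakk> \<Longrightarrow> assoc K A B C \<in> arr K"
  "\<lbrakk>A \<in> ob K; B \<in> ob K; C \<in> ob K\<rbrakk> \<Longrightarrow> dom1 K (assoc K A B C) = (A \<otimes> B) \<otimes> C"
  "\<lbrakk>A \<in> ob K; B \<in> ob K; C \<in> ob K\<rbrakk> \<Longrightarrow> cod1 K (assoc K A B C) = A \<otimes> (B \<otimes> C)"
  by (simp_all add: assoc_def Let_def)

definition assoc2 :: "'o \<Rightarrow> 'o \<Rightarrow> 'o \<Rightarrow> 'c" where
  "assoc2 A B C = pair (p1 A B \<star> p1 (A \<otimes> B) C) (pair (p2 A B \<star> p1 (A \<otimes> B) C) (p2 (A \<otimes> B) C))"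

lemma id2_assoc: "\<lbrakk>A \<in> ob K; B \<in> ob K; C \<in> ob K\<rbrakk> \<Longrightarrow> id2 K (assoc K A B C) = assoc2 A B C"
  by (simp add: assoc_def Let_def assoc2_def id2_comp1 p1_def p2_def)

end

section \<open>Strength and \<open>\<omega>\<close> on generalized elements\<close>

text \<open>
  The suffix \<open>_el\<close> marks the action of a structure 1-cell or 2-cell on generalized elements
  \<open>a : W \<rightarrow> A\<close>.  The object arguments are kept because an object \<open>T A\<close> does not determine \<open>A\<close>.
\<close>

context strong_two_monad
begin

lemma T_ob [simp]: "A \<in> ob K \<Longrightarrow> T0 M A \<in> ob K"
  using cat_functor.map_Obj[OF T_one_functor] by (simp add: one_cat_def)

lemma T1_arr [simp]:
  "f \<in> arr K \<Longrightarrow> T1 M f \<in> arr K"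
  "f \<in> arr K \<Longrightarrow> dom1 K (T1 M f) = T0 M (dom1 K f)"
  "f \<in> arr K \<Longrightarrow> cod1 K (T1 M f) = T0 M (cod1 K f)"
  using cat_functor.map_Arr[OF T_one_functor] cat_functor.map_Dom[OF T_one_functor]
    cat_functor.map_Cod[OF T_one_functor] by (simp_all add: one_cat_def)

lemma T2_cell [simp]:
  "\<alpha> \<in> cell K \<Longrightarrow> T2 M \<alpha> \<in> cell K"
  "\<alpha> \<in> cell K \<Longrightarrow> src (T2 M \<alpha>) = T0 M (src \<alpha>)"
  "\<alpha> \<in> cell K \<Longrightarrow> trg (T2 M \<alpha>) = T0 M (trg \<alpha>)"
  using cat_functor.map_Arr[OF T_horiz_functor] cat_functor.map_Dom[OF T_horiz_functor]
    cat_functor.map_Cod[OF T_horiz_functor] by (simp_all add: horiz_cat_def src_def trg_def)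

lemma T2_id2: "f \<in> arr K \<Longrightarrow> T2 M (id2 K f) = id2 K (T1 M f)"
  using cat_functor.map_Id[OF T_vert_functor] by (simp add: vert_cat_def)

lemma T2_v [simp]:
  "\<alpha> \<in> cell K \<Longrightarrow> vsrc (T2 M \<alpha>) = T2 M (vsrc \<alpha>)"
  "\<alpha> \<in> cell K \<Longrightarrow> vtrg (T2 M \<alpha>) = T2 M (vtrg \<alpha>)"
  using cat_functor.map_Dom[OF T_vert_functor] cat_functor.map_Cod[OF T_vert_functor]
  by (simp_all add: vert_cat_def vsrc_def vtrg_def T2_id2)

lemma T2_hcomp:
  "\<lbrakk>\<alpha> \<in> cell K; \<beta> \<in> cell K; src \<beta> = trg \<alpha>\<rbrakk> \<Longrightarrow> T2 M (\<beta> \<star> \<alpha>) = T2 M \<beta> \<star> T2 M \<alpha>"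
  using cat_functor.map_Comp[OF T_horiz_functor] by (simp add: horiz_cat_def src_def trg_def)

text \<open>Horizontal composites are kept bracketed to the right, so two neighbouring values of
  \<open>T2\<close> usually occur in front of a tail \<open>\<gamma>\<close>. The rules for
  \<open>mu2\<close> below carry a tail for the same reason.\<close>

lemma T2_fuse:
  "\<lbrakk>\<alpha> \<in> cell K; \<beta> \<in> cell K; \<gamma> \<in> cell K; src \<beta> = trg \<alpha>; trg \<gamma> = T0 M (src \<alpha>)\<rbrakk>
    \<Longrightarrow> T2 M \<beta> \<star> (T2 M \<alpha> \<star> \<gamma>) = T2 M (\<beta> \<star> \<alpha>) \<star> \<gamma>"
  by (simp add: T2_hcomp)

lemma T2_hid [simp]: "X \<in> ob K \<Longrightarrow> T2 M (hid X) = hid (T0 M X)"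
  using cat_functor.map_Id[OF T_horiz_functor] by (simp add: horiz_cat_def hid_def)

definition mu2 :: "'o \<Rightarrow> 'c" where "mu2 A = id2 K (mu M A)"

lemma mu2_cell [simp]:
  "A \<in> ob K \<Longrightarrow> mu2 A \<in> cell K"
  "A \<in> ob K \<Longrightarrow> src (mu2 A) = T0 M (T0 M A)"
  "A \<in> ob K \<Longrightarrow> trg (mu2 A) = T0 M A"
  "A \<in> ob K \<Longrightarrow> vsrc (mu2 A) = mu2 A"
  "A \<in> ob K \<Longrightarrow> vtrg (mu2 A) = mu2 A"
  using mu_arr by (simp_all add: mu2_def)

lemma mu2_natural:
  assumes "f \<in> cell K" "src f = A" "trg f = B" "x \<in> cell K" "trg x = T0 M (T0 M A)"
  shows "T2 M f \<star> (mu2 A \<star> x) = mu2 B \<star> (T2 M (T2 M f) \<star> x)"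
proof -
  have "T2 M f \<star> mu2 A = mu2 B \<star> T2 M (T2 M f)"
    using mu_natural2[OF assms(1)] assms
    by (simp add: lwhisker_def rwhisker_def mu2_def flip: src_def trg_def)
  with assms show ?thesis
    by (metis T2_cell mu2_cell hcomp_assoc src_ob trg_ob)
qed

lemma mu2_mu2:
  assumes "A \<in> ob K" "x \<in> cell K" "trg x = T0 M (T0 M (T0 M A))"
  shows "mu2 A \<star> (mu2 (T0 M A) \<star> x) = mu2 A \<star> (T2 M (mu2 A) \<star> x)"
proof -
  have "mu2 A \<star> mu2 (T0 M A) = mu2 A \<star> T2 M (mu2 A)"
    using mu_mu[OF assms(1)] assms mu_arr
    by (simp add: mu2_def T2_id2 flip: id2_comp1)
  with assms show ?thesis
    by (metis T2_cell mu2_cell hcomp_assoc T_ob)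
qed

lemma str_arr' [simp]:
  "\<lbrakk>A \<in> ob K; B \<in> ob K\<rbrakk> \<Longrightarrow> str M A B \<in> arr K"
  "\<lbrakk>A \<in> ob K; B \<in> ob K\<rbrakk> \<Longrightarrow> dom1 K (str M A B) = A \<otimes> T0 M B"
  "\<lbrakk>A \<in> ob K; B \<in> ob K\<rbrakk> \<Longrightarrow> cod1 K (str M A B) = T0 M (A \<otimes> B)"
  using str_arr by auto

definition str_el :: "'o \<Rightarrow> 'o \<Rightarrow> 'c \<Rightarrow> 'c \<Rightarrow> 'c" where
  "str_el A B a b = id2 K (str M A B) \<star> pair a b"

lemma str_el_cell [simp]:
  assumes "a \<in> cell K" "b \<in> cell K" "src b = src a" "trg a = A" "trg b = T0 M B" "B \<in> ob K"
  shows "str_el A B a b \<in> cell K" "src (str_el A B a b) = src a" "trg (str_el A B a b) = T0 M (A \<otimes> B)"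
    "vsrc (str_el A B a b) = str_el A B (vsrc a) (vsrc b)" "vtrg (str_el A B a b) = str_el A B (vtrg a) (vtrg b)"
proof -
  have "A \<in> ob K" using assms by auto
  with assms show "str_el A B a b \<in> cell K" "src (str_el A B a b) = src a" "trg (str_el A B a b) = T0 M (A \<otimes> B)"
    "vsrc (str_el A B a b) = str_el A B (vsrc a) (vsrc b)" "vtrg (str_el A B a b) = str_el A B (vtrg a) (vtrg b)"
    by (simp_all add: str_el_def)
qed

lemma str_el_hcomp [simp]:
  assumes "a \<in> cell K" "b \<in> cell K" "src b = src a" "trg a = A" "trg b = T0 M B" "B \<in> ob K"
    "w \<in> cell K" "trg w = src a"
  shows "str_el A B a b \<star> w = str_el A B (a \<star> w) (b \<star> w)"
proof -
  have "A \<in> ob K" using assms by auto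
  with assms show ?thesis by (simp add: str_el_def)
qed

lemma str_el_natural:
  assumes "f \<in> cell K" "g \<in> cell K" "src f = A" "src g = B" "trg f = A'" "trg g = B'"
    "a \<in> cell K" "b \<in> cell K" "src b = src a" "trg a = A" "trg b = T0 M B"
  shows "str_el A' B' (f \<star> a) (T2 M g \<star> b) = T2 M (pair (f \<star> p1 A B) (g \<star> p2 A B)) \<star> str_el A B a b"
proof -
  have ob: "A \<in> ob K" "B \<in> ob K" "A' \<in> ob K" "B' \<in> ob K" using assms by auto
  have "T2 M (f \<otimes>\<^sub>2 g) \<star> id2 K (str M A B) = id2 K (str M A' B') \<star> (f \<otimes>\<^sub>2 T2 M g)"
    using str_natural2[OF assms(1,2)] assms
    by (simp add: lwhisker_def rwhisker_def flip: src_def trg_def)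
  then have "(T2 M (f \<otimes>\<^sub>2 g) \<star> id2 K (str M A B)) \<star> pair a b =
      (id2 K (str M A' B') \<star> (f \<otimes>\<^sub>2 T2 M g)) \<star> pair a b" by simp
  then show ?thesis using assms ob by (simp add: prod2_eq str_el_def)
qed

text \<open>\<open>f\<close> may be a proper 2-cell; the hexagon needs this for
  \<open>f = \<Gamma> A C\<close>.\<close>

lemma str_el_context:
  assumes "f \<in> cell K" "src f = A" "trg f = A'" "B \<in> ob K"
    "a \<in> cell K" "b \<in> cell K" "src b = src a" "trg a = A" "trg b = T0 M B"
  shows "str_el A' B (f \<star> a) b = T2 M (pair (f \<star> p1 A B) (p2 A B)) \<star> str_el A B a b"
proof -
  have ob: "A \<in> ob K" using assms by auto
  show ?thesis using str_el_natural[of f "hid B" A B A' B a b] assms ob by simp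
qed

lemma str_el_value:
  assumes "g \<in> cell K" "src g = B" "trg g = B'" "A \<in> ob K"
    "a \<in> cell K" "b \<in> cell K" "src b = src a" "trg a = A" "trg b = T0 M B"
  shows "str_el A B' a (T2 M g \<star> b) = T2 M (pair (p1 A B) (g \<star> p2 A B)) \<star> str_el A B a b"
proof -
  have ob: "B \<in> ob K" using assms by auto
  show ?thesis using str_el_natural[of "hid A" g A B A B' a b] assms ob by simp
qed

lemma assoc2_cell [simp]:
  assumes "A \<in> ob K" "B \<in> ob K" "C \<in> ob K"
  shows "assoc2 A B C \<in> cell K" "src (assoc2 A B C) = (A \<otimes> B) \<otimes> C" "trg (assoc2 A B C) = A \<otimes> (B \<otimes> C)"
    "vsrc (assoc2 A B C) = assoc2 A B C" "vtrg (assoc2 A B C) = assoc2 A B C"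
  using assms by (simp_all add: assoc2_def)

lemma assoc2_pair [simp]:
  assumes "A \<in> ob K" "B \<in> ob K" "C \<in> ob K" "a \<in> cell K" "b \<in> cell K" "c \<in> cell K"
    "src b = src a" "src c = src a" "trg a = A" "trg b = B" "trg c = C"
  shows "assoc2 A B C \<star> pair (pair a b) c = pair a (pair b c)"
  using assms by (simp add: assoc2_def)

lemma str_el_assoc:
  assumes "a \<in> cell K" "b \<in> cell K" "c \<in> cell K" "src b = src a" "src c = src a"
    "trg a = A" "trg b = B" "trg c = T0 M C" "C \<in> ob K"
  shows "str_el A (B \<otimes> C) a (str_el B C b c) = T2 M (assoc2 A B C) \<star> str_el (A \<otimes> B) C (pair a b) c"
proof -
  have ob: "A \<in> ob K" "B \<in> ob K" using assms by auto
  have "id2 K (str M A (B \<otimes> C) \<odot> (id1 K A \<otimes>\<^sub>1 str M B C) \<odot> assoc K A B (T0 M C)) =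
      id2 K (T1 M (assoc K A B C) \<odot> str M (A \<otimes> B) C)"
    using str_assoc ob assms by simp
  then have "(id2 K (str M A (B \<otimes> C)) \<star> (hid A \<otimes>\<^sub>2 id2 K (str M B C)) \<star> assoc2 A B (T0 M C)) \<star> pair (pair a b) c
      = (T2 M (assoc2 A B C) \<star> id2 K (str M (A \<otimes> B) C)) \<star> pair (pair a b) c"
    using assms ob by (simp add: id2_comp1 id2_prod1 id2_assoc hid_def flip: T2_id2)
  then show ?thesis using assms ob by (simp add: str_el_def prod2_eq)
qed

lemma str_el_mu2:
  assumes "a \<in> cell K" "b \<in> cell K" "src b = src a" "trg a = A" "trg b = T0 M (T0 M B)" "B \<in> ob K"
  shows "str_el A B a (mu2 B \<star> b) = mu2 (A \<otimes> B) \<star> T2 M (id2 K (str M A B)) \<star> str_el A (T0 M B) a b"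
proof -
  have ob: "A \<in> ob K" using assms by auto
  have "id2 K (str M A B \<odot> (id1 K A \<otimes>\<^sub>1 mu M B)) =
      id2 K (mu M (A \<otimes> B) \<odot> T1 M (str M A B) \<odot> str M A (T0 M B))"
    using str_mu ob assms by simp
  then have "(id2 K (str M A B) \<star> (hid A \<otimes>\<^sub>2 mu2 B)) \<star> pair a b =
     (mu2 (A \<otimes> B) \<star> T2 M (id2 K (str M A B)) \<star> id2 K (str M A (T0 M B))) \<star> pair a b"
    using assms ob mu_arr by (simp add: id2_comp1 id2_prod1 hid_def mu2_def T2_id2)
  then show ?thesis using assms ob by (simp add: str_el_def prod2_eq)
qed

text \<open>Strength commutes with the Kleisli extension
  \<open>g \<mapsto> \<mu> \<circ> T g\<close>: \<open>str_mu\<close> followed by naturality in the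
  value.\<close>

lemma str_el_value_mu2:
  assumes "g \<in> cell K" "src g = B" "trg g = T0 M B'" "A \<in> ob K" "B' \<in> ob K"
    "a \<in> cell K" "b \<in> cell K" "src b = src a" "trg a = A" "trg b = T0 M B"
  shows "str_el A B' a (mu2 B' \<star> (T2 M g \<star> b)) = mu2 (A \<otimes> B') \<star> T2 M (str_el A B' (p1 A B) (g \<star> p2 A B)) \<star> str_el A B a b"
proof -
  have ob: "B \<in> ob K" using assms by auto
  have "str_el A B' a (mu2 B' \<star> (T2 M g \<star> b)) =
    mu2 (A \<otimes> B') \<star> T2 M (id2 K (str M A B')) \<star> T2 M (pair (p1 A B) (g \<star> p2 A B)) \<star> str_el A B a b"
    using assms ob by (simp add: str_el_mu2 str_el_value)
  also have "\<dots> = mu2 (A \<otimes> B') \<star> T2 M (str_el A B' (p1 A B) (g \<star> p2 A B)) \<star> str_el A B a b"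
    using assms ob by (simp add: str_el_def T2_hcomp)
  finally show ?thesis .
qed

text \<open>The context of a strength is an ordinary product, so its two entries may be exchanged at
  the price of a permutation under \<open>T\<close>.\<close>

lemma str_el_swap_context:
  assumes "a \<in> cell K" "b \<in> cell K" "c \<in> cell K" "src b = src a" "src c = src a"
    "trg a = A" "trg b = T0 M B" "trg c = C" "B \<in> ob K"
  shows "str_el (C \<otimes> A) B (pair c a) b =
    T2 M (pair (pair (p2 A C \<star> p1 (A \<otimes> C) B) (p1 A C \<star> p1 (A \<otimes> C) B)) (p2 (A \<otimes> C) B))
      \<star> str_el (A \<otimes> C) B (pair a c) b"
proof -
  have ob: "A \<in> ob K" "C \<in> ob K" using assms by auto
  show ?thesis
    using str_el_context[of "pair (p2 A C) (p1 A C)" "A \<otimes> C" "C \<otimes> A" B "pair a c" b] assms ob by simp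
qed

definition str1_el :: "'o \<Rightarrow> 'o \<Rightarrow> 'c \<Rightarrow> 'c \<Rightarrow> 'c" where
  "str1_el A B a b = T2 M (pair (p2 B A) (p1 B A)) \<star> str_el B A b a"

lemma str1_arr [simp]:
  "\<lbrakk>A \<in> ob K; B \<in> ob K\<rbrakk> \<Longrightarrow> str1 K M A B \<in> arr K"
  "\<lbrakk>A \<in> ob K; B \<in> ob K\<rbrakk> \<Longrightarrow> dom1 K (str1 K M A B) = T0 M A \<otimes> B"
  "\<lbrakk>A \<in> ob K; B \<in> ob K\<rbrakk> \<Longrightarrow> cod1 K (str1 K M A B) = T0 M (A \<otimes> B)"
  by (simp_all add: str1_def)

lemma id2_str1_pair:
  assumes "a \<in> cell K" "b \<in> cell K" "src b = src a" "trg a = T0 M A" "trg b = B" "A \<in> ob K"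
  shows "id2 K (str1 K M A B) \<star> pair a b = str1_el A B a b"
proof -
  have "B \<in> ob K" using assms by auto
  with assms show ?thesis
    by (simp add: str1_def str1_el_def str_el_def id2_comp1 id2_swap flip: T2_id2)
qed

lemma omega_arr [simp]:
  "\<lbrakk>A \<in> ob K; B \<in> ob K\<rbrakk> \<Longrightarrow> omega K M A B \<in> arr K"
  "\<lbrakk>A \<in> ob K; B \<in> ob K\<rbrakk> \<Longrightarrow> dom1 K (omega K M A B) = T0 M A \<otimes> T0 M B"
  "\<lbrakk>A \<in> ob K; B \<in> ob K\<rbrakk> \<Longrightarrow> cod1 K (omega K M A B) = T0 M (A \<otimes> B)"
  "\<lbrakk>A \<in> ob K; B \<in> ob K\<rbrakk> \<Longrightarrow> omega' K M A B \<in> arr K"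
  "\<lbrakk>A \<in> ob K; B \<in> ob K\<rbrakk> \<Longrightarrow> dom1 K (omega' K M A B) = T0 M A \<otimes> T0 M B"
  "\<lbrakk>A \<in> ob K; B \<in> ob K\<rbrakk> \<Longrightarrow> cod1 K (omega' K M A B) = T0 M (A \<otimes> B)"
  using mu_arr by (simp_all add: omega_def omega'_def)

definition om_el :: "'o \<Rightarrow> 'o \<Rightarrow> 'c \<Rightarrow> 'c \<Rightarrow> 'c" where
  "om_el A B a b = id2 K (omega K M A B) \<star> pair a b"

lemma om_el_cell [simp]:
  assumes "a \<in> cell K" "b \<in> cell K" "src b = src a" "trg a = T0 M A" "trg b = T0 M B"
    "A \<in> ob K" "B \<in> ob K"
  shows "om_el A B a b \<in> cell K" "src (om_el A B a b) = src a" "trg (om_el A B a b) = T0 M (A \<otimes> B)"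
    "vsrc (om_el A B a b) = om_el A B (vsrc a) (vsrc b)" "vtrg (om_el A B a b) = om_el A B (vtrg a) (vtrg b)"
  using assms by (simp_all add: om_el_def)

lemma om_el_hcomp [simp]:
  assumes "a \<in> cell K" "b \<in> cell K" "src b = src a" "trg a = T0 M A" "trg b = T0 M B"
    "A \<in> ob K" "B \<in> ob K" "w \<in> cell K" "trg w = src a"
  shows "om_el A B a b \<star> w = om_el A B (a \<star> w) (b \<star> w)"
  using assms by (simp add: om_el_def)

lemma om_el_vcomp:
  assumes "a \<in> cell K" "b \<in> cell K" "src b = src a" "trg a = T0 M A" "trg b = T0 M B"
    "A \<in> ob K" "B \<in> ob K" "a' \<in> cell K" "b' \<in> cell K" "vsrc a' = vtrg a" "vsrc b' = vtrg b"
  shows "om_el A B (a' \<bullet> a) (b' \<bullet> b) = om_el A B a' b' \<bullet> om_el A B a b"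
proof -
  have *: "src a' = src a" "src b' = src b" "trg a' = trg a" "trg b' = trg b"
    using assms by (metis src_vsrc src_vtrg trg_vsrc trg_vtrg)+
  with assms show ?thesis by (simp add: om_el_def pair_vcomp hcomp_vcomp)
qed

text \<open>Normal form of \<open>\<omega>\<close> in terms of \<open>t\<^sub>2\<close> only: the
  outer strength has value \<open>a\<close> and context \<open>b\<close>, and the swap hidden in
  \<open>t\<^sub>1\<close> is absorbed into the projections.\<close>

lemma om_el_eq:
  assumes "a \<in> cell K" "b \<in> cell K" "src b = src a" "trg a = T0 M A" "trg b = T0 M B"
    "A \<in> ob K" "B \<in> ob K"
  shows "om_el A B a b = mu2 (A \<otimes> B) \<star> T2 M (str_el A B (p2 (T0 M B) A) (p1 (T0 M B) A)) \<star> str_el (T0 M B) A b a"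
proof -
  have "om_el A B a b = mu2 (A \<otimes> B) \<star> T2 M (id2 K (str M A B)) \<star> str1_el A (T0 M B) a b"
    using assms mu_arr
    by (simp add: om_el_def omega_def id2_comp1 id2_str1_pair mu2_def flip: T2_id2)
  then show ?thesis using assms by (simp add: str1_el_def T2_fuse) (simp add: str_el_def)
qed

lemma omega'_eq:
  assumes "a \<in> cell K" "b \<in> cell K" "src b = src a" "trg a = T0 M A" "trg b = T0 M B"
    "A \<in> ob K" "B \<in> ob K"
  shows "id2 K (omega' K M A B) \<star> pair a b =
    mu2 (A \<otimes> B) \<star> T2 M (str1_el A B (p1 (T0 M A) B) (p2 (T0 M A) B)) \<star> str_el (T0 M A) B a b"
proof -
  have "id2 K (omega' K M A B) \<star> pair a b =
      mu2 (A \<otimes> B) \<star> T2 M (id2 K (str1 K M A B)) \<star> str_el (T0 M A) B a b"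
    using assms mu_arr
    by (simp add: str_el_def omega'_def id2_comp1 mu2_def flip: T2_id2)
  also have "id2 K (str1 K M A B) = str1_el A B (p1 (T0 M A) B) (p2 (T0 M A) B)"
    using id2_str1_pair[of "p1 (T0 M A) B" "p2 (T0 M A) B" A B] assms by simp
  finally show ?thesis .
qed

text \<open>Naturality of \<open>\<mu>\<close> brings both sides to the same normal form in
  \<open>str_el\<close>. Through this lemma the targets of \<open>\<Gamma>\<close> are again
  expressed by \<open>\<omega>\<close>, with its factors exchanged.\<close>

lemma omega'_pair:
  assumes "a \<in> cell K" "b \<in> cell K" "src b = src a" "trg a = T0 M A" "trg b = T0 M B"
    "A \<in> ob K" "B \<in> ob K"
  shows "id2 K (omega' K M A B) \<star> pair a b = T2 M (pair (p2 B A) (p1 B A)) \<star> om_el B A b a"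
  using assms by (simp add: omega'_eq om_el_eq mu2_natural T2_fuse str1_el_def)

lemma om_el_natural:
  assumes "a \<in> cell K" "b \<in> cell K" "src b = src a" "trg a = T0 M A" "trg b = T0 M B"
    "f \<in> cell K" "g \<in> cell K" "src f = A" "src g = B" "trg f = A'" "trg g = B'"
  shows "om_el A' B' (T2 M f \<star> a) (T2 M g \<star> b) = T2 M (pair (f \<star> p1 A B) (g \<star> p2 A B)) \<star> om_el A B a b"
proof -
  have ob: "A \<in> ob K" "B \<in> ob K" "A' \<in> ob K" "B' \<in> ob K" using assms by auto
  have "om_el A' B' (T2 M f \<star> a) (T2 M g \<star> b) = mu2 (A' \<otimes> B') \<star>
      T2 M (str_el A' B' (f \<star> p2 (T0 M B) A) (T2 M g \<star> p1 (T0 M B) A)) \<star> str_el (T0 M B) A b a"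
    using assms ob str_el_natural[of "T2 M g" f "T0 M B" A "T0 M B'" A' b a]
    by (simp add: om_el_eq T2_fuse)
  also have "\<dots> = T2 M (pair (f \<star> p1 A B) (g \<star> p2 A B)) \<star> om_el A B a b"
    using assms ob by (simp add: om_el_eq mu2_natural T2_fuse str_el_natural[of f g A B A' B'])
  finally show ?thesis .
qed

text \<open>In normal form both sides contain a single outer strength with value \<open>b\<close>,
  where \<open>a\<close> and \<open>c\<close> are both context and may be exchanged. The inner
  strengths are matched by associativity.\<close>

lemma str_el_om_el:
  assumes "a \<in> cell K" "b \<in> cell K" "c \<in> cell K" "src b = src a" "src c = src a"
    "trg a = A" "trg b = T0 M B" "trg c = T0 M C" "B \<in> ob K" "C \<in> ob K"
  shows "str_el A (B \<otimes> C) a (om_el B C b c) = T2 M (assoc2 A B C) \<star> om_el (A \<otimes> B) C (str_el A B a b) c"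
proof -
  have ob: "A \<in> ob K" using assms by auto
  have "str_el A (B \<otimes> C) a (om_el B C b c) = mu2 (A \<otimes> (B \<otimes> C)) \<star>
      T2 M (str_el A (B \<otimes> C) (p1 A (T0 M C \<otimes> B))
        (str_el B C (p2 (T0 M C) B \<star> p2 A (T0 M C \<otimes> B)) (p1 (T0 M C) B \<star> p2 A (T0 M C \<otimes> B)))) \<star>
      str_el A (T0 M C \<otimes> B) a (str_el (T0 M C) B c b)"
    using assms ob by (simp add: om_el_eq str_el_value_mu2)
  also have "\<dots> = mu2 (A \<otimes> (B \<otimes> C)) \<star>
      T2 M (str_el A (B \<otimes> C) (p1 A (T0 M C) \<star> p1 (A \<otimes> T0 M C) B)
        (str_el B C (p2 (A \<otimes> T0 M C) B) (p2 A (T0 M C) \<star> p1 (A \<otimes> T0 M C) B))) \<star>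
      str_el (A \<otimes> T0 M C) B (pair a c) b"
    using assms ob by (simp add: str_el_assoc[of a c b A "T0 M C" B] T2_fuse) (simp add: assoc2_def)
  also have "\<dots> = mu2 (A \<otimes> (B \<otimes> C)) \<star> T2 M (T2 M (assoc2 A B C) \<star>
        str_el (A \<otimes> B) C (pair (p1 A (T0 M C) \<star> p1 (A \<otimes> T0 M C) B) (p2 (A \<otimes> T0 M C) B))
          (p2 A (T0 M C) \<star> p1 (A \<otimes> T0 M C) B)) \<star>
      str_el (A \<otimes> T0 M C) B (pair a c) b"
    using assms ob by (simp add: str_el_assoc)
  also have "\<dots> = T2 M (assoc2 A B C) \<star> mu2 ((A \<otimes> B) \<otimes> C) \<star>
      T2 M (str_el (A \<otimes> B) C (p2 (T0 M C) (A \<otimes> B)) (p1 (T0 M C) (A \<otimes> B))) \<star>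
      str_el (T0 M C) (A \<otimes> B) c (str_el A B a b)"
    using assms ob
    by (simp add: str_el_assoc[of c a b "T0 M C" A B] str_el_swap_context[of a b c A B "T0 M C"] T2_fuse
        mu2_natural)
  also have "\<dots> = T2 M (assoc2 A B C) \<star> om_el (A \<otimes> B) C (str_el A B a b) c"
    using assms ob by (simp add: om_el_eq)
  finally show ?thesis .
qed

text \<open>In the outer \<open>\<omega>\<close> on the left, \<open>\<omega>(b, c)\<close> is only
  context and can be moved under \<open>T\<close>. There \<open>a\<close> has become a plain
  element, so \<open>str_el_om_el\<close> applies; associativity of \<open>\<mu>\<close> then merges
  the two multiplications.\<close>

lemma om_el_assoc:
  assumes "a \<in> cell K" "b \<in> cell K" "c \<in> cell K" "src b = src a" "src c = src a"
    "trg a = T0 M A" "trg b = T0 M B" "trg c = T0 M C" "A \<in> ob K" "B \<in> ob K" "C \<in> ob K"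
  shows "om_el A (B \<otimes> C) a (om_el B C b c) = T2 M (assoc2 A B C) \<star> om_el (A \<otimes> B) C (om_el A B a b) c"
proof -
  let ?Q = "T0 M B \<otimes> T0 M C"
  let ?b = "p1 (T0 M B) (T0 M C) \<star> p1 ?Q A" and ?c = "p2 (T0 M B) (T0 M C) \<star> p1 ?Q A" and ?a = "p2 ?Q A"
  have "om_el A (B \<otimes> C) a (om_el B C b c) = mu2 (A \<otimes> (B \<otimes> C)) \<star>
      T2 M (str_el A (B \<otimes> C) (p2 (T0 M (B \<otimes> C)) A) (p1 (T0 M (B \<otimes> C)) A)) \<star>
      str_el (T0 M (B \<otimes> C)) A (id2 K (omega K M B C) \<star> pair b c) a"
    using assms by (simp add: om_el_eq[of a "om_el B C b c" A]) (simp add: om_el_def)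
  also have "\<dots> = mu2 (A \<otimes> (B \<otimes> C)) \<star>
      T2 M (str_el A (B \<otimes> C) ?a (id2 K (omega K M B C) \<star> p1 ?Q A)) \<star> str_el ?Q A (pair b c) a"
    using assms by (simp add: str_el_context[of "id2 K (omega K M B C)"] T2_fuse)
  also have "id2 K (omega K M B C) \<star> p1 ?Q A = om_el B C ?b ?c"
    using assms by (simp add: om_el_def)
  also have "mu2 (A \<otimes> (B \<otimes> C)) \<star> T2 M (str_el A (B \<otimes> C) ?a (om_el B C ?b ?c)) \<star> str_el ?Q A (pair b c) a =
     T2 M (assoc2 A B C) \<star> mu2 ((A \<otimes> B) \<otimes> C) \<star> T2 M (om_el (A \<otimes> B) C (str_el A B ?a ?b) ?c) \<star> str_el ?Q A (pair b c) a"
    using assms by (simp add: str_el_om_el mu2_natural T2_fuse)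
  \<comment> \<open>The inner \<open>\<omega>\<close> is opened to expose its \<open>\<mu>\<close>,
    which \<open>mu2_mu2\<close> can trade against the outer one.\<close>
  also have "T2 M (om_el (A \<otimes> B) C (str_el A B ?a ?b) ?c) =
      T2 M (mu2 ((A \<otimes> B) \<otimes> C)) \<star> T2 M (T2 M (str_el (A \<otimes> B) C (p2 (T0 M C) (A \<otimes> B)) (p1 (T0 M C) (A \<otimes> B))) \<star>
        str_el (T0 M C) (A \<otimes> B) ?c (str_el A B ?a ?b))"
    using assms by (simp add: om_el_eq[of "str_el A B ?a ?b"] T2_hcomp)
  also have "mu2 ((A \<otimes> B) \<otimes> C) \<star> (T2 M (mu2 ((A \<otimes> B) \<otimes> C)) \<star>
        T2 M (T2 M (str_el (A \<otimes> B) C (p2 (T0 M C) (A \<otimes> B)) (p1 (T0 M C) (A \<otimes> B))) \<star>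
        str_el (T0 M C) (A \<otimes> B) ?c (str_el A B ?a ?b))) \<star> str_el ?Q A (pair b c) a =
      mu2 ((A \<otimes> B) \<otimes> C) \<star> T2 M (str_el (A \<otimes> B) C (p2 (T0 M C) (A \<otimes> B)) (p1 (T0 M C) (A \<otimes> B))) \<star>
        mu2 (T0 M C \<otimes> (A \<otimes> B)) \<star> T2 M (str_el (T0 M C) (A \<otimes> B) ?c (str_el A B ?a ?b)) \<star> str_el ?Q A (pair b c) a"
    using assms by (simp add: mu2_natural mu2_mu2 T2_hcomp)
  also have "mu2 (T0 M C \<otimes> (A \<otimes> B)) \<star> T2 M (str_el (T0 M C) (A \<otimes> B) ?c (str_el A B ?a ?b)) \<star> str_el ?Q A (pair b c) a
      = str_el (T0 M C) (A \<otimes> B) c (mu2 (A \<otimes> B) \<star> T2 M (str_el A B (p2 (T0 M B) A) (p1 (T0 M B) A)) \<star> str_el (T0 M B) A b a)"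
    using assms
    by (simp add: str_el_value_mu2 str_el_assoc[of c b a "T0 M C" "T0 M B" A] T2_fuse
        str_el_swap_context[of b a c "T0 M B" A "T0 M C"])
  also have "mu2 (A \<otimes> B) \<star> T2 M (str_el A B (p2 (T0 M B) A) (p1 (T0 M B) A)) \<star> str_el (T0 M B) A b a = om_el A B a b"
    using assms by (simp add: om_el_eq)
  also have "mu2 ((A \<otimes> B) \<otimes> C) \<star> T2 M (str_el (A \<otimes> B) C (p2 (T0 M C) (A \<otimes> B)) (p1 (T0 M C) (A \<otimes> B))) \<star>
      str_el (T0 M C) (A \<otimes> B) c (om_el A B a b) = om_el (A \<otimes> B) C (om_el A B a b) c"
    using assms by (simp add: om_el_eq[of "om_el A B a b" c])
  finally show ?thesis .
qed

text \<open>This form keeps \<open>t\<^sub>1\<close> intact, since axiom (3) of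
  \<open>\<Gamma>\<close> acts on it directly.\<close>

lemma om_el_eq_str1_el:
  assumes "a \<in> cell K" "b \<in> cell K" "src b = src a" "trg a = T0 M A" "trg b = T0 M B"
    "A \<in> ob K" "B \<in> ob K"
  shows "om_el A B a b = mu2 (A \<otimes> B) \<star> T2 M (id2 K (str M A B)) \<star> str1_el A (T0 M B) a b"
  using assms mu_arr by (simp add: om_el_def omega_def id2_comp1 id2_str1_pair mu2_def flip: T2_id2)

lemma str1_el_cell [simp]:
  assumes "a \<in> cell K" "b \<in> cell K" "src b = src a" "trg a = T0 M A" "trg b = B" "A \<in> ob K"
  shows "str1_el A B a b \<in> cell K" "src (str1_el A B a b) = src a" "trg (str1_el A B a b) = T0 M (A \<otimes> B)"
    "vsrc (str1_el A B a b) = str1_el A B (vsrc a) (vsrc b)" "vtrg (str1_el A B a b) = str1_el A B (vtrg a) (vtrg b)"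
proof -
  have "B \<in> ob K" using assms by auto
  with assms show "str1_el A B a b \<in> cell K" "src (str1_el A B a b) = src a" "trg (str1_el A B a b) = T0 M (A \<otimes> B)"
    "vsrc (str1_el A B a b) = str1_el A B (vsrc a) (vsrc b)" "vtrg (str1_el A B a b) = str1_el A B (vtrg a) (vtrg b)"
    by (simp_all add: str1_el_def)
qed

lemma str1_el_hcomp [simp]:
  assumes "a \<in> cell K" "b \<in> cell K" "src b = src a" "trg a = T0 M A" "trg b = B" "A \<in> ob K"
    "w \<in> cell K" "trg w = src a"
  shows "str1_el A B a b \<star> w = str1_el A B (a \<star> w) (b \<star> w)"
proof -
  have "B \<in> ob K" using assms by auto
  with assms show ?thesis by (simp add: str1_el_def)
qed

end

section \<open>The hexagon and the Yang-Baxter equation\<close>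

context pseudo_commutative_monad
begin

lemma plug22_facts [simp]:
  assumes "A \<in> ob K" "B \<in> ob K"
  shows "\<Gamma> A B \<in> cell K" "src (\<Gamma> A B) = T0 M A \<otimes> T0 M B" "trg (\<Gamma> A B) = T0 M (A \<otimes> B)"
    "vsrc (\<Gamma> A B) = id2 K (omega K M A B)" "vtrg (\<Gamma> A B) = id2 K (omega' K M A B)"
  using G_cell[OF assms] assms by (simp_all add: src_def trg_def vsrc_def vtrg_def)

definition gam_el :: "'o \<Rightarrow> 'o \<Rightarrow> 'c \<Rightarrow> 'c \<Rightarrow> 'c" where
  "gam_el A B a b = \<Gamma> A B \<star> pair a b"

lemma gam_el_cell [simp]:
  assumes "a \<in> cell K" "b \<in> cell K" "src b = src a" "trg a = T0 M A" "trg b = T0 M B"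
    "A \<in> ob K" "B \<in> ob K"
  shows "gam_el A B a b \<in> cell K" "src (gam_el A B a b) = src a" "trg (gam_el A B a b) = T0 M (A \<otimes> B)"
    "vsrc (gam_el A B a b) = om_el A B (vsrc a) (vsrc b)"
    "vtrg (gam_el A B a b) = T2 M (pair (p2 B A) (p1 B A)) \<star> om_el B A (vtrg b) (vtrg a)"
  using assms by (simp_all add: gam_el_def om_el_def[symmetric] omega'_pair)

lemma gam_el_hcomp [simp]:
  assumes "a \<in> cell K" "b \<in> cell K" "src b = src a" "trg a = T0 M A" "trg b = T0 M B"
    "A \<in> ob K" "B \<in> ob K" "w \<in> cell K" "trg w = src a"
  shows "gam_el A B a b \<star> w = gam_el A B (a \<star> w) (b \<star> w)"
  using assms by (simp add: gam_el_def)

text \<open>First of the two interchange factorizations of \<open>\<Gamma> \<star> pair a b\<close>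
  for proper 2-cells \<open>a\<close>, \<open>b\<close>: the arguments act before
  \<open>\<Gamma>\<close>.\<close>

lemma gam_el_vcomp_om_el:
  assumes "a \<in> cell K" "b \<in> cell K" "src b = src a" "trg a = T0 M A" "trg b = T0 M B"
    "A \<in> ob K" "B \<in> ob K"
  shows "gam_el A B (vtrg a) (vtrg b) \<bullet> om_el A B a b = gam_el A B a b"
  using assms vcomp_hcomp[of "pair a b" "pair (vtrg a) (vtrg b)" "vsrc (\<Gamma> A B)" "\<Gamma> A B"]
    vtrg_vcomp_left[of "pair a b"] vcomp_vsrc[of "\<Gamma> A B"]
  by (simp add: gam_el_def om_el_def)

text \<open>The opposite factorization: \<open>\<Gamma>\<close> acts before the arguments. Comparing
  it with the preceding one is the source of the Yang-Baxter equation.\<close>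

lemma om_el_vcomp_gam_el:
  assumes "a \<in> cell K" "b \<in> cell K" "src b = src a" "trg a = T0 M A" "trg b = T0 M B"
    "A \<in> ob K" "B \<in> ob K"
  shows "(T2 M (pair (p2 B A) (p1 B A)) \<star> om_el B A b a) \<bullet> gam_el A B (vsrc a) (vsrc b) = gam_el A B a b"
  using assms vcomp_hcomp[of "pair (vsrc a) (vsrc b)" "pair a b" "\<Gamma> A B" "vtrg (\<Gamma> A B)"]
    vcomp_vsrc[of "pair a b"] vtrg_vcomp_left[of "\<Gamma> A B"]
  by (simp add: gam_el_def flip: omega'_pair)

text \<open>Unlike \<open>om_el_natural\<close> this is restricted to 1-cells \<open>f\<close>,
  \<open>g\<close>, because the modification axiom is an equation for 1-cells.\<close>

lemma gam_el_natural:
  assumes "a \<in> cell K" "b \<in> cell K" "src b = src a" "trg a = T0 M A" "trg b = T0 M B"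
    "f \<in> cell K" "g \<in> cell K" "src f = A" "src g = B" "trg f = A'" "trg g = B'"
    "vsrc f = f" "vsrc g = g"
  shows "gam_el A' B' (T2 M f \<star> a) (T2 M g \<star> b) = T2 M (pair (f \<star> p1 A B) (g \<star> p2 A B)) \<star> gam_el A B a b"
proof -
  have ob: "A \<in> ob K" "B \<in> ob K" "A' \<in> ob K" "B' \<in> ob K" using assms by auto
  obtain f' g' where f': "f = id2 K f'" "f' \<in> arr K" and g': "g = id2 K g'" "g' \<in> arr K"
    using assms(6,7,12,13) unfolding vsrc_def by (metis vert_facts(1))
  have o: "dom1 K f' = A" "cod1 K f' = A'" "dom1 K g' = B" "cod1 K g' = B'"
    using assms f' g' by auto
  have "id2 K (T1 M (f' \<otimes>\<^sub>1 g')) \<star> \<Gamma> A B = \<Gamma> A' B' \<star> id2 K (T1 M f' \<otimes>\<^sub>1 T1 M g')"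
    using G_modification[OF f'(2) g'(2)] o by (simp add: lwhisker_def rwhisker_def)
  then have "(id2 K (T1 M (f' \<otimes>\<^sub>1 g')) \<star> \<Gamma> A B) \<star> pair a b =
      (\<Gamma> A' B' \<star> id2 K (T1 M f' \<otimes>\<^sub>1 T1 M g')) \<star> pair a b" by simp
  then show ?thesis using assms ob f' g' o
    by (simp add: gam_el_def id2_prod1 prod2_eq flip: T2_id2)
qed

text \<open>Axioms (1), (2) and (3) become this rule, \<open>gam_el_str_el\<close> and
  \<open>gam_el_str1_el\<close>. They move a factor without \<open>T\<close> between the outside and
  the two arguments of \<open>\<Gamma>\<close>.\<close>

lemma str_el_gam_el:
  assumes "a \<in> cell K" "b \<in> cell K" "c \<in> cell K" "src b = src a" "src c = src a"
    "trg a = A" "trg b = T0 M B" "trg c = T0 M C" "B \<in> ob K" "C \<in> ob K"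
  shows "str_el A (B \<otimes> C) a (gam_el B C b c) = T2 M (assoc2 A B C) \<star> gam_el (A \<otimes> B) C (str_el A B a b) c"
proof -
  have ob: "A \<in> ob K" using assms by auto
  have "(T2 M (assoc2 A B C) \<star> \<Gamma> (A \<otimes> B) C \<star> id2 K (str M A B \<otimes>\<^sub>1 id1 K (T0 M C))) \<star> pair (pair a b) c
     = ((id2 K (str M A (B \<otimes> C)) \<star> (hid A \<otimes>\<^sub>2 \<Gamma> B C)) \<star> assoc2 A (T0 M B) (T0 M C)) \<star> pair (pair a b) c"
    using G_1[of A B C] ob assms
    by (simp add: lwhisker_def rwhisker_def id2_assoc hid_def flip: T2_id2)
  then show ?thesis using assms ob
    by (simp add: id2_prod1 prod2_eq str_el_def gam_el_def hid_def[symmetric])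
qed

lemma gam_el_str_el:
  assumes "a \<in> cell K" "b \<in> cell K" "c \<in> cell K" "src b = src a" "src c = src a"
    "trg a = T0 M A" "trg b = B" "trg c = T0 M C" "A \<in> ob K" "C \<in> ob K"
  shows "gam_el A (B \<otimes> C) a (str_el B C b c) = T2 M (assoc2 A B C) \<star> gam_el (A \<otimes> B) C (str1_el A B a b) c"
proof -
  have ob: "B \<in> ob K" using assms by auto
  have "((\<Gamma> A (B \<otimes> C) \<star> id2 K (id1 K (T0 M A) \<otimes>\<^sub>1 str M B C)) \<star> assoc2 (T0 M A) B (T0 M C)) \<star> pair (pair a b) c
     = (T2 M (assoc2 A B C) \<star> \<Gamma> (A \<otimes> B) C \<star> id2 K (str1 K M A B \<otimes>\<^sub>1 id1 K (T0 M C))) \<star> pair (pair a b) c"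
    using G_2[of A B C] ob assms
    by (simp add: lwhisker_def rwhisker_def id2_assoc flip: T2_id2)
  then show ?thesis using assms ob
    by (simp add: id2_prod1 prod2_eq str_el_def gam_el_def hid_def[symmetric] id2_str1_pair)
qed

lemma gam_el_str1_el:
  assumes "a \<in> cell K" "b \<in> cell K" "c \<in> cell K" "src b = src a" "src c = src a"
    "trg a = T0 M A" "trg b = T0 M B" "trg c = C" "A \<in> ob K" "B \<in> ob K"
  shows "gam_el A (B \<otimes> C) a (str1_el B C b c) = T2 M (assoc2 A B C) \<star> str1_el (A \<otimes> B) C (gam_el A B a b) c"
proof -
  have ob: "C \<in> ob K" using assms by auto
  have "((\<Gamma> A (B \<otimes> C) \<star> id2 K (id1 K (T0 M A) \<otimes>\<^sub>1 str1 K M B C)) \<star> assoc2 (T0 M A) (T0 M B) C) \<star> pair (pair a b) c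
     = (T2 M (assoc2 A B C) \<star> id2 K (str1 K M (A \<otimes> B) C) \<star> (\<Gamma> A B \<otimes>\<^sub>2 hid C)) \<star> pair (pair a b) c"
    using G_3[of A B C] ob assms
    by (simp add: lwhisker_def rwhisker_def id2_assoc hid_def flip: T2_id2)
  then show ?thesis using assms ob
    by (simp add: id2_prod1 prod2_eq gam_el_def hid_def[symmetric] id2_str1_pair)
qed

text \<open>Axiom (7) precomposed with \<open>pair a b\<close>; for 1-cells \<open>a\<close>,
  \<open>b\<close> the precomposition distributes over the vertical composite.\<close>

lemma gam_el_mu2:
  assumes "a \<in> cell K" "b \<in> cell K" "src b = src a" "trg a = T0 M A" "trg b = T0 M (T0 M B)"
    "A \<in> ob K" "B \<in> ob K" "vsrc a = a" "vsrc b = b"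
  shows "gam_el A B a (mu2 B \<star> b) = (mu2 (A \<otimes> B) \<star> T2 M (\<Gamma> A B) \<star> str_el (T0 M A) (T0 M B) a b) \<bullet>
    (mu2 (A \<otimes> B) \<star> T2 M (id2 K (str M A B)) \<star> gam_el A (T0 M B) a b)"
proof -
  have v: "vtrg a = a" "vtrg b = b" using assms by (simp_all add: vtrg_if_vsrc)
  let ?x = "mu2 (A \<otimes> B) \<star> T2 M (\<Gamma> A B) \<star> id2 K (str M (T0 M A) (T0 M B))"
    and ?y = "mu2 (A \<otimes> B) \<star> T2 M (id2 K (str M A B)) \<star> \<Gamma> A (T0 M B)"
  have mu [simp]: "mu M X \<in> arr K" "dom1 K (mu M X) = T0 M (T0 M X)" "cod1 K (mu M X) = T0 M X"
    if "X \<in> ob K" for X using mu_arr that by auto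
  have "\<Gamma> A B \<star> id2 K (id1 K (T0 M A) \<otimes>\<^sub>1 mu M B) = ?x \<bullet> ?y"
    using G_7[of A B] assms
    by (simp add: lwhisker_def rwhisker_def mu2_def id2_comp1 flip: T2_id2)
  \<comment> \<open>The distribution needs the two factors in (7) to be composable, which the
    equation (7) does not assert by itself. It is tested on arbitrary elements and then specialized
    to the projections.\<close>
  moreover have "vsrc ?x \<star> pair a b = vtrg ?y \<star> pair a b"
    if "a \<in> cell K" "b \<in> cell K" "src b = src a" "trg a = T0 M A" "trg b = T0 M (T0 M B)" for a b
  proof -
    let ?p = "p1 (T0 M A) (T0 M B)" and ?q = "p2 (T0 M A) (T0 M B)"
    have o: "id2 K (omega K M A B) = om_el A B ?p ?q"
      using assms by (simp add: om_el_def)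
    show ?thesis
      using assms that by (simp add: omega'_eq o om_el_eq_str1_el mu2_natural mu2_mu2 T2_hcomp flip: str_el_def)
  qed
  from this[of "p1 (T0 M A) (T0 M (T0 M B))" "p2 (T0 M A) (T0 M (T0 M B))"]
  have "vsrc ?x = vtrg ?y" using assms by simp
  ultimately have "(\<Gamma> A B \<star> id2 K (id1 K (T0 M A) \<otimes>\<^sub>1 mu M B)) \<star> pair a b =
      (?x \<star> pair a b) \<bullet> (?y \<star> pair a b)"
    using assms v by (simp add: vcomp_hcomp_id)
  then show ?thesis
    using assms by (simp add: id2_prod1 prod2_eq gam_el_def str_el_def hid_def[symmetric] mu2_def[symmetric])
qed

text \<open>
  Axiom (7) splits off the \<open>\<mu>\<close> of \<open>\<omega>\<^sub>B\<^sub>C\<close>; axiom (3) evaluates one factor, axioms (2) and (1) the other.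
\<close>

lemma gam_el_hexagon:
  assumes "a \<in> cell K" "b \<in> cell K" "c \<in> cell K" "src b = src a" "src c = src a"
    "trg a = T0 M A" "trg b = T0 M B" "trg c = T0 M C" "A \<in> ob K" "B \<in> ob K" "C \<in> ob K"
    "vsrc a = a" "vsrc b = b" "vsrc c = c"
  shows "gam_el A (B \<otimes> C) a (om_el B C b c) =
    (T2 M (pair (p1 A C \<star> p2 B (A \<otimes> C)) (pair (p1 B (A \<otimes> C)) (p2 A C \<star> p2 B (A \<otimes> C))))
       \<star> om_el B (A \<otimes> C) b (gam_el A C a c)) \<bullet>
    (T2 M (assoc2 A B C) \<star> om_el (A \<otimes> B) C (gam_el A B a b) c)"
proof -
  \<comment> \<open>The reshuffle \<open>B \<otimes> (A \<otimes> C) \<rightarrow> A \<otimes> (B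
    \<otimes> C)\<close>.\<close>
  let ?pi = "pair (p1 A C \<star> p2 B (A \<otimes> C)) (pair (p1 B (A \<otimes> C)) (p2 A C \<star> p2 B (A \<otimes> C)))"
  \<comment> \<open>\<open>\<omega>(b, c)\<close> stripped of its outermost \<open>\<mu>\<close>,
    the part that axiom (7) takes as argument.\<close>
  let ?y = "T2 M (id2 K (str M B C)) \<star> str1_el B (T0 M C) b c"
  let ?P = "T0 M A \<otimes> T0 M C"
  let ?a = "p1 (T0 M A) (T0 M C) \<star> p1 ?P B" and ?b = "p2 ?P B" and ?c = "p2 (T0 M A) (T0 M C) \<star> p1 ?P B"
  have "gam_el A (B \<otimes> C) a (om_el B C b c) =
    (mu2 (A \<otimes> (B \<otimes> C)) \<star> T2 M (\<Gamma> A (B \<otimes> C)) \<star> str_el (T0 M A) (T0 M (B \<otimes> C)) a ?y) \<bullet>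
    (mu2 (A \<otimes> (B \<otimes> C)) \<star> T2 M (id2 K (str M A (B \<otimes> C))) \<star> gam_el A (T0 M (B \<otimes> C)) a ?y)"
    using assms gam_el_mu2[of a ?y A "B \<otimes> C"] by (simp add: om_el_eq_str1_el)
  \<comment> \<open>Axiom (3): with \<open>t\<^sub>1(b, c)\<close> as second argument,
    \<open>\<Gamma>\<close> acts on \<open>a\<close> and \<open>b\<close> alone.\<close>
  also have "mu2 (A \<otimes> (B \<otimes> C)) \<star> T2 M (id2 K (str M A (B \<otimes> C))) \<star> gam_el A (T0 M (B \<otimes> C)) a ?y =
     T2 M (assoc2 A B C) \<star> om_el (A \<otimes> B) C (gam_el A B a b) c"
  proof -
    have "gam_el A (T0 M (B \<otimes> C)) a ?y =
      T2 M (pair (p1 A (B \<otimes> T0 M C)) (id2 K (str M B C) \<star> p2 A (B \<otimes> T0 M C))) \<star>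
      gam_el A (B \<otimes> T0 M C) a (str1_el B (T0 M C) b c)"
      using assms gam_el_natural[of a "str1_el B (T0 M C) b c" A "B \<otimes> T0 M C" "hid A" "id2 K (str M B C)" A]
      by simp
    \<comment> \<open>Associativity of the strength evaluated at the projections, hence an equation
      of 1-cells that can be applied under \<open>T\<close>.\<close>
    moreover have "id2 K (str M A (B \<otimes> C)) \<star>
        pair (p1 A (B \<otimes> T0 M C)) (id2 K (str M B C) \<star> p2 A (B \<otimes> T0 M C)) \<star> assoc2 A B (T0 M C)
      = T2 M (assoc2 A B C) \<star> id2 K (str M (A \<otimes> B) C)"
      using assms str_el_assoc[of "p1 A B \<star> p1 (A \<otimes> B) (T0 M C)" "p2 A B \<star> p1 (A \<otimes> B) (T0 M C)"
          "p2 (A \<otimes> B) (T0 M C)" A B C]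
      by (simp add: str_el_def assoc2_def)
    ultimately show ?thesis
      using assms by (simp add: gam_el_str1_el T2_fuse om_el_eq_str1_el[of "gam_el A B a b"] mu2_natural del: pair_hcomp)
  qed
  \<comment> \<open>Here \<open>\<Gamma>\<close> stands under \<open>T\<close>, where
    \<open>b\<close> is a plain element. Axiom (2) turns \<open>t\<^sub>2(b, c)\<close> in the
    second argument into \<open>t\<^sub>1(a, b)\<close> in the first; written as a swapped
    \<open>t\<^sub>2(b, a)\<close>, it lets axiom (1) take \<open>b\<close> outside, so that
    \<open>\<Gamma>\<close> acts on \<open>a\<close> and \<open>c\<close>.\<close>
  also have "mu2 (A \<otimes> (B \<otimes> C)) \<star> T2 M (\<Gamma> A (B \<otimes> C)) \<star> str_el (T0 M A) (T0 M (B \<otimes> C)) a ?y =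
    T2 M ?pi \<star> om_el B (A \<otimes> C) b (gam_el A C a c)"
  proof -
    have "T2 M (\<Gamma> A (B \<otimes> C)) \<star> str_el (T0 M A) (T0 M (B \<otimes> C)) a ?y =
      T2 M (gam_el A (B \<otimes> C) ?a (str_el B C ?b ?c)) \<star> str_el ?P B (pair a c) b"
      using assms
      by (simp add: str1_el_def T2_fuse str_el_value str_el_assoc[of a c b])
        (simp add: assoc2_def gam_el_def str_el_def)
    also have "gam_el A (B \<otimes> C) ?a (str_el B C ?b ?c) = T2 M ?pi \<star> str_el B (A \<otimes> C) ?b (gam_el A C ?a ?c)"
    proof -
      have "gam_el A (B \<otimes> C) ?a (str_el B C ?b ?c) =
        T2 M (assoc2 A B C) \<star> gam_el (A \<otimes> B) C (T2 M (pair (p2 B A) (p1 B A)) \<star> str_el B A ?b ?a) ?c"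
        using assms by (simp add: gam_el_str_el str1_el_def)
      also have "\<dots> = T2 M (assoc2 A B C) \<star> T2 M (pair (pair (p2 B A) (p1 B A) \<star> p1 (B \<otimes> A) C) (p2 (B \<otimes> A) C)) \<star>
          gam_el (B \<otimes> A) C (str_el B A ?b ?a) ?c"
        using assms gam_el_natural[of "str_el B A ?b ?a" ?c "B \<otimes> A" C "pair (p2 B A) (p1 B A)" "hid C" "A \<otimes> B" C]
        by simp
      also have "\<dots> = T2 M ?pi \<star> str_el B (A \<otimes> C) ?b (gam_el A C ?a ?c)"
        using assms by (simp add: str_el_gam_el T2_fuse) (simp add: assoc2_def)
      finally show ?thesis .
    qed
    also have "T2 M (T2 M ?pi \<star> str_el B (A \<otimes> C) ?b (gam_el A C ?a ?c)) =
      T2 M (T2 M ?pi) \<star> T2 M (str_el B (A \<otimes> C) ?b (\<Gamma> A C \<star> p1 ?P B))"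
      using assms by (simp add: T2_hcomp gam_el_def)
    finally show ?thesis
      using assms
      by (simp add: om_el_eq mu2_natural T2_fuse gam_el_def str_el_context[of "\<Gamma> A C"])
  qed
  finally show ?thesis .
qed

text \<open>Both sides are \<open>\<Gamma> (a, \<Gamma> (b, c))\<close>.\<close>

lemma gam_el_yang_baxter:
  assumes "a \<in> cell K" "b \<in> cell K" "c \<in> cell K" "src b = src a" "src c = src a"
    "trg a = T0 M A" "trg b = T0 M B" "trg c = T0 M C" "A \<in> ob K" "B \<in> ob K" "C \<in> ob K"
    "vsrc a = a" "vsrc b = b" "vsrc c = c"
  shows "(T2 M (pair (p2 (B \<otimes> C) A) (p1 (B \<otimes> C) A)) \<star> om_el (B \<otimes> C) A (gam_el B C b c) a) \<bullet>
    ((T2 M (pair (p1 A C \<star> p2 B (A \<otimes> C)) (pair (p1 B (A \<otimes> C)) (p2 A C \<star> p2 B (A \<otimes> C))))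
       \<star> om_el B (A \<otimes> C) b (gam_el A C a c)) \<bullet>
    (T2 M (assoc2 A B C) \<star> om_el (A \<otimes> B) C (gam_el A B a b) c)) =
    (T2 M (pair (p1 A B \<star> p2 C (A \<otimes> B)) (pair (p2 A B \<star> p2 C (A \<otimes> B)) (p1 C (A \<otimes> B))))
       \<star> om_el C (A \<otimes> B) c (gam_el A B a b)) \<bullet>
    ((T2 M (pair (p1 A C \<star> p1 (A \<otimes> C) B) (pair (p2 (A \<otimes> C) B) (p2 A C \<star> p1 (A \<otimes> C) B)))
       \<star> om_el (A \<otimes> C) B (gam_el A C a c) b) \<bullet>
    om_el A (B \<otimes> C) a (gam_el B C b c))" (is "?lhs = ?z \<bullet> (?y \<bullet> ?x)")
proof -
  have v: "vtrg a = a" "vtrg b = b" "vtrg c = c" using assms by (simp_all add: vtrg_if_vsrc)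
  let ?h = "pair (p1 A (C \<otimes> B)) (pair (p2 C B) (p1 C B) \<star> p2 A (C \<otimes> B))"
  let ?pi = "pair (p1 A B \<star> p2 C (A \<otimes> B)) (pair (p1 C (A \<otimes> B)) (p2 A B \<star> p2 C (A \<otimes> B)))"
  \<comment> \<open>The outer \<open>\<Gamma>\<close> acts first: the inner one still has its source
    \<open>\<omega>(b, c)\<close>, so the hexagon expands the outer one.\<close>
  have "?lhs = gam_el A (B \<otimes> C) a (gam_el B C b c)"
    using assms v om_el_vcomp_gam_el[of a "gam_el B C b c" A "B \<otimes> C"] gam_el_hexagon[of a b c A B C] by simp
  \<comment> \<open>The inner \<open>\<Gamma>\<close> acts first: afterwards the second argument is
    a swapped \<open>\<omega>(c, b)\<close>. Naturality takes the swap outside, and the hexagon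
    applies to \<open>a\<close>, \<open>c\<close>, \<open>b\<close>.\<close>
  moreover have "gam_el A (B \<otimes> C) a (T2 M (pair (p2 C B) (p1 C B)) \<star> om_el C B c b) =
      T2 M ?h \<star> gam_el A (C \<otimes> B) a (om_el C B c b)"
    using assms gam_el_natural[of a "om_el C B c b" A "C \<otimes> B" "hid A" "pair (p2 C B) (p1 C B)" A "B \<otimes> C"]
    by simp
  \<comment> \<open>\<open>ca\<close> and \<open>ac\<close> bring the ends of the factors to a
    common form, which shows that the vertical composites below are composable.\<close>
  moreover have ca: "om_el C (A \<otimes> B) c (om_el A B a b) = T2 M (assoc2 C A B) \<star> om_el (C \<otimes> A) B (om_el C A c a) b"
    using assms by (simp add: om_el_assoc)
  moreover have ac: "om_el (A \<otimes> C) B (T2 M (pair (p2 C A) (p1 C A)) \<star> om_el C A c a) b =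
      T2 M (pair (pair (p2 C A) (p1 C A) \<star> p1 (C \<otimes> A) B) (p2 (C \<otimes> A) B)) \<star> om_el (C \<otimes> A) B (om_el C A c a) b"
    using assms om_el_natural[of "om_el C A c a" b "C \<otimes> A" B "pair (p2 C A) (p1 C A)" "hid B" "A \<otimes> C" B] by simp
  moreover have "T2 M ?h \<star> gam_el A (C \<otimes> B) a (om_el C B c b) = ?z \<bullet> ?y"
  proof -
    let ?u = "T2 M ?pi \<star> om_el C (A \<otimes> B) c (gam_el A B a b)"
      and ?w = "T2 M (assoc2 A C B) \<star> om_el (A \<otimes> C) B (gam_el A C a c) b"
    have "gam_el A (C \<otimes> B) a (om_el C B c b) = ?u \<bullet> ?w"
      using gam_el_hexagon[of a c b A C B] assms by simp
    moreover have "vsrc ?u = vtrg ?w"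
      using assms v by (simp add: ca ac T2_fuse) (simp add: assoc2_def)
    ultimately show ?thesis
      using assms by (simp add: hcomp_vcomp T2_fuse) (simp add: assoc2_def)
  qed
  moreover have "gam_el A (B \<otimes> C) a (T2 M (pair (p2 C B) (p1 C B)) \<star> om_el C B c b) \<bullet> ?x = gam_el A (B \<otimes> C) a (gam_el B C b c)"
    using gam_el_vcomp_om_el[of a "gam_el B C b c" A "B \<otimes> C"] assms v by simp
  moreover have "(?z \<bullet> ?y) \<bullet> ?x = ?z \<bullet> (?y \<bullet> ?x)"
  proof (rule vcomp_assoc)
    show "vsrc ?y = vtrg ?x"
      using assms v om_el_assoc[of a c b A C B]
        om_el_natural[of a "om_el C B c b" A "C \<otimes> B" "hid A" "pair (p2 C B) (p1 C B)" A "B \<otimes> C"]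
      by (simp add: T2_fuse) (simp add: assoc2_def)
    show "vsrc ?z = vtrg ?y"
      using assms v by (simp add: ca ac T2_fuse) (simp add: assoc2_def)
  qed (use assms in simp_all)
  ultimately show ?thesis by simp
qed

end

section \<open>Finite products and iterated \<open>\<omega>\<close>\<close>

context fp_two_category
begin

fun ntuple2 :: "(nat \<Rightarrow> 'c) \<Rightarrow> nat \<Rightarrow> 'c" where
  "ntuple2 f (Suc 0) = f 1"
| "ntuple2 f (Suc (Suc n)) = pair (ntuple2 f (Suc n)) (f (Suc (Suc n)))"

definition nproj2 :: "(nat \<Rightarrow> 'o) \<Rightarrow> nat \<Rightarrow> nat \<Rightarrow> 'c" where
  "nproj2 X n k = id2 K (nproj K X n k)"

definition obs :: "(nat \<Rightarrow> 'o) \<Rightarrow> nat \<Rightarrow> bool" where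
  "obs X n \<longleftrightarrow> (\<forall>k. 1 \<le> k \<and> k \<le> n \<longrightarrow> X k \<in> ob K)"

definition fam :: "'o \<Rightarrow> (nat \<Rightarrow> 'o) \<Rightarrow> nat \<Rightarrow> (nat \<Rightarrow> 'c) \<Rightarrow> bool" where
  "fam W X n f \<longleftrightarrow> (\<forall>k. 1 \<le> k \<and> k \<le> n \<longrightarrow> f k \<in> cell K \<and> src (f k) = W \<and> trg (f k) = X k)"

lemma ntuple2_1 [simp]: "ntuple2 f 1 = f 1" by simp

lemma ntuple2_Suc: "1 \<le> n \<Longrightarrow> ntuple2 f (Suc n) = pair (ntuple2 f n) (f (Suc n))"
  by (cases n) auto

lemma nprod_1 [simp]: "nprod K X 1 = X 1" by simp

lemma nprod_Suc: "1 \<le> n \<Longrightarrow> nprod K X (Suc n) = nprod K X n \<otimes> X (Suc n)"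
  by (cases n) auto

lemma nproj_1 [simp]: "nproj K X 1 k = id1 K (X 1)" by simp

lemma nproj_Suc: "1 \<le> n \<Longrightarrow> nproj K X (Suc n) k = (if k = Suc n then pr2 K (nprod K X n) (X (Suc n))
     else nproj K X n k \<odot> pr1 K (nprod K X n) (X (Suc n)))"
  by (cases n) auto

lemma ntuple_Suc: "1 \<le> n \<Longrightarrow> ntuple K f (Suc n) = pair1 K (ntuple K f n) (f (Suc n))"
  by (cases n) auto

lemma nprod_ob [simp]: "obs X n \<Longrightarrow> nprod K X n \<in> ob K"
proof (induction n)
  case 0
  then show ?case by (simp add: one_ob)
next
  case (Suc n)
  then show ?case by (cases n) (simp_all add: obs_def)
qed

lemma nprod_cong: "(\<And>k. 1 \<le> k \<Longrightarrow> k \<le> n \<Longrightarrow> X k = Y k) \<Longrightarrow> nprod K X n = nprod K Y n"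
proof (induction n)
  case (Suc n)
  then show ?case by (cases n) simp_all
qed simp

lemma ntuple2_cong:
  assumes "1 \<le> n" "\<And>k. 1 \<le> k \<Longrightarrow> k \<le> n \<Longrightarrow> f k = g k"
  shows "ntuple2 f n = ntuple2 g n"
  using assms by (induction n rule: nat_induct_at_least) (auto simp: ntuple2_Suc)

lemma obs_ob: "\<lbrakk>obs X n; 1 \<le> k; k \<le> n\<rbrakk> \<Longrightarrow> X k \<in> ob K"
  by (simp add: obs_def)

lemma obs_mono: "\<lbrakk>obs X n; m \<le> n\<rbrakk> \<Longrightarrow> obs X m"
  by (simp add: obs_def)

lemma nproj_arr:
  assumes "1 \<le> n" "obs X n" "1 \<le> k" "k \<le> n"
  shows "nproj K X n k \<in> arr K \<and> dom1 K (nproj K X n k) = nprod K X n \<and> cod1 K (nproj K X n k) = X k"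
  using assms
proof (induction n rule: nat_induct_at_least)
  case base
  then show ?case by (simp add: obs_def)
next
  case (Suc n)
  moreover have "obs X n" "X (Suc n) \<in> ob K" using Suc by (auto simp: obs_def)
  ultimately show ?case by (auto simp: nproj_Suc nprod_Suc)
qed

lemma nproj2_cell [simp]:
  assumes "obs X n" "1 \<le> k" "k \<le> n"
  shows "nproj2 X n k \<in> cell K" "src (nproj2 X n k) = nprod K X n" "trg (nproj2 X n k) = X k"
    "vsrc (nproj2 X n k) = nproj2 X n k" "vtrg (nproj2 X n k) = nproj2 X n k"
  using nproj_arr[of n X k] assms by (simp_all add: nproj2_def)

lemma nproj2_1: "X 1 \<in> ob K \<Longrightarrow> nproj2 X (Suc 0) (Suc 0) = hid (X 1)"
  by (simp add: nproj2_def hid_def)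

lemma nproj2_Suc:
  assumes "1 \<le> n" "obs X (Suc n)" "1 \<le> k" "k \<le> Suc n"
  shows "nproj2 X (Suc n) k = (if k = Suc n then p2 (nprod K X n) (X (Suc n))
     else nproj2 X n k \<star> p1 (nprod K X n) (X (Suc n)))"
proof -
  have "obs X n" "X (Suc n) \<in> ob K" using assms by (auto simp: obs_def)
  then show ?thesis using assms nproj_arr[of n X k]
    by (auto simp: nproj2_def nproj_Suc p1_def p2_def id2_comp1)
qed

lemma famD:
  assumes "fam W X n f" "1 \<le> k" "k \<le> n"
  shows "f k \<in> cell K" "src (f k) = W" "trg (f k) = X k"
  using assms by (auto simp: fam_def)

lemma fam_mono: "\<lbrakk>fam W X n f; m \<le> n\<rbrakk> \<Longrightarrow> fam W X m f"
  by (simp add: fam_def)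

lemma fam_obs: "fam W X n f \<Longrightarrow> obs X n"
  unfolding obs_def by (metis famD(1,3) trg_ob)

lemma ntuple2_cell:
  assumes "1 \<le> n" "fam W X n f"
  shows "ntuple2 f n \<in> cell K \<and> src (ntuple2 f n) = W \<and> trg (ntuple2 f n) = nprod K X n"
  using assms
proof (induction n rule: nat_induct_at_least)
  case base
  then show ?case using famD[of W X 1 f 1] by simp
next
  case (Suc n)
  then show ?case using fam_mono[of W X "Suc n" f n] famD[of W X "Suc n" f "Suc n"]
    by (simp add: ntuple2_Suc nprod_Suc)
qed

lemma fam_nproj2 [simp]: "obs X n \<Longrightarrow> fam (nprod K X n) X n (nproj2 X n)"
  by (auto simp: fam_def)

lemma nproj2_ntuple2:
  assumes "1 \<le> n" "fam W X n f" "1 \<le> k" "k \<le> n"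
  shows "nproj2 X n k \<star> ntuple2 f n = f k"
  using assms
proof (induction n rule: nat_induct_at_least)
  case base
  then have "k = 1" by simp
  with base show ?case using famD[of W X 1 f 1] trg_ob[of "f 1"] by (simp add: nproj2_1)
next
  case (Suc n)
  have f: "fam W X n f" "obs X (Suc n)" "obs X n" "f (Suc n) \<in> cell K" "src (f (Suc n)) = W"
    "trg (f (Suc n)) = X (Suc n)" "X (Suc n) \<in> ob K"
    using fam_mono[OF Suc.prems(1)] fam_obs[OF Suc.prems(1)] famD[OF Suc.prems(1), of "Suc n"]
    by (auto simp: obs_def)
  then show ?case using Suc ntuple2_cell[of n W X f]
    by (auto simp: nproj2_Suc ntuple2_Suc)
qed

lemma ntuple2_unique:
  assumes "1 \<le> n" "obs X n" "g \<in> cell K" "h \<in> cell K" "src h = src g"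
    "trg g = nprod K X n" "trg h = nprod K X n"
    "\<And>k. 1 \<le> k \<Longrightarrow> k \<le> n \<Longrightarrow> nproj2 X n k \<star> g = nproj2 X n k \<star> h"
  shows "g = h"
  using assms
proof (induction n arbitrary: g h rule: nat_induct_at_least)
  case base
  then show ?case using base(7)[of 1] by (simp add: nproj2_1 obs_def)
next
  case (Suc n)
  have o: "obs X n" "X (Suc n) \<in> ob K" using Suc.prems(1) by (auto simp: obs_def)
  show ?case
  proof (rule pair_unique[of _ _ "nprod K X n" "X (Suc n)"])
    show "p1 (nprod K X n) (X (Suc n)) \<star> g = p1 (nprod K X n) (X (Suc n)) \<star> h"
    proof (rule Suc.IH)
      fix k assume k: "1 \<le> k" "k \<le> n"
      with Suc.prems(7)[of k] Suc.prems(1-6) Suc.hyps o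
      show "nproj2 X n k \<star> p1 (nprod K X n) (X (Suc n)) \<star> g =
          nproj2 X n k \<star> p1 (nprod K X n) (X (Suc n)) \<star> h"
        by (simp add: nproj2_Suc nprod_Suc)
    qed (use Suc o in \<open>simp_all add: nprod_Suc\<close>)
    show "p2 (nprod K X n) (X (Suc n)) \<star> g = p2 (nprod K X n) (X (Suc n)) \<star> h"
      using Suc.prems(7)[of "Suc n"] Suc.prems(1-6) Suc.hyps o by (simp add: nproj2_Suc)
  qed (use Suc o in \<open>simp_all add: nprod_Suc\<close>)
qed

lemma fam_hcomp: "\<lbrakk>fam W X n f; w \<in> cell K; trg w = W\<rbrakk> \<Longrightarrow> fam (src w) X n (\<lambda>k. f k \<star> w)"
  by (auto simp: fam_def)

lemma ntuple2_hcomp: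
  assumes "1 \<le> n" "fam W X n f" "w \<in> cell K" "trg w = W"
  shows "ntuple2 f n \<star> w = ntuple2 (\<lambda>k. f k \<star> w) n"
  using assms
proof (induction n rule: nat_induct_at_least)
  case (Suc n)
  then show ?case using fam_mono[OF Suc.prems(1), of n] famD[OF Suc.prems(1), of "Suc n"]
      ntuple2_cell[of n W X f]
    by (simp add: ntuple2_Suc)
qed simp

lemma vsrc_ntuple2:
  assumes "1 \<le> n" "fam W X n f"
  shows "vsrc (ntuple2 f n) = ntuple2 (\<lambda>k. vsrc (f k)) n" "vtrg (ntuple2 f n) = ntuple2 (\<lambda>k. vtrg (f k)) n"
proof -
  have "vsrc (ntuple2 f n) = ntuple2 (\<lambda>k. vsrc (f k)) n \<and> vtrg (ntuple2 f n) = ntuple2 (\<lambda>k. vtrg (f k)) n"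
    using assms
  proof (induction n rule: nat_induct_at_least)
    case (Suc n)
    then show ?case using fam_mono[OF Suc.prems(1), of n] famD[OF Suc.prems(1), of "Suc n"]
        ntuple2_cell[of n W X f]
      by (simp add: ntuple2_Suc)
  qed simp
  then show "vsrc (ntuple2 f n) = ntuple2 (\<lambda>k. vsrc (f k)) n" "vtrg (ntuple2 f n) = ntuple2 (\<lambda>k. vtrg (f k)) n"
    by auto
qed

lemma ntuple2_nproj2 [simp]:
  assumes "1 \<le> n" "obs X n"
  shows "ntuple2 (nproj2 X n) n = hid (nprod K X n)"
proof (rule ntuple2_unique[OF assms])
  fix k assume "1 \<le> k" "k \<le> n"
  with assms show "nproj2 X n k \<star> ntuple2 (nproj2 X n) n = nproj2 X n k \<star> hid (nprod K X n)"
    using nproj2_ntuple2[of n "nprod K X n" X "nproj2 X n" k] by simp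
qed (use assms ntuple2_cell[of n "nprod K X n" X "nproj2 X n"] in simp_all)

lemma ntuple2_nproj2_hcomp:
  assumes "1 \<le> n" "obs X n" "h \<in> cell K" "trg h = nprod K X n"
  shows "ntuple2 (\<lambda>k. nproj2 X n k \<star> h) n = h"
  using ntuple2_hcomp[of n "nprod K X n" X "nproj2 X n" h] assms by simp

lemma id2_ntuple:
  assumes "1 \<le> n" "\<And>k. 1 \<le> k \<Longrightarrow> k \<le> n \<Longrightarrow> f k \<in> arr K \<and> dom1 K (f k) = W \<and> cod1 K (f k) = X k"
  shows "ntuple K f n \<in> arr K \<and> dom1 K (ntuple K f n) = W \<and> cod1 K (ntuple K f n) = nprod K X n \<and>
    id2 K (ntuple K f n) = ntuple2 (\<lambda>k. id2 K (f k)) n"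
  using assms
  by (induction n rule: nat_induct_at_least) (simp_all add: ntuple_Suc nprod_Suc ntuple2_Suc)

end

section \<open>Iterated \<open>\<omega>\<close> on families and its generalized
  associativity\<close>

context strong_two_monad
begin

fun nom_el :: "(nat \<Rightarrow> 'o) \<Rightarrow> nat \<Rightarrow> (nat \<Rightarrow> 'c) \<Rightarrow> 'c" where
  "nom_el X (Suc 0) a = a 1"
| "nom_el X (Suc (Suc n)) a = om_el (nprod K X (Suc n)) (X (Suc (Suc n))) (nom_el X (Suc n) a) (a (Suc (Suc n)))"

lemma nom_el_Suc: "1 \<le> n \<Longrightarrow> nom_el X (Suc n) a = om_el (nprod K X n) (X (Suc n)) (nom_el X n a) (a (Suc n))"
  by (cases n) auto

definition famT :: "'o \<Rightarrow> (nat \<Rightarrow> 'o) \<Rightarrow> nat \<Rightarrow> (nat \<Rightarrow> 'c) \<Rightarrow> bool" where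
  "famT W X n a \<longleftrightarrow> obs X n \<and> fam W (\<lambda>k. T0 M (X k)) n a"

lemma famT_obs: "famT W X n a \<Longrightarrow> obs X n"
  by (simp add: famT_def)

lemma famT_nprod: "famT W X n a \<Longrightarrow> nprod K X n \<in> ob K"
  by (simp add: famT_def)

lemma famT_iff: "famT W X n a \<longleftrightarrow>
  (\<forall>k. 1 \<le> k \<and> k \<le> n \<longrightarrow> X k \<in> ob K \<and> a k \<in> cell K \<and> src (a k) = W \<and> trg (a k) = T0 M (X k))"
  by (auto simp: famT_def fam_def obs_def)

lemma famT_mono: "\<lbrakk>famT W X n f; m \<le> n\<rbrakk> \<Longrightarrow> famT W X m f"
  by (simp add: famT_iff)

lemma famTD:
  assumes "famT W X n f" "1 \<le> k" "k \<le> n"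
  shows "f k \<in> cell K" "src (f k) = W" "trg (f k) = T0 M (X k)" "X k \<in> ob K"
  using assms by (auto simp: famT_iff)

lemma nom_el_cell:
  assumes "1 \<le> n" "famT W X n a"
  shows "nom_el X n a \<in> cell K \<and> src (nom_el X n a) = W \<and> trg (nom_el X n a) = T0 M (nprod K X n) \<and>
    vsrc (nom_el X n a) = nom_el X n (\<lambda>k. vsrc (a k)) \<and> vtrg (nom_el X n a) = nom_el X n (\<lambda>k. vtrg (a k))"
  using assms
proof (induction n rule: nat_induct_at_least)
  case base
  then show ?case by (auto simp: famT_iff)
next
  case (Suc n)
  moreover have "famT W X n a" using famT_mono[OF Suc.prems(1)] by simp
  ultimately show ?case using famTD[OF Suc.prems(1), of "Suc n"] famT_nprod[of W X n a]
    by (simp add: nom_el_Suc nprod_Suc)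
qed

lemma nom_el_cong:
  assumes "1 \<le> n" "\<And>k. 1 \<le> k \<Longrightarrow> k \<le> n \<Longrightarrow> X k = Y k" "\<And>k. 1 \<le> k \<Longrightarrow> k \<le> n \<Longrightarrow> a k = b k"
  shows "nom_el X n a = nom_el Y n b"
  using assms
proof (induction n rule: nat_induct_at_least)
  case (Suc n)
  then show ?case using nprod_cong[of n X Y] by (simp add: nom_el_Suc)
qed simp

text \<open>Composability is proved along with the equation because interchange in the induction
  step requires it.\<close>

lemma nom_el_vcomp:
  assumes "1 \<le> n" "famT W X n a" "famT W X n b" "\<And>k. 1 \<le> k \<Longrightarrow> k \<le> n \<Longrightarrow> vsrc (b k) = vtrg (a k)"
  shows "nom_el X n b \<bullet> nom_el X n a = nom_el X n (\<lambda>k. b k \<bullet> a k) \<and> vsrc (nom_el X n b) = vtrg (nom_el X n a)"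
  using assms
proof (induction n rule: nat_induct_at_least)
  case (Suc n)
  have a: "famT W X n a" and b: "famT W X n b"
    using Suc.prems(1,2) famT_mono[of W X "Suc n" _ n] by auto
  note d = famT_nprod[OF a] nom_el_cell[OF Suc.hyps a] nom_el_cell[OF Suc.hyps b]
    famTD[OF Suc.prems(1), of "Suc n"] famTD[OF Suc.prems(2), of "Suc n"]
  have IH: "nom_el X n b \<bullet> nom_el X n a = nom_el X n (\<lambda>k. b k \<bullet> a k)" "vsrc (nom_el X n b) = vtrg (nom_el X n a)"
    using Suc.IH[OF a b] Suc.prems(3) by auto
  have "om_el (nprod K X n) (X (Suc n)) (nom_el X n b \<bullet> nom_el X n a) (b (Suc n) \<bullet> a (Suc n)) =
    om_el (nprod K X n) (X (Suc n)) (nom_el X n b) (b (Suc n)) \<bullet> om_el (nprod K X n) (X (Suc n)) (nom_el X n a) (a (Suc n))"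
    by (rule om_el_vcomp) (use d IH Suc.prems(3) in auto)
  then show ?case using IH d Suc.prems(3)[of "Suc n"] Suc.hyps by (simp add: nom_el_Suc)
qed (use assms in simp)

lemma om_el_natural_left:
  assumes "a \<in> cell K" "b \<in> cell K" "src b = src a" "trg a = T0 M A" "trg b = T0 M B"
    "f \<in> cell K" "src f = A" "trg f = A'" "B \<in> ob K"
  shows "om_el A' B (T2 M f \<star> a) b = T2 M (pair (f \<star> p1 A B) (p2 A B)) \<star> om_el A B a b"
proof -
  have "A \<in> ob K" using assms by auto
  then show ?thesis using om_el_natural[of a b A B f "hid B" A' B] assms by simp
qed

lemma nom_el_natural:
  assumes "1 \<le> n" "famT W X n a"
    "\<And>k. 1 \<le> k \<Longrightarrow> k \<le> n \<Longrightarrow> f k \<in> cell K \<and> src (f k) = X k \<and> trg (f k) = Y k"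
  shows "nom_el Y n (\<lambda>k. T2 M (f k) \<star> a k) = T2 M (ntuple2 (\<lambda>k. f k \<star> nproj2 X n k) n) \<star> nom_el X n a"
  using assms
proof (induction n rule: nat_induct_at_least)
  case base
  then show ?case using famTD[of W X 1 a 1] by (simp add: nproj2_1)
next
  case (Suc n)
  have a1: "famT W X n a" using famT_mono[OF Suc.prems(1)] by simp
  note a = a1 famTD[OF Suc.prems(1), of "Suc n"]
    Suc.prems(2)[of "Suc n"]
  let ?g = "\<lambda>k. f k \<star> nproj2 X n k"
  have o: "obs X n" "obs X (Suc n)" using a famT_obs[OF Suc.prems(1)] by (auto intro: obs_mono)
  note N = nom_el_cell[OF Suc.hyps a(1)]
  have g: "fam (nprod K X n) Y n ?g"
    using Suc.prems(2) o by (auto simp: fam_def)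
  have "ntuple2 (\<lambda>k. f k \<star> nproj2 X (Suc n) k) n = ntuple2 (\<lambda>k. ?g k \<star> p1 (nprod K X n) (X (Suc n))) n"
    using Suc.hyps Suc.prems(2) o a by (intro ntuple2_cong) (auto simp: nproj2_Suc)
  also have "\<dots> = ntuple2 ?g n \<star> p1 (nprod K X n) (X (Suc n))"
    using ntuple2_hcomp[OF Suc.hyps g] o a by simp
  finally show ?case
    using Suc a o g N ntuple2_cell[OF Suc.hyps g]
    by (simp add: nom_el_Suc ntuple2_Suc nproj2_Suc om_el_natural[of _ _ "nprod K X n" "X (Suc n)" "ntuple2 ?g n" "f (Suc n)"]
        nprod_Suc)
qed

definition group2 :: "(nat \<Rightarrow> 'o) \<Rightarrow> nat \<Rightarrow> nat \<Rightarrow> 'c" where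
  "group2 X n i = ntuple2 (merge i (nproj2 X n) (pair (nproj2 X n i) (nproj2 X n (Suc i)))) (n - 1)"

lemma obs_merge:
  assumes "obs X n" "B \<in> ob K"
  shows "obs (merge i X B) (n - 1)"
  using assms by (auto simp: obs_def merge_def)

lemma fam_merge:
  assumes "fam W X n a" "y \<in> cell K" "src y = W" "trg y = B"
  shows "fam W (merge i X B) (n - 1) (merge i a y)"
  using assms by (auto simp: fam_def merge_def)

lemma famT_merge:
  assumes "famT W X n a" "y \<in> cell K" "src y = W" "trg y = T0 M B" "B \<in> ob K"
  shows "famT W (merge i X B) (n - 1) (merge i a y)"
  using assms by (auto simp: famT_iff merge_def)

lemma fam_group2:
  assumes "obs X n" "1 \<le> i" "i < n"
  shows "fam (nprod K X n) (merge i X (X i \<otimes> X (Suc i))) (n - 1)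
    (merge i (nproj2 X n) (pair (nproj2 X n i) (nproj2 X n (Suc i))))"
  using assms by (intro fam_merge) (simp_all)

text \<open>Generalized associativity. The induction starts with the pair in the last two places,
  where \<open>om_el_assoc\<close> moves the bracket; every further step appends a factor that the
  grouping does not touch.\<close>

lemma nom_el_merge:
  assumes "famT W X n a" "1 \<le> i" "i < n"
  shows "nom_el (merge i X (X i \<otimes> X (Suc i))) (n - 1) (merge i a (om_el (X i) (X (Suc i)) (a i) (a (Suc i)))) =
    T2 M (group2 X n i) \<star> nom_el X n a"
proof -
  let ?Y = "merge i X (X i \<otimes> X (Suc i))" and ?b = "merge i a (om_el (X i) (X (Suc i)) (a i) (a (Suc i)))"
  have "famT W X (Suc m) a \<Longrightarrow> nom_el ?Y m ?b = T2 M (group2 X (Suc m) i) \<star> nom_el X (Suc m) a"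
    if "i \<le> m" for m
    using that
  proof (induction m rule: nat_induct_at_least)
    case base
    have "obs X (Suc i)" using famT_obs[OF base(1)] .
    note d = famTD[OF base(1), of i] famTD[OF base(1), of "Suc i"] this
    show ?case
    \<comment> \<open>With \<open>i = 1\<close> nothing precedes the pair, and left bracketing has
      already grouped it.\<close>
    proof (cases "i = 1")
      case True
      with d base show ?thesis
        by (simp add: merge_def group2_def nproj2_Suc nproj2_1 flip: One_nat_def)
          (simp add: numeral_2_eq_2 nproj2_1 nproj2_Suc)
    next
      case False
      then obtain j where i: "i = Suc j" "1 \<le> j" using assms(2) by (cases i) auto
      have fj: "famT W X j a" using famT_mono[OF base(1)] i by simp
      note d' = nom_el_cell[OF i(2) fj]
      have o: "obs X j" "obs X i" "obs X (Suc i)"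
        using famT_obs[OF base(1)] i by (auto intro: obs_mono)
      have eqN: "nom_el ?Y j ?b = nom_el X j a" "nprod K ?Y j = nprod K X j"
        using i by (auto intro!: nom_el_cong nprod_cong simp: merge_def)
      let ?p = "p1 (nprod K X j) (X i) \<star> p1 (nprod K X i) (X (Suc i))"
      \<comment> \<open>The projections in front of the pair tuple up to the projection onto the
        prefix of length \<open>j = i - 1\<close>.\<close>
      have "ntuple2 (merge i (nproj2 X (Suc i)) (pair (nproj2 X (Suc i) i) (nproj2 X (Suc i) (Suc i)))) j =
        ntuple2 (\<lambda>k. nproj2 X j k \<star> ?p) j"
        using i o d assms(2) by (intro ntuple2_cong) (simp_all add: merge_def nproj2_Suc nprod_Suc)
      also have "\<dots> = ?p"
        using i o d assms(2) by (intro ntuple2_nproj2_hcomp) (simp_all add: nprod_Suc)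
      finally have "group2 X (Suc i) i = assoc2 (nprod K X j) (X i) (X (Suc i))"
        using i o d
        by (simp add: group2_def ntuple2_Suc) (simp add: merge_def nproj2_Suc assoc2_def nprod_Suc)
      moreover have "nom_el ?Y i ?b = om_el (nprod K X j) (X i \<otimes> X (Suc i)) (nom_el X j a)
          (om_el (X i) (X (Suc i)) (a i) (a (Suc i)))"
        using i eqN by (simp add: nom_el_Suc) (simp add: merge_def)
      ultimately show ?thesis
        using i o d d' by (simp add: nom_el_Suc om_el_assoc nprod_Suc)
    qed
  next
    case (Suc m)
    note d = famTD[OF Suc.prems, of "Suc (Suc m)"] famTD[OF Suc.prems, of i] famTD[OF Suc.prems, of "Suc i"]
      nom_el_cell[of "Suc m" W X a] famT_obs[OF Suc.prems]
    have m: "1 \<le> m" "i \<le> m" using assms(2) Suc.hyps by auto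
    have fm: "famT W X (Suc m) a" using famT_mono[OF Suc.prems] by simp
    have o: "obs X m" "obs X (Suc m)" "obs X (Suc (Suc m))" "X (Suc m) \<in> ob K"
      using famT_obs[OF Suc.prems] by (auto intro: obs_mono obs_ob)
    let ?c = "\<lambda>n. merge i (nproj2 X n) (pair (nproj2 X n i) (nproj2 X n (Suc i)))"
    let ?p = "p1 (nprod K X (Suc m)) (X (Suc (Suc m)))"
    have f: "fam (nprod K X (Suc m)) ?Y m (?c (Suc m))"
      using fam_group2[of X "Suc m" i] o assms(2) m by simp
    have "ntuple2 (?c (Suc (Suc m))) m = ntuple2 (\<lambda>k. ?c (Suc m) k \<star> ?p) m"
      using m o d(4,8,12) assms(2) by (intro ntuple2_cong) (auto simp: merge_def nproj2_Suc nprod_Suc)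
    also have "\<dots> = ntuple2 (?c (Suc m)) m \<star> ?p"
      using ntuple2_hcomp[OF m(1) f] o d by simp
    finally have "group2 X (Suc (Suc m)) i = pair (group2 X (Suc m) i \<star> ?p) (p2 (nprod K X (Suc m)) (X (Suc (Suc m))))"
      using m o d by (simp add: group2_def ntuple2_Suc) (simp add: merge_def nproj2_Suc)
    moreover have "nom_el ?Y (Suc m) ?b = om_el (nprod K ?Y m) (X (Suc (Suc m))) (nom_el ?Y m ?b) (a (Suc (Suc m)))"
      using m by (simp add: nom_el_Suc) (simp add: merge_def)
    moreover have "group2 X (Suc m) i \<in> cell K" "src (group2 X (Suc m) i) = nprod K X (Suc m)"
      "trg (group2 X (Suc m) i) = nprod K ?Y m"
      using ntuple2_cell[OF m(1) f] by (simp_all add: group2_def)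
    ultimately show ?case
      using Suc.IH[OF fm] d fm m o by (simp add: om_el_natural_left nom_el_Suc[of "Suc m"])
  qed
  from this[of "n - 1"] assms show ?thesis by simp
qed

end

section \<open>Substituting a block of factors\<close>

definition merge3 :: "nat \<Rightarrow> (nat \<Rightarrow> 'a) \<Rightarrow> 'a \<Rightarrow> nat \<Rightarrow> 'a" where
  "merge3 i x y = (\<lambda>k. if k < i then x k else if k = i then y else x (Suc (Suc k)))"

lemma merge_merge:
  "merge i (merge i x y) z = merge3 i x z"
  "merge i (merge (Suc i) x y) z = merge3 i x z"
  by (auto simp: merge_def merge3_def fun_eq_iff)

text \<open>Merging at \<open>i\<close> moves all later positions down by one, hence
  \<open>j - 1\<close>.\<close>

lemma merge_merge_commute:
  "Suc i < j \<Longrightarrow> merge (j - 1) (merge i x y) z = merge i (merge j x z) y"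
  by (auto simp: merge_def fun_eq_iff)

context strong_two_monad
begin

text \<open>
  Turns a family of projections out of a product with a factor \<open>A \<otimes> B\<close> in position \<open>i\<close> into the
  projections onto the ungrouped factors.
\<close>

definition unmerge :: "nat \<Rightarrow> 'o \<Rightarrow> 'o \<Rightarrow> (nat \<Rightarrow> 'c) \<Rightarrow> nat \<Rightarrow> 'c" where
  "unmerge i A B q j = (if j < i then q j else if j = i then p1 A B \<star> q i
     else if j = Suc i then p2 A B \<star> q i else q (j - 1))"

definition idfam :: "nat \<Rightarrow> (nat \<Rightarrow> 'c) \<Rightarrow> bool" where
  "idfam n a \<longleftrightarrow> (\<forall>k. 1 \<le> k \<and> k \<le> n \<longrightarrow> vsrc (a k) = a k)"

text \<open>The common shape of all 2-cells below: iterated \<open>\<omega>\<close> on a possibly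
  coarser list, followed by \<open>T\<close> of the 1-cell with components \<open>r\<close> that
  restores the intended product. Changes of grouping or order affect \<open>r\<close> only.\<close>

definition plug_with :: "(nat \<Rightarrow> 'c) \<Rightarrow> nat \<Rightarrow> (nat \<Rightarrow> 'o) \<Rightarrow> nat \<Rightarrow> (nat \<Rightarrow> 'c) \<Rightarrow> 'c" where
  "plug_with r n Y m b = T2 M (ntuple2 r n) \<star> nom_el Y m b"

lemma idfam_ntuple2:
  assumes "1 \<le> n" "fam V X n r" "idfam n r"
  shows "vsrc (ntuple2 r n) = ntuple2 r n" "vtrg (ntuple2 r n) = ntuple2 r n"
proof -
  show *: "vsrc (ntuple2 r n) = ntuple2 r n"
    unfolding vsrc_ntuple2(1)[OF assms(1,2)]
    by (rule ntuple2_cong) (use assms in \<open>auto simp: idfam_def\<close>)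
  show "vtrg (ntuple2 r n) = ntuple2 r n"
    by (rule vtrg_if_vsrc[OF _ *]) (use ntuple2_cell[OF assms(1,2)] in auto)
qed

lemma plug_with_cell:
  assumes "1 \<le> n" "1 \<le> m" "fam (nprod K Y m) X n r" "idfam n r" "famT W Y m b"
  shows "plug_with r n Y m b \<in> cell K" "src (plug_with r n Y m b) = W" "trg (plug_with r n Y m b) = T0 M (nprod K X n)"
    "vsrc (plug_with r n Y m b) = plug_with r n Y m (\<lambda>k. vsrc (b k))"
    "vtrg (plug_with r n Y m b) = plug_with r n Y m (\<lambda>k. vtrg (b k))"
  using nom_el_cell[OF assms(2,5)] ntuple2_cell[OF assms(1,3)] idfam_ntuple2[OF assms(1,3,4)]
  by (simp_all add: plug_with_def)

lemma plug_with_vcomp: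
  assumes "1 \<le> n" "1 \<le> m" "fam (nprod K Y m) X n r" "idfam n r" "famT W Y m b" "famT W Y m b'"
    "\<And>k. 1 \<le> k \<Longrightarrow> k \<le> m \<Longrightarrow> vsrc (b' k) = vtrg (b k)"
  shows "plug_with r n Y m b' \<bullet> plug_with r n Y m b = plug_with r n Y m (\<lambda>k. b' k \<bullet> b k)"
  using nom_el_cell[OF assms(2,5)] nom_el_cell[OF assms(2,6)] ntuple2_cell[OF assms(1,3)]
    idfam_ntuple2[OF assms(1,3,4)] nom_el_vcomp[OF assms(2,5,6,7)]
  unfolding plug_with_def by (simp flip: hcomp_vcomp)

lemma plug_with_cong:
  assumes "1 \<le> n" "1 \<le> m" "\<And>k. 1 \<le> k \<Longrightarrow> k \<le> n \<Longrightarrow> r k = r' k"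
    "\<And>k. 1 \<le> k \<Longrightarrow> k \<le> m \<Longrightarrow> Y k = Y' k" "\<And>k. 1 \<le> k \<Longrightarrow> k \<le> m \<Longrightarrow> b k = b' k"
  shows "plug_with r n Y m b = plug_with r' n Y' m b'"
  unfolding plug_with_def by (simp only: ntuple2_cong[OF assms(1,3)] nom_el_cong[OF assms(2,4,5)])

lemma nproj2_group2:
  assumes "obs X (Suc m)" "1 \<le> i" "i \<le> m" "1 \<le> k" "k \<le> m"
  shows "nproj2 (merge i X (X i \<otimes> X (Suc i))) m k \<star> group2 X (Suc m) i =
    merge i (nproj2 X (Suc m)) (pair (nproj2 X (Suc m) i) (nproj2 X (Suc m) (Suc i))) k"
  using nproj2_ntuple2[of m "nprod K X (Suc m)"] fam_group2[of X "Suc m" i] assms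
  by (simp add: group2_def)

lemma group2_cell:
  assumes "obs X (Suc m)" "1 \<le> i" "i \<le> m"
  shows "group2 X (Suc m) i \<in> cell K" "src (group2 X (Suc m) i) = nprod K X (Suc m)"
    "trg (group2 X (Suc m) i) = nprod K (merge i X (X i \<otimes> X (Suc i))) m"
  using ntuple2_cell[of m "nprod K X (Suc m)"] fam_group2[of X "Suc m" i] assms
  by (simp_all add: group2_def)

lemma plug_with_merge:
  assumes "1 \<le> n" "famT W Y (Suc m) b" "1 \<le> i" "i \<le> m"
    "fam (nprod K (merge i Y (Y i \<otimes> Y (Suc i))) m) X n r"
    "\<And>j. 1 \<le> j \<Longrightarrow> j \<le> n \<Longrightarrow> r j \<star> group2 Y (Suc m) i = r' j"
  shows "plug_with r n (merge i Y (Y i \<otimes> Y (Suc i))) m (merge i b (om_el (Y i) (Y (Suc i)) (b i) (b (Suc i)))) =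
    plug_with r' n Y (Suc m) b"
proof -
  note o = famT_obs[OF assms(2)]
  have "ntuple2 r' n = ntuple2 r n \<star> group2 Y (Suc m) i"
    using ntuple2_hcomp[OF assms(1,5)] group2_cell[OF o assms(3,4)] ntuple2_cong[OF assms(1,6)] by simp
  then show ?thesis
    using nom_el_merge[OF assms(2,3)] group2_cell[OF o assms(3,4)] ntuple2_cell[OF assms(1,5)] assms(4)
      nom_el_cell[OF _ assms(2)]
    by (simp add: plug_with_def T2_fuse)
qed

lemma plug_with_natural:
  assumes "1 \<le> n" "1 \<le> m" "fam (nprod K Y m) X n r" "famT W Y' m b'"
    "\<And>k. 1 \<le> k \<Longrightarrow> k \<le> m \<Longrightarrow> f k \<in> cell K \<and> src (f k) = Y' k \<and> trg (f k) = Y k"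
    "\<And>k. 1 \<le> k \<Longrightarrow> k \<le> m \<Longrightarrow> b k = T2 M (f k) \<star> b' k"
    "\<And>j. 1 \<le> j \<Longrightarrow> j \<le> n \<Longrightarrow> r j \<star> ntuple2 (\<lambda>k. f k \<star> nproj2 Y' m k) m = r' j"
  shows "plug_with r n Y m b = plug_with r' n Y' m b'"
proof -
  let ?c = "ntuple2 (\<lambda>k. f k \<star> nproj2 Y' m k) m"
  have "fam (nprod K Y' m) Y m (\<lambda>k. f k \<star> nproj2 Y' m k)"
    using assms(5) famT_obs[OF assms(4)] by (auto simp: fam_def)
  note c = ntuple2_cell[OF assms(2) this]
  have "ntuple2 r' n = ntuple2 r n \<star> ?c"
    using ntuple2_hcomp[OF assms(1,3)] c ntuple2_cong[OF assms(1,7)] by simp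
  moreover have "nom_el Y m b = T2 M ?c \<star> nom_el Y' m b'"
  proof -
    have "nom_el Y m b = nom_el Y m (\<lambda>k. T2 M (f k) \<star> b' k)"
      by (rule nom_el_cong[OF assms(2) refl assms(6)])
    with nom_el_natural[OF assms(2,4,5)] show ?thesis by simp
  qed
  ultimately show ?thesis
    using c ntuple2_cell[OF assms(1,3)] nom_el_cell[OF assms(2,4)] by (simp add: plug_with_def T2_fuse)
qed

lemma nproj2_natural:
  assumes "1 \<le> m" "obs Y' m" "1 \<le> k" "k \<le> m"
    "\<And>k. 1 \<le> k \<Longrightarrow> k \<le> m \<Longrightarrow> f k \<in> cell K \<and> src (f k) = Y' k \<and> trg (f k) = Y k"
  shows "nproj2 Y m k \<star> ntuple2 (\<lambda>k. f k \<star> nproj2 Y' m k) m = f k \<star> nproj2 Y' m k"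
proof -
  have "fam (nprod K Y' m) Y m (\<lambda>k. f k \<star> nproj2 Y' m k)"
    using assms(2,5) by (auto simp: fam_def)
  from nproj2_ntuple2[OF assms(1) this assms(3,4)] show ?thesis by simp
qed

definition perm2 :: "(nat \<Rightarrow> 'o) \<Rightarrow> nat \<Rightarrow> (nat \<Rightarrow> nat) \<Rightarrow> 'c" where
  "perm2 X n s = ntuple2 (\<lambda>k. nproj2 (X \<circ> s) n (inv s k)) n"

lemma permutes_range:
  assumes "s permutes {1..n}" "1 \<le> k" "k \<le> n"
  shows "1 \<le> s k" "s k \<le> n" "1 \<le> inv s k" "inv s k \<le> n" "s (inv s k) = k" "inv s (s k) = k"
  using assms permutes_in_image[OF assms(1), of k] permutes_in_image[OF permutes_inv[OF assms(1)], of k]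
    permutes_inverses[OF assms(1)] by auto

lemma obs_perm: "\<lbrakk>obs X n; s permutes {1..n}\<rbrakk> \<Longrightarrow> obs (X \<circ> s) n"
  using permutes_range(1,2)[of s n] by (simp add: obs_def)

lemma famT_perm: "\<lbrakk>famT W X n a; s permutes {1..n}\<rbrakk> \<Longrightarrow> famT W (X \<circ> s) n (a \<circ> s)"
  using permutes_range(1,2)[of s n] by (simp add: famT_iff)

lemma idfam_perm: "\<lbrakk>idfam n a; s permutes {1..n}\<rbrakk> \<Longrightarrow> idfam n (a \<circ> s)"
  using permutes_range(1,2)[of s n] by (simp add: idfam_def)

lemma fam_perm2:
  assumes "obs X n" "s permutes {1..n}"
  shows "fam (nprod K (X \<circ> s) n) X n (\<lambda>k. nproj2 (X \<circ> s) n (inv s k))"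
  using obs_perm[OF assms] permutes_range[OF assms(2)] by (auto simp: fam_def)

lemma perm2_cell:
  assumes "1 \<le> n" "obs X n" "s permutes {1..n}"
  shows "perm2 X n s \<in> cell K" "src (perm2 X n s) = nprod K (X \<circ> s) n" "trg (perm2 X n s) = nprod K X n"
    "vsrc (perm2 X n s) = perm2 X n s" "vtrg (perm2 X n s) = perm2 X n s"
proof -
  have "idfam n (\<lambda>k. nproj2 (X \<circ> s) n (inv s k))"
    using obs_perm[OF assms(2,3)] permutes_range[OF assms(3)] by (auto simp: idfam_def)
  from idfam_ntuple2[OF assms(1) fam_perm2[OF assms(2,3)] this] ntuple2_cell[OF assms(1) fam_perm2[OF assms(2,3)]]
  show "perm2 X n s \<in> cell K" "src (perm2 X n s) = nprod K (X \<circ> s) n" "trg (perm2 X n s) = nprod K X n"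
    "vsrc (perm2 X n s) = perm2 X n s" "vtrg (perm2 X n s) = perm2 X n s"
    by (simp_all add: perm2_def)
qed

lemma perm2_ntuple2:
  assumes "1 \<le> n" "s permutes {1..n}" "fam V (X \<circ> s) n r" "obs X n"
  shows "perm2 X n s \<star> ntuple2 r n = ntuple2 (\<lambda>k. r (inv s k)) n"
proof -
  have "perm2 X n s \<star> ntuple2 r n = ntuple2 (\<lambda>k. nproj2 (X \<circ> s) n (inv s k) \<star> ntuple2 r n) n"
    using ntuple2_hcomp[OF assms(1) fam_perm2[OF assms(4,2)]] ntuple2_cell[OF assms(1,3)] by (simp add: perm2_def)
  also have "\<dots> = ntuple2 (\<lambda>k. r (inv s k)) n"
    by (rule ntuple2_cong[OF assms(1)], rule nproj2_ntuple2[OF assms(1,3)])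
      (use permutes_range[OF assms(2)] in auto)
  finally show ?thesis .
qed

text \<open>The component into \<open>X k\<close> is found at position \<open>inv s k\<close>, so a
  permutation reindexes the components by its inverse.\<close>

lemma plug_with_perm:
  assumes "1 \<le> n" "1 \<le> m" "s permutes {1..n}" "fam (nprod K Y m) (X \<circ> s) n r" "obs X n" "famT W Y m b"
  shows "T2 M (perm2 X n s) \<star> plug_with r n Y m b = plug_with (\<lambda>k. r (inv s k)) n Y m b"
  using assms perm2_ntuple2[OF assms(1,3,4,5)] perm2_cell[OF assms(1,5,3)] ntuple2_cell[OF assms(1,4)] nom_el_cell[OF assms(2,6)]
  by (simp add: plug_with_def T2_fuse)

lemma perm2_comp:
  assumes "1 \<le> n" "s permutes {1..n}" "t permutes {1..n}" "obs X n"
  shows "perm2 X n s \<star> perm2 (X \<circ> s) n t = perm2 X n (s \<circ> t)"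
proof -
  have "inv (s \<circ> t) = inv t \<circ> inv s"
    using assms by (meson o_inv_distrib permutes_bij)
  with perm2_ntuple2[OF assms(1,2) fam_perm2[OF obs_perm[OF assms(4,2)] assms(3)] assms(4)]
  show ?thesis by (simp add: perm2_def o_assoc)
qed

lemma fam_unmerge:
  assumes "fam V (merge i X (X i \<otimes> X (Suc i))) m q" "1 \<le> i" "i \<le> m" "obs X (Suc m)"
    "A = X i" "B = X (Suc i)"
  shows "fam V X (Suc m) (unmerge i A B q)"
proof -
  have *: "q k \<in> cell K" "src (q k) = V" "trg (q k) = merge i X (X i \<otimes> X (Suc i)) k"
    if "1 \<le> k" "k \<le> m" for k using famD[OF assms(1) that] .
  have "X i \<in> ob K" "X (Suc i) \<in> ob K" using assms by (auto simp: obs_def)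
  moreover have "k - Suc 0 \<le> m" "1 \<le> k - Suc 0" "\<not> k - Suc 0 \<le> i" "Suc (k - Suc 0) = k"
    if "Suc i < k" "k \<le> Suc m" for k using that assms(2) by auto
  ultimately show ?thesis
    using *[of i] assms *[of "_ - Suc 0"] *
    by (auto simp: fam_def unmerge_def merge_def)
qed

lemma unmerge_hcomp:
  assumes "fam V Z m q" "1 \<le> i" "i \<le> m" "Z i = A \<otimes> B" "A \<in> ob K" "B \<in> ob K"
    "w \<in> cell K" "trg w = V" "1 \<le> j" "j \<le> Suc m"
  shows "unmerge i A B q j \<star> w = unmerge i A B (\<lambda>k. q k \<star> w) j"
  using famD[OF assms(1), of i] assms by (auto simp: unmerge_def)

lemma unmerge_cong:
  assumes "1 \<le> i" "i \<le> m" "1 \<le> j" "j \<le> Suc m" "\<And>k. 1 \<le> k \<Longrightarrow> k \<le> m \<Longrightarrow> q k = q' k"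
  shows "unmerge i A B q j = unmerge i A B q' j"
  using assms by (auto simp: unmerge_def)

lemma idfam_unmerge:
  assumes "fam V Z m q" "idfam m q" "1 \<le> i" "i \<le> m" "Z i = A \<otimes> B" "A \<in> ob K" "B \<in> ob K"
  shows "idfam (Suc m) (unmerge i A B q)"
proof -
  have "vsrc (q (j - 1)) = q (j - 1)" if "i < j" "j \<noteq> Suc i" "j \<le> Suc m" for j
  proof -
    have "1 \<le> j - 1" "j - 1 \<le> m" using that assms(3) by auto
    with assms(2) show ?thesis by (simp add: idfam_def)
  qed
  then show ?thesis
    using famD[OF assms(1), of i] assms by (auto simp: unmerge_def idfam_def)
qed

text \<open>
  The operators by which projections of one product are computed from those of another.  Naturality in
  the domain reduces every coherence question about regroupings and permutations to an equation
  between components.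
\<close>

definition regrouping :: "((nat \<Rightarrow> 'c) \<Rightarrow> nat \<Rightarrow> 'c) \<Rightarrow> nat \<Rightarrow> nat \<Rightarrow> (nat \<Rightarrow> 'o) \<Rightarrow> (nat \<Rightarrow> 'o) \<Rightarrow> bool" where
  "regrouping R n m X Y \<longleftrightarrow> (\<forall>V q. fam V Y m q \<longrightarrow> fam V X n (R q) \<and> (idfam m q \<longrightarrow> idfam n (R q)) \<and>
     (\<forall>w j. w \<in> cell K \<and> trg w = V \<and> 1 \<le> j \<and> j \<le> n \<longrightarrow> R q j \<star> w = R (\<lambda>k. q k \<star> w) j) \<and>
     (\<forall>q' j. (\<forall>k. 1 \<le> k \<and> k \<le> m \<longrightarrow> q k = q' k) \<and> 1 \<le> j \<and> j \<le> n \<longrightarrow> R q j = R q' j))"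

lemma linD:
  assumes "regrouping R n m X Y" "fam V Y m q"
  shows "fam V X n (R q)" "idfam m q \<Longrightarrow> idfam n (R q)"
    "\<lbrakk>w \<in> cell K; trg w = V; 1 \<le> j; j \<le> n\<rbrakk> \<Longrightarrow> R q j \<star> w = R (\<lambda>k. q k \<star> w) j"
    "\<lbrakk>\<And>k. 1 \<le> k \<Longrightarrow> k \<le> m \<Longrightarrow> q k = q' k; 1 \<le> j; j \<le> n\<rbrakk> \<Longrightarrow> R q j = R q' j"
proof -
  note * = assms(1)[unfolded regrouping_def, THEN spec, THEN spec, THEN mp, OF assms(2)]
  note ** = *[THEN conjunct2, THEN conjunct2]
  show "fam V X n (R q)" by (rule *[THEN conjunct1])
  show "idfam m q \<Longrightarrow> idfam n (R q)" by (rule *[THEN conjunct2, THEN conjunct1, THEN mp])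
  show "\<lbrakk>w \<in> cell K; trg w = V; 1 \<le> j; j \<le> n\<rbrakk> \<Longrightarrow> R q j \<star> w = R (\<lambda>k. q k \<star> w) j"
    using **[THEN conjunct1] by simp
  show "\<lbrakk>\<And>k. 1 \<le> k \<Longrightarrow> k \<le> m \<Longrightarrow> q k = q' k; 1 \<le> j; j \<le> n\<rbrakk> \<Longrightarrow> R q j = R q' j"
    using **[THEN conjunct2] by simp
qed

lemma regrouping_unmerge:
  assumes "Y = merge i X (A \<otimes> B)" "1 \<le> i" "i \<le> m" "obs X (Suc m)" "X i = A" "X (Suc i) = B"
  shows "regrouping (unmerge i A B) (Suc m) m X Y"
  unfolding regrouping_def
proof (intro allI impI conjI)
  fix V q assume q: "fam V Y m q"
  have o: "A \<in> ob K" "B \<in> ob K" and Y: "Y i = A \<otimes> B"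
    using assms by (auto simp: obs_def merge_def)
  show "fam V X (Suc m) (unmerge i A B q)"
    by (rule fam_unmerge[OF q[unfolded assms(1), folded assms(5,6)]]) (use assms in auto)
  show "idfam m q \<Longrightarrow> idfam (Suc m) (unmerge i A B q)"
    using idfam_unmerge[OF q _ assms(2,3) Y o] by simp
  show "unmerge i A B q j \<star> w = unmerge i A B (\<lambda>k. q k \<star> w) j"
    if "w \<in> cell K \<and> trg w = V \<and> 1 \<le> j \<and> j \<le> Suc m" for w j
    by (rule unmerge_hcomp[OF q assms(2,3) Y o]) (use that in auto)
  show "unmerge i A B q j = unmerge i A B q' j"
    if "(\<forall>k. 1 \<le> k \<and> k \<le> m \<longrightarrow> q k = q' k) \<and> 1 \<le> j \<and> j \<le> Suc m" for q' j
    by (rule unmerge_cong[OF assms(2,3)]) (use that in auto)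
qed

lemma regrouping_comp:
  assumes R: "regrouping R n m X Y" and S: "regrouping S m l Y Z"
  shows "regrouping (\<lambda>q. R (S q)) n l X Z"
  unfolding regrouping_def
proof (intro allI impI conjI)
  fix V q assume q: "fam V Z l q"
  note Sq = linD(1)[OF S q]
  show "fam V X n (R (S q))" by (rule linD(1)[OF R Sq])
  show "idfam l q \<Longrightarrow> idfam n (R (S q))"
    by (rule linD(2)[OF R Sq], rule linD(2)[OF S q])
  show "R (S q) j \<star> w = R (S (\<lambda>k. q k \<star> w)) j"
    if w: "w \<in> cell K \<and> trg w = V \<and> 1 \<le> j \<and> j \<le> n" for w j
  proof -
    have "R (S q) j \<star> w = R (\<lambda>k. S q k \<star> w) j"
      by (rule linD(3)[OF R Sq]) (use w in auto)
    also have "\<dots> = R (S (\<lambda>k. q k \<star> w)) j"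
    proof (rule linD(4)[OF R])
      show "fam (src w) Y m (\<lambda>k. S q k \<star> w)" by (rule fam_hcomp[OF Sq]) (use w in auto)
      show "S q k \<star> w = S (\<lambda>k. q k \<star> w) k" if "1 \<le> k" "k \<le> m" for k
        by (rule linD(3)[OF S q]) (use w that in auto)
    qed (use w in auto)
    finally show ?thesis .
  qed
  show "R (S q) j = R (S q') j"
    if "(\<forall>k. 1 \<le> k \<and> k \<le> l \<longrightarrow> q k = q' k) \<and> 1 \<le> j \<and> j \<le> n" for q' j
    by (rule linD(4)[OF R Sq], rule linD(4)[OF S q]) (use that in auto)
qed

text \<open>Yoneda: an operator natural in the domain is determined by its value on the projections,
  so \<open>R\<close> stands for the 1-cell whose components it yields there.\<close>

definition plug :: "((nat \<Rightarrow> 'c) \<Rightarrow> nat \<Rightarrow> 'c) \<Rightarrow> nat \<Rightarrow> (nat \<Rightarrow> 'o) \<Rightarrow> nat \<Rightarrow> (nat \<Rightarrow> 'c) \<Rightarrow> 'c" where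
  "plug R n Y m b = plug_with (R (nproj2 Y m)) n Y m b"

lemma idfam_nproj2: "obs Y m \<Longrightarrow> idfam m (nproj2 Y m)"
  by (simp add: idfam_def)

lemma plug_cell:
  assumes "1 \<le> n" "1 \<le> m" "regrouping R n m X Y" "famT W Y m b"
  shows "plug R n Y m b \<in> cell K" "src (plug R n Y m b) = W" "trg (plug R n Y m b) = T0 M (nprod K X n)"
    "vsrc (plug R n Y m b) = plug R n Y m (\<lambda>k. vsrc (b k))"
    "vtrg (plug R n Y m b) = plug R n Y m (\<lambda>k. vtrg (b k))"
proof -
  note o = famT_obs[OF assms(4)]
  note e = plug_with_cell[OF assms(1,2) linD(1)[OF assms(3) fam_nproj2[OF o]]
      linD(2)[OF assms(3) fam_nproj2[OF o] idfam_nproj2[OF o]] assms(4)]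
  show "plug R n Y m b \<in> cell K" "src (plug R n Y m b) = W" "trg (plug R n Y m b) = T0 M (nprod K X n)"
    "vsrc (plug R n Y m b) = plug R n Y m (\<lambda>k. vsrc (b k))"
    "vtrg (plug R n Y m b) = plug R n Y m (\<lambda>k. vtrg (b k))"
    unfolding plug_def by (fact e)+
qed

lemma plug_vcomp:
  assumes "1 \<le> n" "1 \<le> m" "regrouping R n m X Y" "famT W Y m b" "famT W Y m b'"
    "\<And>k. 1 \<le> k \<Longrightarrow> k \<le> m \<Longrightarrow> vsrc (b' k) = vtrg (b k)"
  shows "plug R n Y m b' \<bullet> plug R n Y m b = plug R n Y m (\<lambda>k. b' k \<bullet> b k)"
proof -
  note o = famT_obs[OF assms(4)]
  show ?thesis
    unfolding plug_def
    by (rule plug_with_vcomp[OF assms(1,2) linD(1)[OF assms(3) fam_nproj2[OF o]]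
      linD(2)[OF assms(3) fam_nproj2[OF o] idfam_nproj2[OF o]] assms(4,5,6)])
qed

lemma plug_cong:
  assumes "1 \<le> n" "1 \<le> m" "\<And>k. 1 \<le> k \<Longrightarrow> k \<le> m \<Longrightarrow> b k = b' k"
  shows "plug R n Y m b = plug R n Y m b'"
  unfolding plug_def by (rule plug_with_cong[OF assms(1,2) refl refl assms(3)])

text \<open>Generalized associativity in operator form. The remaining condition on \<open>R\<close>
  and \<open>R'\<close> is an equation between components of arbitrary families, without any
  \<open>T\<close> or \<open>\<omega>\<close>.\<close>

lemma plug_merge:
  assumes "1 \<le> n" "famT W Y (Suc m) b" "1 \<le> i" "i \<le> m"
    "Z = merge i Y (Y i \<otimes> Y (Suc i))" "regrouping R n m X Z"
    "\<And>V q j. \<lbrakk>fam V Y (Suc m) q; 1 \<le> j; j \<le> n\<rbrakk> \<Longrightarrow> R (merge i q (pair (q i) (q (Suc i)))) j = R' q j"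
  shows "plug R n Z m (merge i b (om_el (Y i) (Y (Suc i)) (b i) (b (Suc i)))) = plug R' n Y (Suc m) b"
proof -
  note o = famT_obs[OF assms(2)]
  note Y = obs_ob[OF o, of i] obs_ob[OF o, of "Suc i"]
  have oZ: "obs Z m" using obs_merge[OF o, of "Y i \<otimes> Y (Suc i)" i] Y assms by simp
  note l = linD[OF assms(6) fam_nproj2[OF oZ]]
  have "R (nproj2 Z m) j \<star> group2 Y (Suc m) i = R' (nproj2 Y (Suc m)) j" if j: "1 \<le> j" "j \<le> n" for j
  proof -
    have "R (nproj2 Z m) j \<star> group2 Y (Suc m) i = R (\<lambda>k. nproj2 Z m k \<star> group2 Y (Suc m) i) j"
      by (rule l(3)) (use j group2_cell[OF o assms(3,4)] assms(5) in auto)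
    also have "\<dots> = R (merge i (nproj2 Y (Suc m)) (pair (nproj2 Y (Suc m) i) (nproj2 Y (Suc m) (Suc i)))) j"
    proof (rule linD(4)[OF assms(6)])
      show "fam (nprod K Y (Suc m)) Z m (\<lambda>k. nproj2 Z m k \<star> group2 Y (Suc m) i)"
        using fam_hcomp[OF fam_nproj2[OF oZ], of "group2 Y (Suc m) i"] group2_cell[OF o assms(3,4)]
          assms(5) by simp
    qed (use j nproj2_group2[OF o assms(3,4)] assms(5) in auto)
    also have "\<dots> = R' (nproj2 Y (Suc m)) j"
      by (rule assms(7)[OF fam_nproj2[OF o] j])
    finally show ?thesis .
  qed
  then show ?thesis
    unfolding plug_def assms(5)
    by (intro plug_with_merge[OF assms(1-4)]) (use l(1) assms(5) in auto)
qed

text \<open>Factors \<open>T f\<close> in the entries are absorbed into the operator; again only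
  components remain to be compared.\<close>

lemma plug_natural:
  assumes "1 \<le> n" "1 \<le> m" "regrouping R n m X Y" "famT W Y' m b'" "obs Y m"
    "\<And>k. 1 \<le> k \<Longrightarrow> k \<le> m \<Longrightarrow> f k \<in> cell K \<and> src (f k) = Y' k \<and> trg (f k) = Y k"
    "\<And>k. 1 \<le> k \<Longrightarrow> k \<le> m \<Longrightarrow> b k = T2 M (f k) \<star> b' k"
    "\<And>V q j. \<lbrakk>fam V Y' m q; 1 \<le> j; j \<le> n\<rbrakk> \<Longrightarrow> R (\<lambda>k. f k \<star> q k) j = R' q j"
  shows "plug R n Y m b = plug R' n Y' m b'"
  unfolding plug_def
proof (rule plug_with_natural[OF assms(1,2) linD(1)[OF assms(3) fam_nproj2[OF assms(5)]] assms(4,6,7)])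
  fix j assume j: "1 \<le> j" "j \<le> n"
  note o = famT_obs[OF assms(4)]
  let ?c = "ntuple2 (\<lambda>k. f k \<star> nproj2 Y' m k) m"
  have f: "fam (nprod K Y' m) Y m (\<lambda>k. f k \<star> nproj2 Y' m k)"
    using assms(6) o by (auto simp: fam_def)
  note c = ntuple2_cell[OF assms(2) f]
  have "R (nproj2 Y m) j \<star> ?c = R (\<lambda>k. nproj2 Y m k \<star> ?c) j"
    by (rule linD(3)[OF assms(3) fam_nproj2[OF assms(5)]]) (use j c in auto)
  also have "\<dots> = R (\<lambda>k. f k \<star> nproj2 Y' m k) j"
    by (rule linD(4)[OF assms(3) fam_hcomp[OF fam_nproj2[OF assms(5)]]])
      (use j c nproj2_natural[OF assms(2) o _ _ assms(6)] in auto)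
  also have "\<dots> = R' (nproj2 Y' m) j" by (rule assms(8)[OF fam_nproj2[OF o] j])
  finally show "R (nproj2 Y m) j \<star> ?c = R' (nproj2 Y' m) j" .
qed auto

lemma plug_perm:
  assumes "1 \<le> n" "1 \<le> m" "s permutes {1..n}" "regrouping R n m (X \<circ> s) Y" "obs X n" "famT W Y m b"
  shows "T2 M (perm2 X n s) \<star> plug R n Y m b = plug (\<lambda>q k. R q (inv s k)) n Y m b"
  unfolding plug_def
  by (rule plug_with_perm[OF assms(1,2,3) linD(1)[OF assms(4) fam_nproj2] assms(5,6)])
    (rule famT_obs[OF assms(6)])

lemma plug_self: "\<lbrakk>1 \<le> n; famT W X n a\<rbrakk> \<Longrightarrow> plug (\<lambda>q. q) n X n a = nom_el X n a"
  using famT_obs[of W X n a] nom_el_cell[of n W X a] by (simp add: plug_def plug_with_def)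

lemma unmerge_merge:
  assumes "fam V Y (Suc m) q" "1 \<le> i" "i \<le> m" "1 \<le> j" "j \<le> Suc m" "A = Y i" "B = Y (Suc i)"
  shows "unmerge i A B (merge i q (pair (q i) (q (Suc i)))) j = q j"
  using famD[OF assms(1), of i] famD[OF assms(1), of "Suc i"] assms
  by (auto simp: unmerge_def merge_def)

lemma famT_merge_at:
  assumes "famT W X (Suc m) a" "y \<in> cell K" "src y = W" "trg y = T0 M B" "B \<in> ob K"
  shows "famT W (merge i X B) m (merge i a y)"
  using famT_merge[OF assms] by simp

text \<open>
  \<open>plug2\<close> replaces the entries \<open>i\<close> and \<open>i + 1\<close> of the list \<open>a\<close>, to which iterated \<open>\<omega>\<close> is applied, by one
  2-cell into \<open>T (X i \<otimes> X (i + 1))\<close>.  Likewise \<open>plug3\<close> replaces three consecutive entries, and \<open>plug22\<close>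
  two disjoint pairs.
\<close>

definition plug2 :: "(nat \<Rightarrow> 'o) \<Rightarrow> nat \<Rightarrow> nat \<Rightarrow> (nat \<Rightarrow> 'c) \<Rightarrow> 'c \<Rightarrow> 'c" where
  "plug2 X m i a y = plug (unmerge i (X i) (X (Suc i))) (Suc m) (merge i X (X i \<otimes> X (Suc i))) m (merge i a y)"

lemma plug2_cell:
  assumes "famT W X (Suc m) a" "idfam (Suc m) a" "1 \<le> i" "i \<le> m"
    "y \<in> cell K" "src y = W" "trg y = T0 M (X i \<otimes> X (Suc i))"
  shows "plug2 X m i a y \<in> cell K" "src (plug2 X m i a y) = W" "trg (plug2 X m i a y) = T0 M (nprod K X (Suc m))"
    "vsrc (plug2 X m i a y) = plug2 X m i a (vsrc y)"
    "vtrg (plug2 X m i a y) = plug2 X m i a (vtrg y)"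
proof -
  note o = famT_obs[OF assms(1)]
  have m: "1 \<le> m" "1 \<le> Suc m" using assms by auto
  have "X i \<otimes> X (Suc i) \<in> ob K" using o assms by (auto simp: obs_def)
  note f = famT_merge_at[OF assms(1,5,6,7) this]
  note e = plug_cell[OF m(2,1) regrouping_unmerge[OF refl assms(3,4) o refl refl] f]
  show "plug2 X m i a y \<in> cell K" "src (plug2 X m i a y) = W" "trg (plug2 X m i a y) = T0 M (nprod K X (Suc m))"
    using e by (simp_all add: plug2_def)
  have "vtrg (a k) = a k" if "1 \<le> k" "k \<le> Suc m" for k
    using famTD[OF assms(1) that] assms(2) that by (auto simp: idfam_def intro: vtrg_if_vsrc)
  then show "vsrc (plug2 X m i a y) = plug2 X m i a (vsrc y)" "vtrg (plug2 X m i a y) = plug2 X m i a (vtrg y)"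
    using m assms(2) unfolding plug2_def e(4,5)
    by (auto simp: merge_def idfam_def intro!: plug_cong)
qed

text \<open>Since inserting \<open>\<omega>\<close> changes nothing, inserting
  \<open>\<Gamma>\<close> gives a 2-cell whose source is the iterated
  \<open>\<omega>\<close>.\<close>

lemma plug2_om_el:
  assumes "famT W X (Suc m) a" "1 \<le> i" "i \<le> m"
  shows "plug2 X m i a (om_el (X i) (X (Suc i)) (a i) (a (Suc i))) = nom_el X (Suc m) a"
proof -
  note o = famT_obs[OF assms(1)]
  have m: "1 \<le> Suc m" using assms by auto
  have "plug2 X m i a (om_el (X i) (X (Suc i)) (a i) (a (Suc i))) = plug (\<lambda>q. q) (Suc m) X (Suc m) a"
    unfolding plug2_def
    by (rule plug_merge[OF m assms refl regrouping_unmerge[OF refl assms(2,3) o refl refl]])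
      (use unmerge_merge assms in blast)
  with plug_self[OF m assms(1)] show ?thesis by simp
qed

text \<open>A permutation of the whole product that moves only the factors of one block can be
  performed inside that block, as \<open>h\<close> at the single entry \<open>p\<close>. The last
  assumption says, on components, that \<open>h\<close> realizes \<open>s\<close>.\<close>

lemma plug_perm_at:
  assumes n: "1 \<le> n" and s: "s permutes {1..n}" and o: "obs X n"
    and R: "regrouping R n m X Y" and R': "regrouping R' n m (X \<circ> s) Y'" and b': "famT W Y' m b'"
    and p: "1 \<le> p" "p \<le> m" and h: "h \<in> cell K" "src h = Y' p" "trg h = Y p"
    and Y: "\<And>k. 1 \<le> k \<Longrightarrow> k \<le> m \<Longrightarrow> k \<noteq> p \<Longrightarrow> Y k = Y' k"
    and b: "\<And>k. 1 \<le> k \<Longrightarrow> k \<le> m \<Longrightarrow> k \<noteq> p \<Longrightarrow> b k = b' k" "b p = T2 M h \<star> b' p"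
    and q: "\<And>V q j. \<lbrakk>fam V Y' m q; 1 \<le> j; j \<le> n\<rbrakk> \<Longrightarrow>
      R (\<lambda>k. if k = p then h \<star> q k else q k) j = R' q (inv s j)"
  shows "T2 M (perm2 X n s) \<star> plug R' n Y' m b' = plug R n Y m b"
proof -
  have m: "1 \<le> m" using p by simp
  have oY: "obs Y m" unfolding obs_def
    using h(1,3) Y famT_obs[OF b'] trg_ob[of h] by (metis obs_ob)
  let ?f = "\<lambda>k. if k = p then h else hid (Y' k)"
  have "T2 M (perm2 X n s) \<star> plug R' n Y' m b' = plug (\<lambda>q k. R' q (inv s k)) n Y' m b'"
    by (rule plug_perm[OF n m s R' o b'])
  also have "\<dots> = plug R n Y m b"
  proof (rule plug_natural[OF n m R b' oY, symmetric])
    fix k assume k: "1 \<le> k" "k \<le> m"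
    show "?f k \<in> cell K \<and> src (?f k) = Y' k \<and> trg (?f k) = Y k"
      using k h Y obs_ob[OF famT_obs[OF b'] k] by simp
    show "b k = T2 M (?f k) \<star> b' k"
      using k b famTD[OF b' k] by simp
  next
    fix V q j assume qf: "fam V Y' m q" and j: "1 \<le> j" "j \<le> n"
    have e: "(if k = p then h \<star> q k else q k) = ?f k \<star> q k" if "1 \<le> k" "k \<le> m" for k
      using famD[OF qf that] by simp
    have "fam V Y m (\<lambda>k. if k = p then h \<star> q k else q k)"
      using famD[OF qf] h Y p by (auto simp: fam_def)
    from linD(4)[OF R this e j] q[OF qf j]
    show "R (\<lambda>k. ?f k \<star> q k) j = R' q (inv s j)" by simp
  qed
  finally show ?thesis .
qed

lemma transpose_permutes: "\<lbrakk>1 \<le> i; i < n\<rbrakk> \<Longrightarrow> transpose i (Suc i) permutes {1..n}"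
  by (simp add: permutes_swap_id)

lemma unmerge_swap:
  assumes "q i \<in> cell K" "trg (q i) = B \<otimes> A" "A \<in> ob K" "B \<in> ob K"
  shows "unmerge i A B (\<lambda>k. if k = i then pair (p2 B A) (p1 B A) \<star> q k else q k) j =
    unmerge i B A q (transpose i (Suc i) j)"
  using assms by (auto simp: unmerge_def transpose_def)

text \<open>This turns the swap in the target of an inserted \<open>\<Gamma>\<close> into a
  permutation of the whole product.\<close>

lemma plug2_swap:
  assumes "famT W X (Suc m) a" "1 \<le> i" "i \<le> m" "y \<in> cell K" "src y = W" "trg y = T0 M (X (Suc i) \<otimes> X i)"
    "s = transpose i (Suc i)"
  shows "T2 M (perm2 X (Suc m) s) \<star> plug2 (X \<circ> s) m i (a \<circ> s) y =
    plug2 X m i a (T2 M (pair (p2 (X (Suc i)) (X i)) (p1 (X (Suc i)) (X i))) \<star> y)"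
proof -
  note o = famT_obs[OF assms(1)]
  have m: "1 \<le> Suc m" by simp
  have x: "X i \<in> ob K" "X (Suc i) \<in> ob K" using o assms by (auto simp: obs_def)
  have s: "s permutes {1..Suc m}" using assms transpose_permutes by simp
  have si: "s i = Suc i" "s (Suc i) = i" "\<And>k. k \<noteq> i \<Longrightarrow> k \<noteq> Suc i \<Longrightarrow> s k = k"
    using assms(7) by (auto simp: transpose_def)
  have lhs: "plug2 (X \<circ> s) m i (a \<circ> s) y = plug (unmerge i (X (Suc i)) (X i)) (Suc m)
      (merge i (X \<circ> s) (X (Suc i) \<otimes> X i)) m (merge i (a \<circ> s) y)"
    using si by (simp add: plug2_def)
  have l: "regrouping (unmerge i (X (Suc i)) (X i)) (Suc m) m (X \<circ> s) (merge i (X \<circ> s) (X (Suc i) \<otimes> X i))"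
    by (rule regrouping_unmerge[OF refl assms(2,3) obs_perm[OF o s]]) (use si in auto)
  show ?thesis
    unfolding lhs unfolding plug2_def
  proof (rule plug_perm_at[OF m s o regrouping_unmerge[OF refl assms(2,3) o refl refl] l _ assms(2,3)])
    show "famT W (merge i (X \<circ> s) (X (Suc i) \<otimes> X i)) m (merge i (a \<circ> s) y)"
      using famT_merge_at[OF famT_perm[OF assms(1) s] assms(4,5,6)] x by simp
  next
    fix V q j assume q: "fam V (merge i (X \<circ> s) (X (Suc i) \<otimes> X i)) m q"
    from famD[OF q assms(2,3)] show "unmerge i (X i) (X (Suc i))
        (\<lambda>k. if k = i then pair (p2 (X (Suc i)) (X i)) (p1 (X (Suc i)) (X i)) \<star> q k else q k) j =
      unmerge i (X (Suc i)) (X i) q (inv s j)"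
      using unmerge_swap[of q i "X (Suc i)" "X i" j] x assms(7) by (simp add: merge_def)
  qed (use x si in \<open>auto simp: merge_def\<close>)
qed

lemma om_el_natural_right:
  assumes "a \<in> cell K" "b \<in> cell K" "src b = src a" "trg a = T0 M A" "trg b = T0 M B"
    "g \<in> cell K" "src g = B" "trg g = B'" "A \<in> ob K"
  shows "om_el A B' a (T2 M g \<star> b) = T2 M (pair (p1 A B) (g \<star> p2 A B)) \<star> om_el A B a b"
proof -
  have "B \<in> ob K" using assms by auto
  then show ?thesis using om_el_natural[of a b A B "hid A" g A B'] assms by simp
qed

definition plug3 :: "(nat \<Rightarrow> 'o) \<Rightarrow> nat \<Rightarrow> nat \<Rightarrow> (nat \<Rightarrow> 'c) \<Rightarrow> 'c \<Rightarrow> 'c" where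
  "plug3 X m i a y = plug (\<lambda>q. unmerge (Suc i) (X (Suc i)) (X (Suc (Suc i)))
      (unmerge i (X i) (X (Suc i) \<otimes> X (Suc (Suc i))) q)) (Suc (Suc m))
    (merge3 i X (X i \<otimes> (X (Suc i) \<otimes> X (Suc (Suc i))))) m (merge3 i a y)"

lemma regrouping_plug3:
  assumes "obs X (Suc (Suc m))" "1 \<le> i" "i \<le> m" "A = X i" "B = X (Suc i)" "C = X (Suc (Suc i))"
    "Y = merge3 i X (A \<otimes> (B \<otimes> C))"
  shows "regrouping (\<lambda>q. unmerge (Suc i) B C (unmerge i A (B \<otimes> C) q)) (Suc (Suc m)) m X Y"
proof (rule regrouping_comp[where R = "unmerge (Suc i) B C" and S = "unmerge i A (B \<otimes> C)"])
  have "B \<otimes> C \<in> ob K" using assms by (auto simp: obs_def)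
  then have o: "obs (merge (Suc i) X (B \<otimes> C)) (Suc m)"
    using obs_merge[OF assms(1), of "B \<otimes> C" "Suc i"] by simp
  show "regrouping (unmerge (Suc i) B C) (Suc (Suc m)) (Suc m) X (merge (Suc i) X (B \<otimes> C))"
    by (rule regrouping_unmerge[OF refl _ _ assms(1)]) (use assms in auto)
  show "regrouping (unmerge i A (B \<otimes> C)) (Suc m) m (merge (Suc i) X (B \<otimes> C)) Y"
    by (rule regrouping_unmerge[OF _ assms(2,3) o]) (use assms merge_merge(2)[of i X "B \<otimes> C"] in \<open>auto simp: merge_def\<close>)
qed

lemma famT_merge3:
  assumes "famT W X (Suc (Suc m)) a" "y \<in> cell K" "src y = W" "trg y = T0 M B" "B \<in> ob K"
  shows "famT W (merge3 i X B) m (merge3 i a y)"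
  using assms by (auto simp: famT_iff merge3_def)

text \<open>The entries outside the block are 1-cells, for which
  \<open>a k \<bullet> a k = a k\<close>; so vertical composition takes place in the inserted entry
  alone.\<close>

lemma plug3_vcomp:
  assumes "famT W X (Suc (Suc m)) a" "idfam (Suc (Suc m)) a" "1 \<le> i" "i \<le> m"
    "y \<in> cell K" "src y = W" "trg y = T0 M (X i \<otimes> (X (Suc i) \<otimes> X (Suc (Suc i))))"
    "y' \<in> cell K" "vsrc y' = vtrg y"
  shows "plug3 X m i a y' \<bullet> plug3 X m i a y = plug3 X m i a (y' \<bullet> y)"
proof -
  note o = famT_obs[OF assms(1)]
  have y': "src y' = src y" "trg y' = trg y"
    using assms by (metis src_vsrc src_vtrg trg_vsrc trg_vtrg)+
  have m: "1 \<le> m" "1 \<le> Suc (Suc m)" using assms by auto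
  have ob: "X i \<otimes> (X (Suc i) \<otimes> X (Suc (Suc i))) \<in> ob K" using o assms(3,4) by (auto simp: obs_def)
  have id: "vsrc (a k) = a k" "vtrg (a k) = a k" "a k \<bullet> a k = a k" if "1 \<le> k" "k \<le> Suc (Suc m)" for k
    using famTD[OF assms(1) that] assms(2) that by (auto simp: idfam_def intro: vtrg_if_vsrc)
  show ?thesis
    unfolding plug3_def
  proof (subst plug_vcomp[OF m(2,1) regrouping_plug3[OF o assms(3,4) refl refl refl refl]])
    show "famT W (merge3 i X (X i \<otimes> (X (Suc i) \<otimes> X (Suc (Suc i))))) m (merge3 i a y)"
      "famT W (merge3 i X (X i \<otimes> (X (Suc i) \<otimes> X (Suc (Suc i))))) m (merge3 i a y')"
      using famT_merge3[OF assms(1)] assms y' ob by simp_all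
  qed (use assms id m in \<open>auto simp: merge3_def intro!: plug_cong\<close>)
qed

text \<open>\<open>u\<close> assigns to each of the three positions its projection out of the
  permuted block. The three equations then identify \<open>h\<close> as the reshuffle of the block
  that corresponds to \<open>s\<close>.\<close>

lemma plug3_perm:
  assumes a: "famT W X (Suc (Suc m)) a" and i: "1 \<le> i" "i \<le> m"
    and s: "s permutes {1..Suc (Suc m)}"
    and fx: "\<And>k. k < i \<or> Suc (Suc i) < k \<Longrightarrow> s k = k"
    and X: "A = X i" "B = X (Suc i)" "C = X (Suc (Suc i))"
      "A' = X (s i)" "B' = X (s (Suc i))" "C' = X (s (Suc (Suc i)))"
    and h: "h \<in> cell K" "src h = A' \<otimes> (B' \<otimes> C')" "trg h = A \<otimes> (B \<otimes> C)"
    and u: "u = (\<lambda>j. if j = i then p1 A' (B' \<otimes> C') else if j = Suc i then p1 B' C' \<star> p2 A' (B' \<otimes> C')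
        else p2 B' C' \<star> p2 A' (B' \<otimes> C'))"
      "p1 A (B \<otimes> C) \<star> h = u (inv s i)" "p1 B C \<star> p2 A (B \<otimes> C) \<star> h = u (inv s (Suc i))"
      "p2 B C \<star> p2 A (B \<otimes> C) \<star> h = u (inv s (Suc (Suc i)))"
    and y: "y \<in> cell K" "src y = W" "trg y = T0 M (A' \<otimes> (B' \<otimes> C'))"
  shows "T2 M (perm2 X (Suc (Suc m)) s) \<star> plug3 (X \<circ> s) m i (a \<circ> s) y = plug3 X m i a (T2 M h \<star> y)"
proof -
  note o = famT_obs[OF a]
  note os = obs_perm[OF o s]
  have ob: "A \<in> ob K" "B \<in> ob K" "C \<in> ob K" using o i X by (auto simp: obs_def)
  have ob': "A' \<in> ob K" "B' \<in> ob K" "C' \<in> ob K"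
    using obs_ob[OF os, of i] obs_ob[OF os, of "Suc i"] obs_ob[OF os, of "Suc (Suc i)"] i X by auto
  have n: "1 \<le> Suc (Suc m)" by simp
  have inv: "inv s k = k" if "k < i \<or> Suc (Suc i) < k" for k
    using fx[OF that] s by (metis permutes_inverses(2))
  \<comment> \<open>Since \<open>s\<close> fixes every position outside the block, its inverse
    preserves the block.\<close>
  have inv3: "inv s j \<in> {i, Suc i, Suc (Suc i)}" if "j \<in> {i, Suc i, Suc (Suc i)}" for j
  proof (rule ccontr)
    assume "inv s j \<notin> {i, Suc i, Suc (Suc i)}"
    then have "inv s j < i \<or> Suc (Suc i) < inv s j" by auto
    from fx[OF this] have "s (inv s j) = inv s j" .
    then have "j = inv s j" using s by (metis permutes_inverses(1))
    then show False using that \<open>inv s j \<notin> _\<close> by metis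
  qed
  have lhs: "plug3 (X \<circ> s) m i (a \<circ> s) y = plug (\<lambda>q. unmerge (Suc i) B' C' (unmerge i A' (B' \<otimes> C') q)) (Suc (Suc m))
    (merge3 i (X \<circ> s) (A' \<otimes> (B' \<otimes> C'))) m (merge3 i (a \<circ> s) y)"
    using X by (simp add: plug3_def)
  have rhs: "plug3 X m i a (T2 M h \<star> y) = plug (\<lambda>q. unmerge (Suc i) B C (unmerge i A (B \<otimes> C) q)) (Suc (Suc m))
    (merge3 i X (A \<otimes> (B \<otimes> C))) m (merge3 i a (T2 M h \<star> y))"
    using X by (simp add: plug3_def)
  have l: "regrouping (\<lambda>q. unmerge (Suc i) B' C' (unmerge i A' (B' \<otimes> C') q)) (Suc (Suc m)) m (X \<circ> s)
    (merge3 i (X \<circ> s) (A' \<otimes> (B' \<otimes> C')))"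
    by (rule regrouping_plug3[OF os i]) (use X in auto)
  show ?thesis
    unfolding lhs rhs
  proof (rule plug_perm_at[OF n s o regrouping_plug3[OF o i X(1-3) refl] l _ i])
    show "famT W (merge3 i (X \<circ> s) (A' \<otimes> (B' \<otimes> C'))) m (merge3 i (a \<circ> s) y)"
      using famT_merge3[OF famT_perm[OF a s] y] ob' by simp
  next
    fix V q j assume q: "fam V (merge3 i (X \<circ> s) (A' \<otimes> (B' \<otimes> C'))) m q" and j: "1 \<le> j" "j \<le> Suc (Suc m)"
    have qi: "q i \<in> cell K" "trg (q i) = A' \<otimes> (B' \<otimes> C')"
      using famD[OF q i] by (auto simp: merge3_def)
    let ?r = "unmerge (Suc i) B' C' (unmerge i A' (B' \<otimes> C') q)"
    have r: "?r k = u k \<star> q i" if "k \<in> {i, Suc i, Suc (Suc i)}" for k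
      using that u(1) qi ob' by (auto simp: unmerge_def)
    let ?l = "unmerge (Suc i) B C (unmerge i A (B \<otimes> C) (\<lambda>k. if k = i then h \<star> q k else q k))"
    consider "j < i \<or> Suc (Suc i) < j" | "j = i" | "j = Suc i" | "j = Suc (Suc i)" by linarith
    then show "?l j = ?r (inv s j)"
    proof cases
      case 1
      then show ?thesis using inv[OF 1] by (auto simp: unmerge_def)
    next
      case 2
      have "?l j = (p1 A (B \<otimes> C) \<star> h) \<star> q i" using 2 h qi ob by (simp add: unmerge_def)
      then show ?thesis using 2 r[OF inv3[of j]] u(2) by simp
    next
      case 3
      have "?l j = (p1 B C \<star> p2 A (B \<otimes> C) \<star> h) \<star> q i" using 3 h qi ob by (simp add: unmerge_def)
      then show ?thesis using 3 r[OF inv3[of j]] u(3) by simp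
    next
      case 4
      have "?l j = (p2 B C \<star> p2 A (B \<otimes> C) \<star> h) \<star> q i" using 4 h qi ob by (simp add: unmerge_def)
      then show ?thesis using 4 r[OF inv3[of j]] u(4) by simp
    qed
  qed (use h fx in \<open>auto simp: merge3_def\<close>)
qed

text \<open>The first factor of the triple is joined to the pair by generalized associativity, which
  supplies the additional \<open>\<omega>\<close>.\<close>

lemma plug2_plug3_right:
  assumes a: "famT W X (Suc (Suc m)) a" and i: "1 \<le> i" "i \<le> m"
    and X: "A = X i" "B = X (Suc i)" "C = X (Suc (Suc i))"
    and y: "y \<in> cell K" "src y = W" "trg y = T0 M (B \<otimes> C)"
  shows "plug2 X (Suc m) (Suc i) a y = plug3 X m i a (om_el A (B \<otimes> C) (a i) y)"
proof -
  note o = famT_obs[OF a]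
  have ob: "A \<in> ob K" "B \<in> ob K" "C \<in> ob K" using o i X by (auto simp: obs_def)
  let ?Y = "merge (Suc i) X (B \<otimes> C)" and ?b = "merge (Suc i) a y"
  have n: "1 \<le> Suc (Suc m)" by simp
  have Y: "?Y i = A" "?Y (Suc i) = B \<otimes> C" "?b i = a i" "?b (Suc i) = y"
    using X by (auto simp: merge_def)
  have "plug (\<lambda>q. unmerge (Suc i) B C (unmerge i A (B \<otimes> C) q)) (Suc (Suc m)) (merge3 i X (A \<otimes> (B \<otimes> C))) m
      (merge i ?b (om_el (?Y i) (?Y (Suc i)) (?b i) (?b (Suc i)))) =
    plug (unmerge (Suc i) B C) (Suc (Suc m)) ?Y (Suc m) ?b"
  proof (rule plug_merge[OF n _ i _ regrouping_plug3[OF o i X refl]])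
    show "famT W ?Y (Suc m) ?b" using famT_merge_at[OF a y] ob by simp
    show "merge3 i X (A \<otimes> (B \<otimes> C)) = merge i ?Y (?Y i \<otimes> ?Y (Suc i))"
      unfolding Y by (simp add: merge_merge)
  next
    fix V q j assume q: "fam V ?Y (Suc m) q" and j: "1 \<le> j" "j \<le> Suc (Suc m)"
    show "unmerge (Suc i) B C (unmerge i A (B \<otimes> C) (merge i q (pair (q i) (q (Suc i))))) j = unmerge (Suc i) B C q j"
      by (rule unmerge_cong[of "Suc i" "Suc m"], use i j in simp_all)
        (use unmerge_merge[OF q i _ _ Y(1,2)[symmetric]] in simp)
  qed
  then show ?thesis unfolding Y merge_merge plug2_def plug3_def using X by simp
qed

text \<open>Joining the third factor to the pair produces the bracketing
  \<open>(A \<otimes> B) \<otimes> C\<close>, while \<open>plug3\<close> uses the other one.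
  Naturality moves the reassociation into the entry.\<close>

lemma plug2_plug3_left:
  assumes a: "famT W X (Suc (Suc m)) a" and i: "1 \<le> i" "i \<le> m"
    and X: "A = X i" "B = X (Suc i)" "C = X (Suc (Suc i))"
    and y: "y \<in> cell K" "src y = W" "trg y = T0 M (A \<otimes> B)"
  shows "plug2 X (Suc m) i a y = plug3 X m i a (T2 M (assoc2 A B C) \<star> om_el (A \<otimes> B) C y (a (Suc (Suc i))))"
proof -
  note o = famT_obs[OF a]
  have ob: "A \<in> ob K" "B \<in> ob K" "C \<in> ob K" using o i X by (auto simp: obs_def)
  let ?Y = "merge i X (A \<otimes> B)" and ?b = "merge i a y"
  have n: "1 \<le> Suc (Suc m)" and m: "1 \<le> m" using i by auto
  have Y: "?Y i = A \<otimes> B" "?Y (Suc i) = C" "?b i = y" "?b (Suc i) = a (Suc (Suc i))"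
    using X by (auto simp: merge_def)
  have oY: "obs ?Y (Suc m)" using obs_merge[OF o, of "A \<otimes> B" i] ob by simp
  let ?Z = "merge3 i X ((A \<otimes> B) \<otimes> C)"
  let ?R = "\<lambda>q. unmerge i A B (unmerge i (A \<otimes> B) C q)"
  let ?w = "om_el (A \<otimes> B) C y (a (Suc (Suc i)))"
  have w: "?w \<in> cell K" "src ?w = W" "trg ?w = T0 M ((A \<otimes> B) \<otimes> C)"
    using famTD[OF a, of "Suc (Suc i)"] i y ob X by simp_all
  have l: "regrouping ?R (Suc (Suc m)) m X ?Z"
    by (rule regrouping_comp[OF regrouping_unmerge[OF refl _ _ o] regrouping_unmerge[OF _ i oY]])
      (use X i in \<open>auto simp: merge_merge merge_def merge3_def\<close>)
  have "plug ?R (Suc (Suc m)) ?Z m (merge i ?b (om_el (?Y i) (?Y (Suc i)) (?b i) (?b (Suc i)))) =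
    plug (unmerge i A B) (Suc (Suc m)) ?Y (Suc m) ?b"
  proof (rule plug_merge[OF n _ i _ l])
    show "famT W ?Y (Suc m) ?b" using famT_merge_at[OF a y] ob by simp
    show "?Z = merge i ?Y (?Y i \<otimes> ?Y (Suc i))"
      unfolding Y by (simp add: merge_merge)
  next
    fix V q j assume q: "fam V ?Y (Suc m) q" and j: "1 \<le> j" "j \<le> Suc (Suc m)"
    show "?R (merge i q (pair (q i) (q (Suc i)))) j = unmerge i A B q j"
      by (rule unmerge_cong[of i "Suc m"], use i j in simp_all)
        (use unmerge_merge[OF q i _ _ Y(1,2)[symmetric]] in simp)
  qed
  then have "plug2 X (Suc m) i a y = plug ?R (Suc (Suc m)) ?Z m (merge3 i a ?w)"
    unfolding Y merge_merge plug2_def using X by simp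
  also have "\<dots> = plug3 X m i a (T2 M (assoc2 A B C) \<star> ?w)"
    unfolding plug3_def X(1-3)[symmetric]
  proof (rule plug_natural[OF n m regrouping_plug3[OF o i X refl], symmetric])
    show "famT W ?Z m (merge3 i a ?w)" using famT_merge3[OF a w] ob by simp
    show "obs (merge3 i X (A \<otimes> (B \<otimes> C))) m" using o ob by (auto simp: obs_def merge3_def)
    let ?f = "\<lambda>k. if k = i then assoc2 A B C else hid (?Z k)"
    fix k assume k: "1 \<le> k" "k \<le> m"
    show "?f k \<in> cell K \<and> src (?f k) = ?Z k \<and> trg (?f k) = merge3 i X (A \<otimes> (B \<otimes> C)) k"
      using k ob o by (auto simp: merge3_def obs_def)
    show "merge3 i a (T2 M (assoc2 A B C) \<star> ?w) k = T2 M (?f k) \<star> merge3 i a ?w k"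
      using k ob o famTD[OF a, of k] famTD[OF a, of "Suc (Suc k)"] by (auto simp: merge3_def)
  next
    let ?f = "\<lambda>k. if k = i then assoc2 A B C else hid (?Z k)"
    fix V q j assume q: "fam V ?Z m q" and j: "1 \<le> j" "j \<le> Suc (Suc m)"
    have qi: "q i \<in> cell K" "trg (q i) = (A \<otimes> B) \<otimes> C"
      using famD[OF q i] by (auto simp: merge3_def)
    have qj: "hid (?Z k) \<star> q k = q k" if "1 \<le> k" "k \<le> m" for k
      using famD[OF q that] by simp
    \<comment> \<open>Three positions have become one, so a position behind the block is shifted by
      two.\<close>
    have b: "1 \<le> j - 2" "j - 2 \<le> m" "j - 2 \<noteq> i" "j - Suc 0 - Suc 0 = j - 2" "j - Suc 0 \<noteq> Suc i" "\<not> j - Suc 0 < i"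
      if "Suc (Suc i) < j" using that i j by auto
    consider "j < i" | "j = i" | "j = Suc i" | "j = Suc (Suc i)" | "Suc (Suc i) < j" by linarith
    then show "unmerge (Suc i) B C (unmerge i A (B \<otimes> C) (\<lambda>k. ?f k \<star> q k)) j = ?R q j"
    proof cases
      case 1
      then show ?thesis using qj[of j] i j by (simp add: unmerge_def)
    next
      case 5
      then show ?thesis using qj[of "j - 2"] b by (auto simp: unmerge_def)
    qed (use qi ob in \<open>auto simp: unmerge_def assoc2_def\<close>)
  qed
  finally show ?thesis .
qed

text \<open>Before the pair at \<open>i\<close> is split, the pair meant for position
  \<open>j\<close> sits at \<open>j - 1\<close>.\<close>

lemma unmerge_commute:
  assumes "Suc i < j"
  shows "unmerge j C D (unmerge i A B q) = unmerge i A B (unmerge (j - 1) C D q)"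
proof
  fix k
  obtain j' where j: "j = Suc j'" "i < j'" using assms by (cases j) auto
  consider "k < i" | "k = i" | "k = Suc i" | "Suc i < k" "k < j" | "k = j" | "k = Suc j"
    | k' where "k = Suc (Suc k')" "j' < k'"
  proof (cases "Suc j < k")
    case True
    then have "k = Suc (Suc (k - 2))" "j' < k - 2" using j by auto
    then show ?thesis by (rule that(7))
  qed (use that in linarith)
  then show "unmerge j C D (unmerge i A B q) k = unmerge i A B (unmerge (j - 1) C D q) k"
    by cases (use j in \<open>simp_all add: unmerge_def\<close>)
qed

text \<open>Splitting at \<open>i\<close> shifts everything behind it by one, including a
  transposition that takes place there.\<close>

lemma unmerge_transpose:
  assumes "i < j"
  shows "unmerge i A B (\<lambda>k. r (transpose j (Suc j) k)) k = unmerge i A B r (transpose (Suc j) (Suc (Suc j)) k)"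
proof -
  consider "k \<le> Suc i" | "k = Suc j" | "k = Suc (Suc j)" | k' where "k = Suc k'" "Suc i < k" "k' \<noteq> j" "k' \<noteq> Suc j"
  proof (cases k)
    case (Suc n)
    then show ?thesis using that
      by (cases "k \<le> Suc i"; cases "n = j"; cases "n = Suc j") auto
  qed (use that in auto)
  then show ?thesis
    by cases (use assms in \<open>simp_all add: unmerge_def transpose_def\<close>)
qed

definition plug22 :: "(nat \<Rightarrow> 'o) \<Rightarrow> nat \<Rightarrow> nat \<Rightarrow> nat \<Rightarrow> (nat \<Rightarrow> 'c) \<Rightarrow> 'c \<Rightarrow> 'c \<Rightarrow> 'c" where
  "plug22 X m i j a y z = plug (\<lambda>q. unmerge j (X j) (X (Suc j)) (unmerge i (X i) (X (Suc i)) q)) (Suc (Suc m))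
    (merge i (merge j X (X j \<otimes> X (Suc j))) (X i \<otimes> X (Suc i))) m (merge i (merge j a z) y)"

lemma regrouping_plug22:
  assumes "obs X (Suc (Suc m))" "1 \<le> i" "Suc i < j" "j \<le> Suc m" "A = X i" "B = X (Suc i)" "C = X j"
    "D = X (Suc j)" "Y = merge i (merge j X (C \<otimes> D)) (A \<otimes> B)"
  shows "regrouping (\<lambda>q. unmerge j C D (unmerge i A B q)) (Suc (Suc m)) m X Y"
proof (rule regrouping_comp[where R = "unmerge j C D" and S = "unmerge i A B"])
  have "C \<otimes> D \<in> ob K" using assms by (auto simp: obs_def)
  then have o: "obs (merge j X (C \<otimes> D)) (Suc m)"
    using obs_merge[OF assms(1), of "C \<otimes> D" j] by simp
  show "regrouping (unmerge j C D) (Suc (Suc m)) (Suc m) X (merge j X (C \<otimes> D))"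
    by (rule regrouping_unmerge[OF refl _ _ assms(1)]) (use assms in auto)
  show "regrouping (unmerge i A B) (Suc m) m (merge j X (C \<otimes> D)) Y"
    by (rule regrouping_unmerge[OF _ assms(2) _ o]) (use assms in \<open>auto simp: merge_def\<close>)
qed

lemma famT_plug22:
  assumes "famT W X (Suc (Suc m)) a" "y \<in> cell K" "src y = W" "trg y = T0 M P" "P \<in> ob K"
    "z \<in> cell K" "src z = W" "trg z = T0 M Q" "Q \<in> ob K"
  shows "famT W (merge i (merge j X Q) P) m (merge i (merge j a z) y)"
  by (rule famT_merge_at[OF famT_merge_at[OF assms(1,6-9)] assms(2-5)])

lemma plug22_vcomp:
  assumes "famT W X (Suc (Suc m)) a" "idfam (Suc (Suc m)) a" "1 \<le> i" "Suc i < j" "j \<le> Suc m"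
    "y \<in> cell K" "src y = W" "trg y = T0 M (X i \<otimes> X (Suc i))" "y' \<in> cell K" "vsrc y' = vtrg y"
    "z \<in> cell K" "src z = W" "trg z = T0 M (X j \<otimes> X (Suc j))" "z' \<in> cell K" "vsrc z' = vtrg z"
  shows "plug22 X m i j a y' z' \<bullet> plug22 X m i j a y z = plug22 X m i j a (y' \<bullet> y) (z' \<bullet> z)"
proof -
  note o = famT_obs[OF assms(1)]
  have y': "src y' = src y" "trg y' = trg y" "src z' = src z" "trg z' = trg z"
    using assms by (metis src_vsrc src_vtrg trg_vsrc trg_vtrg)+
  have m: "1 \<le> m" "1 \<le> Suc (Suc m)" using assms by auto
  have ob: "X i \<otimes> X (Suc i) \<in> ob K" "X j \<otimes> X (Suc j) \<in> ob K"
    using o assms(3-5) by (auto simp: obs_def)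
  have id: "vsrc (a k) = a k" "vtrg (a k) = a k" "a k \<bullet> a k = a k" if "1 \<le> k" "k \<le> Suc (Suc m)" for k
    using famTD[OF assms(1) that] assms(2) that by (auto simp: idfam_def intro: vtrg_if_vsrc)
  show ?thesis
    unfolding plug22_def
  proof (subst plug_vcomp[OF m(2,1) regrouping_plug22[OF o assms(3-5) refl refl refl refl refl]])
    show "famT W (merge i (merge j X (X j \<otimes> X (Suc j))) (X i \<otimes> X (Suc i))) m (merge i (merge j a z) y)"
      "famT W (merge i (merge j X (X j \<otimes> X (Suc j))) (X i \<otimes> X (Suc i))) m (merge i (merge j a z') y')"
      using famT_plug22[OF assms(1)] assms y' ob by simp_all
  qed (use assms id m in \<open>auto simp: merge_def intro!: plug_cong\<close>)
qed

text \<open>The other slot of \<open>plug22\<close> can be filled with \<open>\<omega>\<close> at no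
  cost, by generalized associativity.\<close>

lemma plug2_plug22_snd:
  assumes a: "famT W X (Suc (Suc m)) a" and i: "1 \<le> i" "Suc i < j" "j \<le> Suc m"
    and z: "z \<in> cell K" "src z = W" "trg z = T0 M (X j \<otimes> X (Suc j))"
  shows "plug2 X (Suc m) j a z = plug22 X m i j a (om_el (X i) (X (Suc i)) (a i) (a (Suc i))) z"
proof -
  note o = famT_obs[OF a]
  have ob: "X j \<otimes> X (Suc j) \<in> ob K" using o i by (auto simp: obs_def)
  let ?Y = "merge j X (X j \<otimes> X (Suc j))" and ?b = "merge j a z"
  have n: "1 \<le> Suc (Suc m)" "1 \<le> j" and im: "i \<le> m" using i by auto
  have Y: "?Y i = X i" "?Y (Suc i) = X (Suc i)" "?b i = a i" "?b (Suc i) = a (Suc i)"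
    using i by (auto simp: merge_def)
  have "plug (\<lambda>q. unmerge j (X j) (X (Suc j)) (unmerge i (X i) (X (Suc i)) q)) (Suc (Suc m))
      (merge i ?Y (X i \<otimes> X (Suc i))) m (merge i ?b (om_el (?Y i) (?Y (Suc i)) (?b i) (?b (Suc i)))) =
    plug (unmerge j (X j) (X (Suc j))) (Suc (Suc m)) ?Y (Suc m) ?b"
  proof (rule plug_merge[OF n(1) _ i(1) im _ regrouping_plug22[OF o i refl refl refl refl refl]])
    show "famT W ?Y (Suc m) ?b" by (rule famT_merge_at[OF a z ob])
    show "merge i ?Y (X i \<otimes> X (Suc i)) = merge i ?Y (?Y i \<otimes> ?Y (Suc i))" unfolding Y ..
  next
    fix V q k assume q: "fam V ?Y (Suc m) q" and k: "1 \<le> k" "k \<le> Suc (Suc m)"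
    show "unmerge j (X j) (X (Suc j)) (unmerge i (X i) (X (Suc i)) (merge i q (pair (q i) (q (Suc i))))) k =
      unmerge j (X j) (X (Suc j)) q k"
      by (rule unmerge_cong[OF n(2) i(3) k], rule unmerge_merge[OF q i(1) im _ _ Y(1,2)[symmetric]])
  qed
  then show ?thesis unfolding Y plug2_def plug22_def by simp
qed

text \<open>\<open>plug22\<close> merges at \<open>j\<close> before merging at \<open>i\<close>.
  Here the pair at \<open>i\<close> is merged already, so the second pair is found at
  \<open>j - 1\<close> and the two operations have to be commuted.\<close>

lemma plug2_plug22_fst:
  assumes a: "famT W X (Suc (Suc m)) a" and i: "1 \<le> i" "Suc i < j" "j \<le> Suc m"
    and y: "y \<in> cell K" "src y = W" "trg y = T0 M (X i \<otimes> X (Suc i))"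
  shows "plug2 X (Suc m) i a y = plug22 X m i j a y (om_el (X j) (X (Suc j)) (a j) (a (Suc j)))"
proof -
  note o = famT_obs[OF a]
  have ob: "X i \<otimes> X (Suc i) \<in> ob K" using o i by (auto simp: obs_def)
  let ?Y = "merge i X (X i \<otimes> X (Suc i))" and ?b = "merge i a y" and ?j = "j - 1"
  have n: "1 \<le> Suc (Suc m)" "1 \<le> ?j" "?j \<le> m" "i \<le> Suc m" using i by auto
  have Y: "?Y ?j = X j" "?Y (Suc ?j) = X (Suc j)" "?b ?j = a j" "?b (Suc ?j) = a (Suc j)"
    using i by (auto simp: merge_def)
  have "plug (\<lambda>q. unmerge j (X j) (X (Suc j)) (unmerge i (X i) (X (Suc i)) q)) (Suc (Suc m))
      (merge i (merge j X (X j \<otimes> X (Suc j))) (X i \<otimes> X (Suc i))) m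
      (merge ?j ?b (om_el (?Y ?j) (?Y (Suc ?j)) (?b ?j) (?b (Suc ?j)))) =
    plug (unmerge i (X i) (X (Suc i))) (Suc (Suc m)) ?Y (Suc m) ?b"
  proof (rule plug_merge[OF n(1) _ n(2,3) _ regrouping_plug22[OF o i refl refl refl refl refl]])
    show "famT W ?Y (Suc m) ?b" by (rule famT_merge_at[OF a y ob])
    show "merge i (merge j X (X j \<otimes> X (Suc j))) (X i \<otimes> X (Suc i)) = merge ?j ?Y (?Y ?j \<otimes> ?Y (Suc ?j))"
      unfolding Y merge_merge_commute[OF i(2)] ..
  next
    fix V q k assume q: "fam V ?Y (Suc m) q" and k: "1 \<le> k" "k \<le> Suc (Suc m)"
    show "unmerge j (X j) (X (Suc j)) (unmerge i (X i) (X (Suc i)) (merge ?j q (pair (q ?j) (q (Suc ?j))))) k =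
      unmerge i (X i) (X (Suc i)) q k"
      unfolding unmerge_commute[OF i(2)]
      by (rule unmerge_cong[OF i(1) n(4) k], rule unmerge_merge[OF q n(2,3) _ _ Y(1,2)[symmetric]])
  qed
  then show ?thesis unfolding Y merge_merge_commute[OF i(2)] plug2_def plug22_def by simp
qed

lemma plug22_swap_fst:
  assumes a: "famT W X (Suc (Suc m)) a" and i: "1 \<le> i" "Suc i < j" "j \<le> Suc m"
    and y: "y \<in> cell K" "src y = W" "trg y = T0 M (X (Suc i) \<otimes> X i)"
    and z: "z \<in> cell K" "src z = W" "trg z = T0 M (X j \<otimes> X (Suc j))"
    and s: "s = transpose i (Suc i)"
  shows "T2 M (perm2 X (Suc (Suc m)) s) \<star> plug22 (X \<circ> s) m i j (a \<circ> s) y z =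
    plug22 X m i j a (T2 M (pair (p2 (X (Suc i)) (X i)) (p1 (X (Suc i)) (X i))) \<star> y) z"
proof -
  note o = famT_obs[OF a]
  have n: "1 \<le> Suc (Suc m)" and im: "i \<le> m" using i by auto
  have x: "X i \<in> ob K" "X (Suc i) \<in> ob K" "X j \<in> ob K" "X (Suc j) \<in> ob K" using o i by (auto simp: obs_def)
  have sp: "s permutes {1..Suc (Suc m)}" using i s transpose_permutes by simp
  have si: "s i = Suc i" "s (Suc i) = i" "\<And>k. k \<noteq> i \<Longrightarrow> k \<noteq> Suc i \<Longrightarrow> s k = k"
    using s by (auto simp: transpose_def)
  have sj: "s j = j" "s (Suc j) = Suc j" using si(3) i by auto
  let ?Y' = "merge i (merge j (X \<circ> s) (X j \<otimes> X (Suc j))) (X (Suc i) \<otimes> X i)"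
  let ?R' = "\<lambda>q. unmerge j (X j) (X (Suc j)) (unmerge i (X (Suc i)) (X i) q)"
  have lhs: "plug22 (X \<circ> s) m i j (a \<circ> s) y z = plug ?R' (Suc (Suc m)) ?Y' m (merge i (merge j (a \<circ> s) z) y)"
    using si sj by (simp add: plug22_def)
  have l: "regrouping ?R' (Suc (Suc m)) m (X \<circ> s) ?Y'"
    by (rule regrouping_plug22[OF obs_perm[OF o sp] i]) (use si sj in auto)
  show ?thesis
    unfolding lhs unfolding plug22_def
  proof (rule plug_perm_at[OF n sp o regrouping_plug22[OF o i refl refl refl refl refl] l _ i(1) im])
    show "famT W ?Y' m (merge i (merge j (a \<circ> s) z) y)"
      by (rule famT_plug22[OF famT_perm[OF a sp] y _ z]) (use x in auto)
  next
    fix V q k assume q: "fam V ?Y' m q"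
    have inner: "unmerge i (X i) (X (Suc i)) (\<lambda>k. if k = i then
        pair (p2 (X (Suc i)) (X i)) (p1 (X (Suc i)) (X i)) \<star> q k else q k) =
        (\<lambda>k. unmerge i (X (Suc i)) (X i) q (s k))"
      using famD[OF q i(1) im] unmerge_swap[of q i "X (Suc i)" "X i"] x s by (auto simp: merge_def)
    show "unmerge j (X j) (X (Suc j)) (unmerge i (X i) (X (Suc i)) (\<lambda>k. if k = i then
        pair (p2 (X (Suc i)) (X i)) (p1 (X (Suc i)) (X i)) \<star> q k else q k)) k = ?R' q (inv s k)"
      unfolding inner using i s by (auto simp: unmerge_def[of j] transpose_def)
  qed (use x si sj i in \<open>auto simp: merge_def\<close>)
qed

text \<open>Once the pair at \<open>i\<close> is merged, the block to be permuted is the entry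
  \<open>j - 1\<close>; \<open>unmerge_transpose\<close> converts the transposition there into the
  one of \<open>j\<close> and \<open>j + 1\<close>.\<close>

lemma plug22_swap_snd:
  assumes a: "famT W X (Suc (Suc m)) a" and i: "1 \<le> i" "Suc i < j" "j \<le> Suc m"
    and y: "y \<in> cell K" "src y = W" "trg y = T0 M (X i \<otimes> X (Suc i))"
    and z: "z \<in> cell K" "src z = W" "trg z = T0 M (X (Suc j) \<otimes> X j)"
    and s: "s = transpose j (Suc j)"
  shows "T2 M (perm2 X (Suc (Suc m)) s) \<star> plug22 (X \<circ> s) m i j (a \<circ> s) y z =
    plug22 X m i j a y (T2 M (pair (p2 (X (Suc j)) (X j)) (p1 (X (Suc j)) (X j))) \<star> z)"
proof -
  note o = famT_obs[OF a]
  have n: "1 \<le> Suc (Suc m)" and im: "i \<le> m" and jm: "1 \<le> j - 1" "j - 1 \<le> m" using i by auto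
  have x: "X i \<in> ob K" "X (Suc i) \<in> ob K" "X j \<in> ob K" "X (Suc j) \<in> ob K" using o i by (auto simp: obs_def)
  have sp: "s permutes {1..Suc (Suc m)}" using i s transpose_permutes by simp
  have sj: "s j = Suc j" "s (Suc j) = j" "\<And>k. k \<noteq> j \<Longrightarrow> k \<noteq> Suc j \<Longrightarrow> s k = k"
    using s by (auto simp: transpose_def)
  have si: "s i = i" "s (Suc i) = Suc i" using sj(3) i by auto
  let ?Y' = "merge i (merge j (X \<circ> s) (X (Suc j) \<otimes> X j)) (X i \<otimes> X (Suc i))"
  let ?R' = "\<lambda>q. unmerge j (X (Suc j)) (X j) (unmerge i (X i) (X (Suc i)) q)"
  have lhs: "plug22 (X \<circ> s) m i j (a \<circ> s) y z = plug ?R' (Suc (Suc m)) ?Y' m (merge i (merge j (a \<circ> s) z) y)"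
    using si sj by (simp add: plug22_def)
  have l: "regrouping ?R' (Suc (Suc m)) m (X \<circ> s) ?Y'"
    by (rule regrouping_plug22[OF obs_perm[OF o sp] i]) (use si sj in auto)
  show ?thesis
    unfolding lhs unfolding plug22_def
  proof (rule plug_perm_at[OF n sp o regrouping_plug22[OF o i refl refl refl refl refl] l _ jm])
    show "famT W ?Y' m (merge i (merge j (a \<circ> s) z) y)"
      by (rule famT_plug22[OF famT_perm[OF a sp] y _ z]) (use x in auto)
  next
    fix V q k assume q: "fam V ?Y' m q"
    have inner: "unmerge (j - 1) (X j) (X (Suc j)) (\<lambda>k. if k = j - 1 then
        pair (p2 (X (Suc j)) (X j)) (p1 (X (Suc j)) (X j)) \<star> q k else q k) =
        (\<lambda>k. unmerge (j - 1) (X (Suc j)) (X j) q (transpose (j - 1) (Suc (j - 1)) k))"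
    proof (rule ext, rule unmerge_swap)
      obtain j' where "j = Suc j'" using i by (cases j) auto
      then have "?Y' (j - 1) = X (Suc j) \<otimes> X j" using i by (simp add: merge_def)
      then show "trg (q (j - 1)) = X (Suc j) \<otimes> X j" by (rule trans[OF famD(3)[OF q jm]])
      show "q (j - 1) \<in> cell K" by (rule famD(1)[OF q jm])
    qed (rule x)+
    show "unmerge j (X j) (X (Suc j)) (unmerge i (X i) (X (Suc i)) (\<lambda>k. if k = j - 1 then
        pair (p2 (X (Suc j)) (X j)) (p1 (X (Suc j)) (X j)) \<star> q k else q k)) k = ?R' q (inv s k)"
    proof -
      obtain j' where j': "j = Suc j'" "i < j'" using i by (cases j) auto
      show ?thesis
        unfolding unmerge_commute[OF i(2)] inner
        using unmerge_transpose[OF j'(2), of "X i" "X (Suc i)" "unmerge j' (X (Suc j)) (X j) q" k] j'(1) s by simp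
    qed
  qed (use x si sj i in \<open>auto simp: merge_def\<close>)
qed

end

section \<open>Squares and hexagons for \<open>\<Gamma>\<close> inserted into a long product\<close>

context pseudo_commutative_monad
begin

text \<open>\<open>gam_el_yang_baxter\<close> equates composites without asserting that consecutive
  factors meet. \<open>plug3_vcomp\<close> needs this in order to insert the factors one at a
  time.\<close>

lemma yang_baxter_composable:
  assumes "a \<in> cell K" "b \<in> cell K" "c \<in> cell K" "src b = src a" "src c = src a"
    "trg a = T0 M A" "trg b = T0 M B" "trg c = T0 M C" "A \<in> ob K" "B \<in> ob K" "C \<in> ob K"
    "vsrc a = a" "vsrc b = b" "vsrc c = c"
  shows "vsrc (T2 M (pair (p1 A C \<star> p2 B (A \<otimes> C)) (pair (p1 B (A \<otimes> C)) (p2 A C \<star> p2 B (A \<otimes> C))))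
       \<star> om_el B (A \<otimes> C) b (gam_el A C a c)) = vtrg (T2 M (assoc2 A B C) \<star> om_el (A \<otimes> B) C (gam_el A B a b) c)"
    "vsrc (T2 M (pair (p2 (B \<otimes> C) A) (p1 (B \<otimes> C) A)) \<star> om_el (B \<otimes> C) A (gam_el B C b c) a) =
      vtrg (T2 M (pair (p1 A C \<star> p2 B (A \<otimes> C)) (pair (p1 B (A \<otimes> C)) (p2 A C \<star> p2 B (A \<otimes> C))))
       \<star> om_el B (A \<otimes> C) b (gam_el A C a c))"
    "vsrc (T2 M (pair (p1 A C \<star> p1 (A \<otimes> C) B) (pair (p2 (A \<otimes> C) B) (p2 A C \<star> p1 (A \<otimes> C) B)))
       \<star> om_el (A \<otimes> C) B (gam_el A C a c) b) = vtrg (om_el A (B \<otimes> C) a (gam_el B C b c))"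
    "vsrc (T2 M (pair (p1 A B \<star> p2 C (A \<otimes> B)) (pair (p2 A B \<star> p2 C (A \<otimes> B)) (p1 C (A \<otimes> B))))
       \<star> om_el C (A \<otimes> B) c (gam_el A B a b)) =
     vtrg (T2 M (pair (p1 A C \<star> p1 (A \<otimes> C) B) (pair (p2 (A \<otimes> C) B) (p2 A C \<star> p1 (A \<otimes> C) B)))
       \<star> om_el (A \<otimes> C) B (gam_el A C a c) b)"
  using assms
  by (simp_all add: vtrg_if_vsrc om_el_natural_left om_el_natural_right om_el_assoc T2_fuse) (simp_all add: assoc2_def)

text \<open>This is \<open>Omega_step\<close> at the identity permutation.\<close>

definition gam_step :: "(nat \<Rightarrow> 'o) \<Rightarrow> nat \<Rightarrow> nat \<Rightarrow> (nat \<Rightarrow> 'c) \<Rightarrow> 'c" where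
  "gam_step X m i a = plug2 X m i a (gam_el (X i) (X (Suc i)) (a i) (a (Suc i)))"

lemma idfamD:
  assumes "idfam n a" "famT W X n a" "1 \<le> k" "k \<le> n"
  shows "vsrc (a k) = a k" "vtrg (a k) = a k"
  using famTD[OF assms(2-4)] assms by (auto simp: idfam_def intro: vtrg_if_vsrc)

text \<open>The source follows from \<open>plug2_om_el\<close>. The target of
  \<open>\<Gamma>\<close> is \<open>\<omega>\<close> in the exchanged order followed by a swap, and
  \<open>plug2_swap\<close> turns that swap into the transposition of the whole product.\<close>

lemma gam_step_cell:
  assumes "famT W X (Suc m) a" "idfam (Suc m) a" "1 \<le> i" "i \<le> m" "s = transpose i (Suc i)"
  shows "gam_step X m i a \<in> cell K" "src (gam_step X m i a) = W" "trg (gam_step X m i a) = T0 M (nprod K X (Suc m))"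
    "vsrc (gam_step X m i a) = nom_el X (Suc m) a"
    "vtrg (gam_step X m i a) = T2 M (perm2 X (Suc m) s) \<star> nom_el (X \<circ> s) (Suc m) (a \<circ> s)"
proof -
  have i: "i \<le> Suc m" "1 \<le> Suc i" "Suc i \<le> Suc m" using assms(4) by auto
  note d = famTD[OF assms(1,3) i(1)] famTD[OF assms(1) i(2,3)]
  note v = idfamD[OF assms(2,1,3) i(1)] idfamD[OF assms(2,1) i(2,3)]
  let ?y = "gam_el (X i) (X (Suc i)) (a i) (a (Suc i))"
  have y: "?y \<in> cell K" "src ?y = W" "trg ?y = T0 M (X i \<otimes> X (Suc i))"
    using d by simp_all
  note e = plug2_cell[OF assms(1-4) y]
  show "gam_step X m i a \<in> cell K" "src (gam_step X m i a) = W" "trg (gam_step X m i a) = T0 M (nprod K X (Suc m))"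
    unfolding gam_step_def by (fact e)+
  show "vsrc (gam_step X m i a) = nom_el X (Suc m) a"
    unfolding gam_step_def e(4) using d v plug2_om_el[OF assms(1,3,4)] by simp
  let ?w = "om_el (X (Suc i)) (X i) (a (Suc i)) (a i)"
  have s: "s permutes {1..Suc m}" using assms transpose_permutes by simp
  have "vtrg (gam_step X m i a) = plug2 X m i a (T2 M (pair (p2 (X (Suc i)) (X i)) (p1 (X (Suc i)) (X i))) \<star> ?w)"
    unfolding gam_step_def e(5) using d v by simp
  also have "\<dots> = T2 M (perm2 X (Suc m) s) \<star> plug2 (X \<circ> s) m i (a \<circ> s) ?w"
    by (rule plug2_swap[OF assms(1,3,4) _ _ _ assms(5), symmetric]) (use d in simp_all)
  also have "plug2 (X \<circ> s) m i (a \<circ> s) ?w = nom_el (X \<circ> s) (Suc m) (a \<circ> s)"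
    using plug2_om_el[OF famT_perm[OF assms(1) s] assms(3,4)] assms(5) by simp
  finally show "vtrg (gam_step X m i a) = T2 M (perm2 X (Suc m) s) \<star> nom_el (X \<circ> s) (Suc m) (a \<circ> s)" .
qed

text \<open>Both paths equal the simultaneous insertion of \<open>\<Gamma>\<close> at
  \<open>i\<close> and at \<open>j\<close>: each step is a \<open>plug22\<close> with
  \<open>\<Gamma>\<close> in one slot and \<open>\<omega>\<close> in the other, and these compose
  slot by slot.\<close>

lemma gam_step_square:
  assumes a: "famT W X (Suc (Suc m)) a" and id: "idfam (Suc (Suc m)) a"
    and i: "1 \<le> i" "Suc i < j" "j \<le> Suc m"
    and s: "s = transpose i (Suc i)" and t: "t = transpose j (Suc j)"
  shows "(T2 M (perm2 X (Suc (Suc m)) s) \<star> gam_step (X \<circ> s) (Suc m) j (a \<circ> s)) \<bullet> gam_step X (Suc m) i a =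
    (T2 M (perm2 X (Suc (Suc m)) t) \<star> gam_step (X \<circ> t) (Suc m) i (a \<circ> t)) \<bullet> gam_step X (Suc m) j a"
proof -
  let ?n = "Suc (Suc m)"
  have r: "1 \<le> Suc i" "1 \<le> j" "1 \<le> Suc j" "i \<le> ?n" "Suc i \<le> ?n" "j \<le> ?n" "Suc j \<le> ?n" using i by auto
  note d = famTD[OF a i(1) r(4)] famTD[OF a r(1,5)] famTD[OF a r(2,6)] famTD[OF a r(3,7)]
  note v = idfamD[OF id a i(1) r(4)] idfamD[OF id a r(1,5)] idfamD[OF id a r(2,6)] idfamD[OF id a r(3,7)]
  have sp: "s permutes {1..?n}" and tp: "t permutes {1..?n}" using i s t transpose_permutes by simp_all
  have s': "s i = Suc i" "s (Suc i) = i" "s j = j" "s (Suc j) = Suc j"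
    using s i by (auto simp: transpose_def)
  have t': "t i = i" "t (Suc i) = Suc i" "t j = Suc j" "t (Suc j) = j"
    using t i by (auto simp: transpose_def)
  let ?A = "X i" and ?B = "X (Suc i)" and ?C = "X j" and ?D = "X (Suc j)"
  let ?g = "gam_el ?A ?B (a i) (a (Suc i))" and ?h = "gam_el ?C ?D (a j) (a (Suc j))"
  let ?o = "om_el ?A ?B (a i) (a (Suc i))" and ?p = "om_el ?C ?D (a j) (a (Suc j))"
  let ?o' = "om_el ?B ?A (a (Suc i)) (a i)" and ?p' = "om_el ?D ?C (a (Suc j)) (a j)"
  let ?sw = "pair (p2 ?B ?A) (p1 ?B ?A)" and ?sw' = "pair (p2 ?D ?C) (p1 ?D ?C)"
  have "gam_step X (Suc m) i a = plug22 X m i j a ?g ?p"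
    unfolding gam_step_def by (rule plug2_plug22_fst[OF a i]) (use d in simp_all)
  moreover have "gam_step X (Suc m) j a = plug22 X m i j a ?o ?h"
    unfolding gam_step_def by (rule plug2_plug22_snd[OF a i]) (use d in simp_all)
  moreover have "T2 M (perm2 X ?n s) \<star> gam_step (X \<circ> s) (Suc m) j (a \<circ> s) = plug22 X m i j a (T2 M ?sw \<star> ?o') ?h"
  proof -
    have "gam_step (X \<circ> s) (Suc m) j (a \<circ> s) = plug22 (X \<circ> s) m i j (a \<circ> s) ?o' ?h"
      using plug2_plug22_snd[OF famT_perm[OF a sp] i, of ?h] s' d by (simp add: gam_step_def)
    with plug22_swap_fst[OF a i _ _ _ _ _ _ s, of ?o' ?h] d show ?thesis by simp
  qed
  moreover have "T2 M (perm2 X ?n t) \<star> gam_step (X \<circ> t) (Suc m) i (a \<circ> t) = plug22 X m i j a ?g (T2 M ?sw' \<star> ?p')"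
  proof -
    have "gam_step (X \<circ> t) (Suc m) i (a \<circ> t) = plug22 (X \<circ> t) m i j (a \<circ> t) ?g ?p'"
      using plug2_plug22_fst[OF famT_perm[OF a tp] i, of ?g] t' d by (simp add: gam_step_def)
    with plug22_swap_snd[OF a i _ _ _ _ _ _ t, of ?g ?p'] d show ?thesis by simp
  qed
  moreover have "plug22 X m i j a (T2 M ?sw \<star> ?o') ?h \<bullet> plug22 X m i j a ?g ?p = plug22 X m i j a ?g ?h"
    using plug22_vcomp[OF a id i, of ?g "T2 M ?sw \<star> ?o'" ?p ?h] d v
      vtrg_vcomp_left[of ?g] vcomp_vsrc[of ?h] by simp
  moreover have "plug22 X m i j a ?g (T2 M ?sw' \<star> ?p') \<bullet> plug22 X m i j a ?o ?h = plug22 X m i j a ?g ?h"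
    using plug22_vcomp[OF a id i, of ?o ?g ?h "T2 M ?sw' \<star> ?p'"] d v
      vtrg_vcomp_left[of ?h] vcomp_vsrc[of ?g] by simp
  ultimately show ?thesis by simp
qed

text \<open>All six steps are insertions into the same block of three factors, so the equation is
  the image of the Yang-Baxter equation under \<open>plug3 X m i a\<close>, which preserves vertical
  composition.\<close>

lemma gam_step_braid:
  assumes a: "famT W X (Suc (Suc m)) a" and id: "idfam (Suc (Suc m)) a"
    and i: "1 \<le> i" "i \<le> m"
    and s: "s = transpose i (Suc i)" and t: "t = transpose (Suc i) (Suc (Suc i))"
  shows "(T2 M (perm2 X (Suc (Suc m)) (s \<circ> t)) \<star> gam_step (X \<circ> (s \<circ> t)) (Suc m) i (a \<circ> (s \<circ> t))) \<bullet>
     ((T2 M (perm2 X (Suc (Suc m)) s) \<star> gam_step (X \<circ> s) (Suc m) (Suc i) (a \<circ> s)) \<bullet> gam_step X (Suc m) i a) =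
    (T2 M (perm2 X (Suc (Suc m)) (t \<circ> s)) \<star> gam_step (X \<circ> (t \<circ> s)) (Suc m) (Suc i) (a \<circ> (t \<circ> s))) \<bullet>
     ((T2 M (perm2 X (Suc (Suc m)) t) \<star> gam_step (X \<circ> t) (Suc m) i (a \<circ> t)) \<bullet> gam_step X (Suc m) (Suc i) a)"
proof -
  let ?n = "Suc (Suc m)"
  have r: "1 \<le> Suc i" "1 \<le> Suc (Suc i)" "i \<le> ?n" "Suc i \<le> ?n" "Suc (Suc i) \<le> ?n" using i by auto
  define A B C where ABC: "A = X i" "B = X (Suc i)" "C = X (Suc (Suc i))"
  define x y z where xyz: "x = a i" "y = a (Suc i)" "z = a (Suc (Suc i))"
  note d = famTD[OF a i(1) r(3), folded ABC xyz] famTD[OF a r(1,4), folded ABC xyz]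
    famTD[OF a r(2,5), folded ABC xyz]
  note v = idfamD[OF id a i(1) r(3), folded ABC xyz] idfamD[OF id a r(1,4), folded ABC xyz]
    idfamD[OF id a r(2,5), folded ABC xyz]
  have p: "s permutes {1..?n}" "t permutes {1..?n}" using i s t transpose_permutes by simp_all
  then have pp: "s \<circ> t permutes {1..?n}" "t \<circ> s permutes {1..?n}" by (auto intro: permutes_compose)
  have sv: "s i = Suc i" "s (Suc i) = i" "s (Suc (Suc i)) = Suc (Suc i)"
    and tv: "t i = i" "t (Suc i) = Suc (Suc i)" "t (Suc (Suc i)) = Suc i"
    and fx: "\<And>k. k < i \<or> Suc (Suc i) < k \<Longrightarrow> s k = k" "\<And>k. k < i \<or> Suc (Suc i) < k \<Longrightarrow> t k = k"
    using s t by (auto simp: transpose_def)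
  have inv: "inv s = s" "inv t = t" using s t by simp_all
  then have inv2: "inv (s \<circ> t) = t \<circ> s" "inv (t \<circ> s) = s \<circ> t"
    using p by (metis o_inv_distrib permutes_bij)+
  \<comment> \<open>\<open>?z1\<close>, \<open>?z2\<close>, \<open>?z3\<close> and
    \<open>?w1\<close>, \<open>?w2\<close>, \<open>?w3\<close> are the factors of the two sides of
    \<open>gam_el_yang_baxter\<close>. \<open>?h2\<close>, \<open>?h3\<close>, \<open>?k2\<close>,
    \<open>?k3\<close> realize \<open>s\<close>, \<open>s \<circ> t\<close>, \<open>t\<close>,
    \<open>t \<circ> s\<close> on the block.\<close>
  let ?z1 = "T2 M (assoc2 A B C) \<star> om_el (A \<otimes> B) C (gam_el A B x y) z"
  let ?h2 = "pair (p1 A C \<star> p2 B (A \<otimes> C)) (pair (p1 B (A \<otimes> C)) (p2 A C \<star> p2 B (A \<otimes> C)))"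
  let ?z2 = "T2 M ?h2 \<star> om_el B (A \<otimes> C) y (gam_el A C x z)"
  let ?z3 = "T2 M (pair (p2 (B \<otimes> C) A) (p1 (B \<otimes> C) A)) \<star> om_el (B \<otimes> C) A (gam_el B C y z) x"
  let ?h3 = "pair (p2 C A \<star> p2 B (C \<otimes> A)) (pair (p1 B (C \<otimes> A)) (p1 C A \<star> p2 B (C \<otimes> A)))"
  let ?w1 = "om_el A (B \<otimes> C) x (gam_el B C y z)"
  let ?w2 = "T2 M (pair (p1 A C \<star> p1 (A \<otimes> C) B) (pair (p2 (A \<otimes> C) B) (p2 A C \<star> p1 (A \<otimes> C) B)))
       \<star> om_el (A \<otimes> C) B (gam_el A C x z) y"
  let ?k2 = "pair (p1 A (C \<otimes> B)) (pair (p2 C B \<star> p2 A (C \<otimes> B)) (p1 C B \<star> p2 A (C \<otimes> B)))"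
  let ?k3 = "pair (p1 A B \<star> p2 C (A \<otimes> B)) (pair (p2 A B \<star> p2 C (A \<otimes> B)) (p1 C (A \<otimes> B)))"
  let ?w3 = "T2 M ?k3 \<star> om_el C (A \<otimes> B) z (gam_el A B x y)"
  let ?F = "plug3 X m i a"
  have "gam_step X (Suc m) i a = ?F ?z1"
    using plug2_plug3_left[OF a i ABC, of "gam_el A B x y"] d by (simp add: gam_step_def flip: ABC xyz)
  moreover have "gam_step X (Suc m) (Suc i) a = ?F ?w1"
    using plug2_plug3_right[OF a i ABC, of "gam_el B C y z"] d by (simp add: gam_step_def flip: ABC xyz)
  moreover have "T2 M (perm2 X ?n s) \<star> gam_step (X \<circ> s) (Suc m) (Suc i) (a \<circ> s) = ?F ?z2"
  proof -
    have "gam_step (X \<circ> s) (Suc m) (Suc i) (a \<circ> s) = plug3 (X \<circ> s) m i (a \<circ> s) (om_el B (A \<otimes> C) y (gam_el A C x z))"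
      using plug2_plug3_right[OF famT_perm[OF a p(1)] i, of B A C "gam_el A C x z"] d sv
      by (simp add: gam_step_def flip: ABC xyz)
    moreover have "T2 M (perm2 X ?n s) \<star> plug3 (X \<circ> s) m i (a \<circ> s) (om_el B (A \<otimes> C) y (gam_el A C x z)) = ?F ?z2"
      by (rule plug3_perm[OF a i p(1) _ ABC, where A' = B and B' = A and C' = C, OF _ _ _ _ _ _ _ refl])
        (use d sv fx inv ABC in simp_all)
    ultimately show ?thesis by simp
  qed
  moreover have "T2 M (perm2 X ?n (s \<circ> t)) \<star> gam_step (X \<circ> (s \<circ> t)) (Suc m) i (a \<circ> (s \<circ> t)) = ?F ?z3"
  proof -
    have "gam_step (X \<circ> (s \<circ> t)) (Suc m) i (a \<circ> (s \<circ> t)) = plug3 (X \<circ> (s \<circ> t)) m i (a \<circ> (s \<circ> t))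
        (T2 M (assoc2 B C A) \<star> om_el (B \<otimes> C) A (gam_el B C y z) x)"
      using plug2_plug3_left[OF famT_perm[OF a pp(1)] i, of B C A "gam_el B C y z"] d sv tv
      by (simp add: gam_step_def flip: ABC xyz)
    moreover have "T2 M (perm2 X ?n (s \<circ> t)) \<star> plug3 (X \<circ> (s \<circ> t)) m i (a \<circ> (s \<circ> t))
        (T2 M (assoc2 B C A) \<star> om_el (B \<otimes> C) A (gam_el B C y z) x) =
        ?F (T2 M ?h3 \<star> (T2 M (assoc2 B C A) \<star> om_el (B \<otimes> C) A (gam_el B C y z) x))"
      by (rule plug3_perm[OF a i pp(1) _ ABC, where A' = B and B' = C and C' = A, OF _ _ _ _ _ _ _ refl])
        (use d sv tv fx inv2 ABC in simp_all)
    \<comment> \<open>The reassociation from \<open>plug2_plug3_left\<close> is absorbed by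
      \<open>?h3\<close>, leaving the plain swap of the Yang-Baxter equation.\<close>
    moreover have "T2 M ?h3 \<star> (T2 M (assoc2 B C A) \<star> om_el (B \<otimes> C) A (gam_el B C y z) x) = ?z3"
      using d by (simp add: T2_fuse) (simp add: assoc2_def)
    ultimately show ?thesis by simp
  qed
  moreover have "T2 M (perm2 X ?n t) \<star> gam_step (X \<circ> t) (Suc m) i (a \<circ> t) = ?F ?w2"
  proof -
    have "gam_step (X \<circ> t) (Suc m) i (a \<circ> t) = plug3 (X \<circ> t) m i (a \<circ> t) (T2 M (assoc2 A C B) \<star> om_el (A \<otimes> C) B (gam_el A C x z) y)"
      using plug2_plug3_left[OF famT_perm[OF a p(2)] i, of A C B "gam_el A C x z"] d tv
      by (simp add: gam_step_def flip: ABC xyz)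
    moreover have "T2 M (perm2 X ?n t) \<star> plug3 (X \<circ> t) m i (a \<circ> t) (T2 M (assoc2 A C B) \<star> om_el (A \<otimes> C) B (gam_el A C x z) y) =
        ?F (T2 M ?k2 \<star> (T2 M (assoc2 A C B) \<star> om_el (A \<otimes> C) B (gam_el A C x z) y))"
      by (rule plug3_perm[OF a i p(2) _ ABC, where A' = A and B' = C and C' = B, OF _ _ _ _ _ _ _ refl])
        (use d tv fx inv ABC in simp_all)
    moreover have "T2 M ?k2 \<star> (T2 M (assoc2 A C B) \<star> om_el (A \<otimes> C) B (gam_el A C x z) y) = ?w2"
      using d by (simp add: T2_fuse) (simp add: assoc2_def)
    ultimately show ?thesis by simp
  qed
  moreover have "T2 M (perm2 X ?n (t \<circ> s)) \<star> gam_step (X \<circ> (t \<circ> s)) (Suc m) (Suc i) (a \<circ> (t \<circ> s)) = ?F ?w3"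
  proof -
    have "gam_step (X \<circ> (t \<circ> s)) (Suc m) (Suc i) (a \<circ> (t \<circ> s)) =
        plug3 (X \<circ> (t \<circ> s)) m i (a \<circ> (t \<circ> s)) (om_el C (A \<otimes> B) z (gam_el A B x y))"
      using plug2_plug3_right[OF famT_perm[OF a pp(2)] i, of C A B "gam_el A B x y"] d sv tv
      by (simp add: gam_step_def flip: ABC xyz)
    moreover have "T2 M (perm2 X ?n (t \<circ> s)) \<star> plug3 (X \<circ> (t \<circ> s)) m i (a \<circ> (t \<circ> s)) (om_el C (A \<otimes> B) z (gam_el A B x y)) = ?F ?w3"
      by (rule plug3_perm[OF a i pp(2) _ ABC, where A' = C and B' = A and C' = B, OF _ _ _ _ _ _ _ refl])
        (use d sv tv fx inv2 ABC in simp_all)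
    ultimately show ?thesis by simp
  qed
  moreover have "?F ?z3 \<bullet> (?F ?z2 \<bullet> ?F ?z1) = ?F ?w3 \<bullet> (?F ?w2 \<bullet> ?F ?w1)"
  proof -
    have dd: "x \<in> cell K" "y \<in> cell K" "z \<in> cell K" "src y = src x" "src z = src x"
      "trg x = T0 M A" "trg y = T0 M B" "trg z = T0 M C" "A \<in> ob K" "B \<in> ob K" "C \<in> ob K"
      "vsrc x = x" "vsrc y = y" "vsrc z = z" using d v by auto
    note comp = yang_baxter_composable[OF dd]
    note Fv = plug3_vcomp[OF a id i, folded ABC]
    have zc: "?z1 \<in> cell K" "src ?z1 = W" "trg ?z1 = T0 M (A \<otimes> (B \<otimes> C))" "?z2 \<in> cell K" "?z3 \<in> cell K"
      and wc: "?w1 \<in> cell K" "src ?w1 = W" "trg ?w1 = T0 M (A \<otimes> (B \<otimes> C))" "?w2 \<in> cell K" "?w3 \<in> cell K"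
      using d by simp_all
    have "?F ?z2 \<bullet> ?F ?z1 = ?F (?z2 \<bullet> ?z1)" by (rule Fv[OF zc(1-4) comp(1)])
    moreover have "?F ?z3 \<bullet> ?F (?z2 \<bullet> ?z1) = ?F (?z3 \<bullet> (?z2 \<bullet> ?z1))"
      by (rule Fv) (use zc comp(1,2) in \<open>simp_all only: vcomp_cell src_vcomp trg_vcomp vtrg_vcomp\<close>)
    moreover have "?F ?w2 \<bullet> ?F ?w1 = ?F (?w2 \<bullet> ?w1)" by (rule Fv[OF wc(1-4) comp(3)])
    moreover have "?F ?w3 \<bullet> ?F (?w2 \<bullet> ?w1) = ?F (?w3 \<bullet> (?w2 \<bullet> ?w1))"
      by (rule Fv) (use wc comp(3,4) in \<open>simp_all only: vcomp_cell src_vcomp trg_vcomp vtrg_vcomp\<close>)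
    ultimately show ?thesis using gam_el_yang_baxter[OF dd] by simp
  qed
  ultimately show ?thesis by simp
qed

end

section \<open>Ascending paths in the weak right order\<close>

abbreviation adj :: "nat \<Rightarrow> nat \<Rightarrow> nat" where "adj i \<equiv> transpose i (Suc i)"

text \<open>Inversions are recorded by values, not positions: a step
  \<open>\<sigma> \<circ> adj i\<close> exchanges neighbouring positions, so it changes the order of
  a single pair of values. Weak order thereby becomes inclusion of sets.\<close>

definition value_inversions :: "nat \<Rightarrow> (nat \<Rightarrow> nat) \<Rightarrow> (nat \<times> nat) set" where
  "value_inversions n \<sigma> = {(x, y). 1 \<le> x \<and> x < y \<and> y \<le> n \<and> inv \<sigma> y < inv \<sigma> x}"

lemma perm_range:
  assumes "\<sigma> \<in> symmetric_group n" "1 \<le> k" "k \<le> n"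
  shows "1 \<le> \<sigma> k" "\<sigma> k \<le> n" "1 \<le> inv \<sigma> k" "inv \<sigma> k \<le> n"
  using assms permutes_in_image[of \<sigma> "{1..n}" k] permutes_in_image[OF permutes_inv, of \<sigma> "{1..n}" k]
  by (auto simp: symmetric_group_def)

lemma perm_inv:
  assumes "\<sigma> \<in> symmetric_group n"
  shows "\<sigma> (inv \<sigma> k) = k" "inv \<sigma> (\<sigma> k) = k" "inv \<sigma> x = y \<longleftrightarrow> \<sigma> y = x" "\<sigma> x = \<sigma> y \<longleftrightarrow> x = y"
proof -
  have p: "\<sigma> permutes {1..n}" using assms by (simp add: symmetric_group_def)
  show "\<sigma> (inv \<sigma> k) = k" "inv \<sigma> (\<sigma> k) = k" using permutes_inverses[OF p] by simp_all
  show "inv \<sigma> x = y \<longleftrightarrow> \<sigma> y = x" by (rule permutes_inv_eq[OF p])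
  show "\<sigma> x = \<sigma> y \<longleftrightarrow> x = y" by (rule inj_eq[OF permutes_inj[OF p]])
qed

lemma adj_in_group: "\<lbrakk>1 \<le> i; i < n\<rbrakk> \<Longrightarrow> adj i \<in> symmetric_group n"
  by (simp add: symmetric_group_def permutes_swap_id)

lemma group_comp: "\<lbrakk>\<sigma> \<in> symmetric_group n; \<tau> \<in> symmetric_group n\<rbrakk> \<Longrightarrow> \<sigma> \<circ> \<tau> \<in> symmetric_group n"
  by (simp add: symmetric_group_def permutes_compose)

lemma group_adj: "\<lbrakk>\<sigma> \<in> symmetric_group n; 1 \<le> i; i < n\<rbrakk> \<Longrightarrow> \<sigma> \<circ> adj i \<in> symmetric_group n"
  by (intro group_comp adj_in_group)

lemma inv_comp_adj:
  assumes "\<sigma> \<in> symmetric_group n"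
  shows "inv (\<sigma> \<circ> adj i) x = adj i (inv \<sigma> x)"
proof -
  have "bij \<sigma>" using assms by (simp add: symmetric_group_def permutes_bij)
  then have "inv (\<sigma> \<circ> adj i) = inv (adj i) \<circ> inv \<sigma>" by (intro o_inv_distrib) auto
  then show ?thesis by simp
qed

lemma finite_value_inversions [simp]: "finite (value_inversions n \<sigma>)"
  by (rule finite_subset[of _ "{..n} \<times> {..n}"]) (auto simp: value_inversions_def)

lemma inversions_eq_card:
  assumes "\<sigma> \<in> symmetric_group n"
  shows "inversions n \<sigma> = card (value_inversions n \<sigma>)"
  unfolding inversions_def
proof (rule bij_betw_same_card)
  show "bij_betw (\<lambda>(i, j). (\<sigma> j, \<sigma> i)) {(i, j). 1 \<le> i \<and> i < j \<and> j \<le> n \<and> \<sigma> j < \<sigma> i} (value_inversions n \<sigma>)"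
    using perm_range[OF assms]
    by (intro bij_betw_byWitness[where f' = "\<lambda>(x, y). (inv \<sigma> y, inv \<sigma> x)"])
      (auto simp: value_inversions_def perm_inv(1,2)[OF assms])
qed

text \<open>No position lies between \<open>i\<close> and \<open>i + 1\<close>, so exchanging them
  alters no other comparison.\<close>

lemma value_inversions_step:
  assumes "\<sigma> \<in> symmetric_group n" "1 \<le> i" "i < n" "\<sigma> i < \<sigma> (Suc i)"
  shows "value_inversions n (\<sigma> \<circ> adj i) = insert (\<sigma> i, \<sigma> (Suc i)) (value_inversions n \<sigma>)"
    "(\<sigma> i, \<sigma> (Suc i)) \<notin> value_inversions n \<sigma>"
proof -
  show "(\<sigma> i, \<sigma> (Suc i)) \<notin> value_inversions n \<sigma>"
    by (simp add: value_inversions_def perm_inv(2)[OF assms(1)])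
  have *: "adj i q < adj i p \<longleftrightarrow> (q < p \<and> \<not> (q = i \<and> p = Suc i)) \<or> (q = Suc i \<and> p = i)" for p q
    by (auto simp: transpose_def)
  show "value_inversions n (\<sigma> \<circ> adj i) = insert (\<sigma> i, \<sigma> (Suc i)) (value_inversions n \<sigma>)"
    using assms perm_range[OF assms(1), of i] perm_range[OF assms(1), of "Suc i"] perm_inv[OF assms(1)]
    by (auto simp: value_inversions_def inv_comp_adj[OF assms(1)] *)
qed

text \<open>A descent of \<open>\<sigma>\<close> at \<open>i\<close> is an ascent of
  \<open>\<sigma> \<circ> adj i\<close>, and \<open>adj i\<close> is an involution; so the count for
  ascents settles both directions.\<close>

lemma inversions_less_iff:
  assumes "\<sigma> \<in> symmetric_group n" "1 \<le> i" "i < n"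
  shows "inversions n \<sigma> < inversions n (\<sigma> \<circ> adj i) \<longleftrightarrow> \<sigma> i < \<sigma> (Suc i)"
proof -
  have *: "inversions n (\<tau> \<circ> adj i) = Suc (inversions n \<tau>)"
    if "\<tau> \<in> symmetric_group n" "\<tau> i < \<tau> (Suc i)" for \<tau>
    using value_inversions_step[OF that(1) assms(2,3) that(2)] group_adj[OF that(1) assms(2,3)] that
    by (simp add: inversions_eq_card)
  show ?thesis
  proof (cases "\<sigma> i < \<sigma> (Suc i)")
    case True
    with *[OF assms(1)] show ?thesis by simp
  next
    case False
    then have "\<sigma> (Suc i) < \<sigma> i" using perm_inv(4)[OF assms(1), of i "Suc i"] by auto
    then have "inversions n (\<sigma> \<circ> adj i \<circ> adj i) = Suc (inversions n (\<sigma> \<circ> adj i))"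
      by (intro *) (use group_adj[OF assms] in auto)
    moreover have "\<sigma> \<circ> adj i \<circ> adj i = \<sigma>" by (simp add: fun_eq_iff)
    ultimately show ?thesis using False by simp
  qed
qed

text \<open>Otherwise \<open>inv \<tau> \<circ> \<sigma>\<close> would increase at every
  neighbouring pair: at an ascent of \<open>\<sigma>\<close> because the pair is not inverted in
  \<open>\<tau>\<close>, at a descent because it is. An increasing permutation is the
  identity.\<close>

lemma ascent_exists:
  assumes "\<sigma> \<in> symmetric_group n" "\<tau> \<in> symmetric_group n"
    "value_inversions n \<sigma> \<subseteq> value_inversions n \<tau>" "\<sigma> \<noteq> \<tau>"
  shows "\<exists>i. 1 \<le> i \<and> i < n \<and> \<sigma> i < \<sigma> (Suc i) \<and> (\<sigma> i, \<sigma> (Suc i)) \<in> value_inversions n \<tau>"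
proof (rule ccontr)
  assume no: "\<nexists>i. 1 \<le> i \<and> i < n \<and> \<sigma> i < \<sigma> (Suc i) \<and> (\<sigma> i, \<sigma> (Suc i)) \<in> value_inversions n \<tau>"
  let ?r = "inv \<tau> \<circ> \<sigma>"
  have up: "?r i < ?r (Suc i)" if i: "1 \<le> i" "i < n" for i
  proof -
    have ne: "inv \<tau> (\<sigma> i) \<noteq> inv \<tau> (\<sigma> (Suc i))"
      using perm_inv[OF assms(1)] perm_inv[OF assms(2)] by (metis n_not_Suc_n)
    have rg: "1 \<le> \<sigma> i" "\<sigma> i \<le> n" "1 \<le> \<sigma> (Suc i)" "\<sigma> (Suc i) \<le> n"
      using perm_range[OF assms(1)] i by auto
    show ?thesis
    proof (cases "\<sigma> i < \<sigma> (Suc i)")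
      case True
      with no i have "(\<sigma> i, \<sigma> (Suc i)) \<notin> value_inversions n \<tau>" by blast
      with True rg ne show ?thesis by (auto simp: value_inversions_def)
    next
      case False
      then have "\<sigma> (Suc i) < \<sigma> i" using perm_inv(4)[OF assms(1), of i "Suc i"] by auto
      then have "(\<sigma> (Suc i), \<sigma> i) \<in> value_inversions n \<sigma>"
        using rg perm_inv(2)[OF assms(1)] by (simp add: value_inversions_def)
      with assms(3) show ?thesis by (auto simp: value_inversions_def)
    qed
  qed
  have r: "?r permutes {1..n}"
    using assms by (auto simp: symmetric_group_def intro: permutes_compose permutes_inv)
  \<comment> \<open>Strictly increasing natural numbers starting at or above 1 satisfy
    \<open>i \<le> ?r i\<close>, and a permutation with this property is the identity.\<close>
  have ge: "i \<le> ?r i" if "1 \<le> i" "i \<le> n" for i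
    using that
  proof (induction i rule: nat_induct_at_least)
    case base
    then show ?case using permutes_in_image[OF r, of 1] by simp
  next
    case (Suc i)
    then show ?case using up[of i] by simp
  qed
  have "?r = id" by (rule permutes_natset_ge[OF r]) (use ge in auto)
  then have "inv \<tau> (\<sigma> k) = k" for k by (metis comp_apply id_apply)
  then have "\<sigma> k = \<tau> k" for k using perm_inv(1)[OF assms(2)] by metis
  with assms(4) show False by auto
qed

lemma adj_commute: "Suc i < j \<Longrightarrow> adj i \<circ> adj j = adj j \<circ> adj i"
  by (auto simp: fun_eq_iff transpose_def)

lemma adj_braid: "adj i \<circ> adj (Suc i) \<circ> adj i = adj (Suc i) \<circ> adj i \<circ> adj (Suc i)"
  by (auto simp: fun_eq_iff transpose_def)

lemma category_order_cat:
  assumes refl: "\<And>x. (x, x) \<in> R" and trans: "\<And>x y z. \<lbrakk>(x, y) \<in> R; (y, z) \<in> R\<rbrakk> \<Longrightarrow> (x, z) \<in> R"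
  shows "category (order_cat S R)"
proof
  fix f g assume "f \<in> Arr (order_cat S R)" "g \<in> Arr (order_cat S R)"
    "Dom (order_cat S R) g = Cod (order_cat S R) f"
  then show "Comp (order_cat S R) g f \<in> Arr (order_cat S R)"
    using trans[of "fst f" "snd f" "snd g"] by (auto simp: order_cat_def)
qed (auto simp: order_cat_def refl)

text \<open>The combinatorial half, free of 2-categories: arrows on the edges extend to a functor
  once squares and hexagons commute. The laws are imposed at every \<open>\<sigma>\<close>, at
  ascents and descents alike, which avoids side conditions.\<close>

locale weak_order_diagram = category C
  for C :: "('o, 'm) cat" +
  fixes n :: nat and Ob :: "(nat \<Rightarrow> nat) \<Rightarrow> 'o" and st :: "(nat \<Rightarrow> nat) \<Rightarrow> nat \<Rightarrow> 'm"
  assumes Ob: "\<sigma> \<in> symmetric_group n \<Longrightarrow> Ob \<sigma> \<in> Obj C"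
    and st: "\<lbrakk>\<sigma> \<in> symmetric_group n; 1 \<le> i; i < n\<rbrakk> \<Longrightarrow>
      st \<sigma> i \<in> Arr C \<and> Dom C (st \<sigma> i) = Ob \<sigma> \<and> Cod C (st \<sigma> i) = Ob (\<sigma> \<circ> adj i)"
    and square: "\<lbrakk>\<sigma> \<in> symmetric_group n; 1 \<le> i; Suc i < j; j < n\<rbrakk> \<Longrightarrow>
      Comp C (st (\<sigma> \<circ> adj i) j) (st \<sigma> i) = Comp C (st (\<sigma> \<circ> adj j) i) (st \<sigma> j)"
    and braid: "\<lbrakk>\<sigma> \<in> symmetric_group n; 1 \<le> i; Suc i < n\<rbrakk> \<Longrightarrow>
      Comp C (st (\<sigma> \<circ> adj i \<circ> adj (Suc i)) i) (Comp C (st (\<sigma> \<circ> adj i) (Suc i)) (st \<sigma> i)) =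
      Comp C (st (\<sigma> \<circ> adj (Suc i) \<circ> adj i) (Suc i)) (Comp C (st (\<sigma> \<circ> adj (Suc i)) i) (st \<sigma> (Suc i)))"
begin

text \<open>A relation rather than a function of the ends, because the composite is a priori one for
  each path; that it depends only on the ends is the point to be proved.\<close>

inductive wpath :: "(nat \<Rightarrow> nat) \<Rightarrow> (nat \<Rightarrow> nat) \<Rightarrow> 'm \<Rightarrow> bool" where
  refl: "\<sigma> \<in> symmetric_group n \<Longrightarrow> wpath \<sigma> \<sigma> (Id C (Ob \<sigma>))"
| step: "\<lbrakk>\<sigma> \<in> symmetric_group n; 1 \<le> i; i < n; \<sigma> i < \<sigma> (Suc i); wpath (\<sigma> \<circ> adj i) \<tau> \<alpha>\<rbrakk> \<Longrightarrow>
    wpath \<sigma> \<tau> (Comp C \<alpha> (st \<sigma> i))"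

lemma wpath_arr:
  assumes "wpath \<sigma> \<tau> \<alpha>"
  shows "\<alpha> \<in> Arr C \<and> Dom C \<alpha> = Ob \<sigma> \<and> Cod C \<alpha> = Ob \<tau> \<and> \<sigma> \<in> symmetric_group n \<and> \<tau> \<in> symmetric_group n \<and>
    value_inversions n \<sigma> \<subseteq> value_inversions n \<tau>"
  using assms
proof induction
  case (refl \<sigma>)
  then show ?case using Ob[OF refl] by (simp add: Id_closed Dom_Id Cod_Id)
next
  case (step \<sigma> i \<tau> \<alpha>)
  have IH: "\<alpha> \<in> Arr C" "Dom C \<alpha> = Ob (\<sigma> \<circ> adj i)" "Cod C \<alpha> = Ob \<tau>" "\<tau> \<in> symmetric_group n"
    "value_inversions n (\<sigma> \<circ> adj i) \<subseteq> value_inversions n \<tau>"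
    using step(6) by (simp_all only:)
  then show ?case
    using st[OF step(1-3)] value_inversions_step(1)[OF step(1-4)] step(1)
    by (simp add: Comp_closed Dom_Comp Cod_Comp)
qed

text \<open>With \<open>wpath_arr\<close>, this characterizes reachability by inclusion. A step at
  the ascent from \<open>ascent_exists\<close> removes one pair from those that
  \<open>\<sigma>\<close> still misses.\<close>

lemma wpath_exists:
  assumes "\<sigma> \<in> symmetric_group n" "\<tau> \<in> symmetric_group n"
    "value_inversions n \<sigma> \<subseteq> value_inversions n \<tau>"
  shows "\<exists>\<alpha>. wpath \<sigma> \<tau> \<alpha>"
  using assms
proof (induction "card (value_inversions n \<tau> - value_inversions n \<sigma>)" arbitrary: \<sigma> rule: less_induct)
  case less
  show ?case
  proof (cases "\<sigma> = \<tau>")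
    case True
    then show ?thesis using refl less by blast
  next
    case False
    obtain i where i: "1 \<le> i" "i < n" "\<sigma> i < \<sigma> (Suc i)" "(\<sigma> i, \<sigma> (Suc i)) \<in> value_inversions n \<tau>"
      using ascent_exists[OF less.prems False] by blast
    note vi = value_inversions_step[OF less.prems(1) i(1-3)]
    have "card (value_inversions n \<tau> - value_inversions n (\<sigma> \<circ> adj i)) <
        card (value_inversions n \<tau> - value_inversions n \<sigma>)"
      by (rule psubset_card_mono) (use vi i(4) in auto)
    from less.hyps[OF this group_adj[OF less.prems(1) i(1,2)] less.prems(2)]
    obtain \<alpha> where "wpath (\<sigma> \<circ> adj i) \<tau> \<alpha>" using vi i(4) less.prems(3) by auto
    from step[OF less.prems(1) i(1-3) this] show ?thesis by blast
  qed
qed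

text \<open>
  Two first steps at positions \<open>i < j\<close> are completed to a square or a hexagon whose last vertex
  is still below \<open>\<tau>\<close>, because the value inversions of \<open>\<tau>\<close> are closed under transitivity.
\<close>

lemma wpath_confluent:
  assumes \<sigma>: "\<sigma> \<in> symmetric_group n" and i: "1 \<le> i" "\<sigma> i < \<sigma> (Suc i)"
    and j: "i < j" "j < n" "\<sigma> j < \<sigma> (Suc j)"
    and \<alpha>: "wpath (\<sigma> \<circ> adj i) \<tau> \<alpha>" and \<beta>: "wpath (\<sigma> \<circ> adj j) \<tau> \<beta>"
  shows "\<exists>\<alpha>' \<beta>'. wpath (\<sigma> \<circ> adj i) \<tau> \<alpha>' \<and> wpath (\<sigma> \<circ> adj j) \<tau> \<beta>' \<and>
    Comp C \<alpha>' (st \<sigma> i) = Comp C \<beta>' (st \<sigma> j)"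
proof -
  have i': "i < n" "1 \<le> j" using i j by auto
  have \<tau>: "\<tau> \<in> symmetric_group n" using wpath_arr[OF \<alpha>] by simp
  note vi = value_inversions_step(1)[OF \<sigma> i(1) i'(1) i(2)] value_inversions_step(1)[OF \<sigma> i'(2) j(2,3)]
  have vt: "(\<sigma> i, \<sigma> (Suc i)) \<in> value_inversions n \<tau>" "(\<sigma> j, \<sigma> (Suc j)) \<in> value_inversions n \<tau>"
    "value_inversions n \<sigma> \<subseteq> value_inversions n \<tau>"
    using wpath_arr[OF \<alpha>] wpath_arr[OF \<beta>] vi by auto
  note gi = group_adj[OF \<sigma> i(1) i'(1)] and gj = group_adj[OF \<sigma> i'(2) j(2)]
  note si = st[OF \<sigma> i(1) i'(1)] and sj = st[OF \<sigma> i'(2) j(2)]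
  show ?thesis
  proof (cases "Suc i < j")
    case True
    let ?\<rho> = "\<sigma> \<circ> adj i \<circ> adj j"
    have \<rho>: "\<sigma> \<circ> adj j \<circ> adj i = ?\<rho>" using adj_commute[OF True] by (metis comp_assoc)
    have aj: "(\<sigma> \<circ> adj i) j = \<sigma> j" "(\<sigma> \<circ> adj i) (Suc j) = \<sigma> (Suc j)"
      and ai: "(\<sigma> \<circ> adj j) i = \<sigma> i" "(\<sigma> \<circ> adj j) (Suc i) = \<sigma> (Suc i)"
      using True by (auto simp: transpose_def)
    have g: "?\<rho> \<in> symmetric_group n" using group_adj[OF gi i'(2) j(2)] .
    have "value_inversions n ?\<rho> \<subseteq> value_inversions n \<tau>"
      using value_inversions_step(1)[OF gi i'(2) j(2)] aj j(3) vi(1) vt by auto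
    from wpath_exists[OF g \<tau> this] obtain \<gamma> where \<gamma>: "wpath ?\<rho> \<tau> \<gamma>" by blast
    have "wpath (\<sigma> \<circ> adj i) \<tau> (Comp C \<gamma> (st (\<sigma> \<circ> adj i) j))"
      by (rule step[OF gi i'(2) j(2) _ \<gamma>]) (use aj j(3) in simp)
    moreover have "wpath (\<sigma> \<circ> adj j) \<tau> (Comp C \<gamma> (st (\<sigma> \<circ> adj j) i))"
      by (rule step[OF gj i(1) i'(1)]) (use ai i(2) \<gamma> \<rho> in simp_all)
    moreover have "Comp C (Comp C \<gamma> (st (\<sigma> \<circ> adj i) j)) (st \<sigma> i) = Comp C (Comp C \<gamma> (st (\<sigma> \<circ> adj j) i)) (st \<sigma> j)"
      using square[OF \<sigma> i(1) True j(2)] si sj st[OF gi i'(2) j(2)] st[OF gj i(1) i'(1)] wpath_arr[OF \<gamma>] \<rho>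
      by (simp add: Comp_assoc)
    ultimately show ?thesis by blast
  next
    case False
    then have ji: "j = Suc i" using j(1) by simp
    note gi2 = group_adj[OF gi i'(2) j(2), unfolded ji] and gj2 = group_adj[OF gj i(1) i'(1), unfolded ji]
    let ?\<rho> = "\<sigma> \<circ> adj i \<circ> adj (Suc i) \<circ> adj i"
    have \<rho>: "\<sigma> \<circ> adj (Suc i) \<circ> adj i \<circ> adj (Suc i) = ?\<rho>" using adj_braid[of i] by (metis comp_assoc)
    have v1: "(\<sigma> \<circ> adj i) (Suc i) = \<sigma> i" "(\<sigma> \<circ> adj i) (Suc (Suc i)) = \<sigma> (Suc (Suc i))"
      "(\<sigma> \<circ> adj i \<circ> adj (Suc i)) i = \<sigma> (Suc i)" "(\<sigma> \<circ> adj i \<circ> adj (Suc i)) (Suc i) = \<sigma> (Suc (Suc i))"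
      and v2: "(\<sigma> \<circ> adj (Suc i)) i = \<sigma> i" "(\<sigma> \<circ> adj (Suc i)) (Suc i) = \<sigma> (Suc (Suc i))"
      "(\<sigma> \<circ> adj (Suc i) \<circ> adj i) (Suc i) = \<sigma> i" "(\<sigma> \<circ> adj (Suc i) \<circ> adj i) (Suc (Suc i)) = \<sigma> (Suc i)"
      by (auto simp: transpose_def)
    have lt: "\<sigma> i < \<sigma> (Suc i)" "\<sigma> (Suc i) < \<sigma> (Suc (Suc i))" "\<sigma> i < \<sigma> (Suc (Suc i))" and sn: "Suc i < n" "1 \<le> Suc i"
      using i j ji by auto
    \<comment> \<open>The third inversion created along the hexagon: \<open>\<tau>\<close> reverses
      both pairs of neighbours among the three values, hence also the outer pair.\<close>
    have ac: "(\<sigma> i, \<sigma> (Suc (Suc i))) \<in> value_inversions n \<tau>"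
      using vt ji by (auto simp: value_inversions_def)
    note g = group_adj[OF gi2 i(1) i'(1)]
    have "value_inversions n ?\<rho> \<subseteq> value_inversions n \<tau>"
      using value_inversions_step(1)[OF gi2 i(1) i'(1)] value_inversions_step(1)[OF gi sn(2,1)] v1 lt vi(1) vt ac ji
      by auto
    from wpath_exists[OF g \<tau> this] obtain \<gamma> where \<gamma>: "wpath ?\<rho> \<tau> \<gamma>" by blast
    have "wpath (\<sigma> \<circ> adj i \<circ> adj (Suc i)) \<tau> (Comp C \<gamma> (st (\<sigma> \<circ> adj i \<circ> adj (Suc i)) i))"
      by (rule step[OF gi2 i(1) i'(1) _ \<gamma>]) (use v1 lt in simp)
    then have "wpath (\<sigma> \<circ> adj i) \<tau> (Comp C (Comp C \<gamma> (st (\<sigma> \<circ> adj i \<circ> adj (Suc i)) i)) (st (\<sigma> \<circ> adj i) (Suc i)))"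
      by (rule step[OF gi sn(2,1), rotated]) (use v1 lt in simp)
    moreover have "wpath (\<sigma> \<circ> adj (Suc i) \<circ> adj i) \<tau> (Comp C \<gamma> (st (\<sigma> \<circ> adj (Suc i) \<circ> adj i) (Suc i)))"
      by (rule step[OF gj2 sn(2,1)]) (use v2 lt \<gamma> \<rho> in simp_all)
    then have "wpath (\<sigma> \<circ> adj (Suc i)) \<tau> (Comp C (Comp C \<gamma> (st (\<sigma> \<circ> adj (Suc i) \<circ> adj i) (Suc i))) (st (\<sigma> \<circ> adj (Suc i)) i))"
      by (rule step[OF gj[unfolded ji] i(1) i'(1), rotated]) (use v2 lt in simp)
    moreover have "Comp C (Comp C (Comp C \<gamma> (st (\<sigma> \<circ> adj i \<circ> adj (Suc i)) i)) (st (\<sigma> \<circ> adj i) (Suc i))) (st \<sigma> i) =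
      Comp C (Comp C (Comp C \<gamma> (st (\<sigma> \<circ> adj (Suc i) \<circ> adj i) (Suc i))) (st (\<sigma> \<circ> adj (Suc i)) i)) (st \<sigma> (Suc i))"
      using braid[OF \<sigma> i(1) sn(1)] si sj[unfolded ji] st[OF gi sn(2,1)] st[OF gj[unfolded ji] i(1) i'(1)]
        st[OF gi2 i(1) i'(1)] st[OF gj2 sn(2,1)] wpath_arr[OF \<gamma>] \<rho>
      by (simp add: Comp_assoc Comp_closed Cod_Comp Dom_Comp)
    ultimately show ?thesis unfolding ji by blast
  qed
qed

text \<open>Newman's argument: \<open>wpath_confluent\<close> offers some continuations with equal
  composites, and the induction hypothesis after the first step identifies them with the given
  ones.\<close>

lemma wpath_unique: "\<lbrakk>wpath \<sigma> \<tau> \<alpha>; wpath \<sigma> \<tau> \<beta>\<rbrakk> \<Longrightarrow> \<alpha> = \<beta>"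
proof (induction "card (value_inversions n \<tau> - value_inversions n \<sigma>)" arbitrary: \<sigma> \<alpha> \<beta> rule: less_induct)
  case less
  have \<sigma>: "\<sigma> \<in> symmetric_group n" using wpath_arr[OF less.prems(1)] by simp
  have smaller: "card (value_inversions n \<tau> - value_inversions n (\<sigma> \<circ> adj i)) <
      card (value_inversions n \<tau> - value_inversions n \<sigma>)"
    if "1 \<le> i" "i < n" "\<sigma> i < \<sigma> (Suc i)" "wpath (\<sigma> \<circ> adj i) \<tau> \<gamma>" for i \<gamma>
    by (rule psubset_card_mono)
      (use value_inversions_step[OF \<sigma> that(1-3)] wpath_arr[OF that(4)] in auto)
  have uniq: "\<gamma> = \<delta>" if "1 \<le> i" "i < n" "\<sigma> i < \<sigma> (Suc i)" "wpath (\<sigma> \<circ> adj i) \<tau> \<gamma>" "wpath (\<sigma> \<circ> adj i) \<tau> \<delta>"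
    for i \<gamma> \<delta>
    by (rule less.hyps[OF smaller[OF that(1-4)] that(4,5)])
  \<comment> \<open>The completion to a square or hexagon assumes \<open>i < j\<close>; the opposite
    order is obtained at the end by exchanging the two paths.\<close>
  have ordered: "Comp C \<gamma> (st \<sigma> i) = Comp C \<delta> (st \<sigma> j)"
    if "1 \<le> i" "\<sigma> i < \<sigma> (Suc i)" "wpath (\<sigma> \<circ> adj i) \<tau> \<gamma>"
      "i < j" "j < n" "\<sigma> j < \<sigma> (Suc j)" "wpath (\<sigma> \<circ> adj j) \<tau> \<delta>" for i j \<gamma> \<delta>
  proof -
    note hyps = that
    obtain \<gamma>' \<delta>' where *: "wpath (\<sigma> \<circ> adj i) \<tau> \<gamma>'" "wpath (\<sigma> \<circ> adj j) \<tau> \<delta>'"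
      "Comp C \<gamma>' (st \<sigma> i) = Comp C \<delta>' (st \<sigma> j)"
      using wpath_confluent[OF \<sigma> hyps(1,2,4-6,3,7)] by blast
    have "\<gamma> = \<gamma>'" by (rule uniq[OF that(1) _ that(2,3) *(1)]) (use that in simp)
    moreover have "\<delta> = \<delta>'" by (rule uniq[OF _ that(5,6,7) *(2)]) (use that in simp)
    ultimately show ?thesis using *(3) by simp
  qed
  \<comment> \<open>A nonempty ascending path cannot return to its start, so an empty path and a
    nonempty one never share both ends.\<close>
  have no_loop: "False" if "1 \<le> i" "i < n" "\<tau> i < \<tau> (Suc i)" "wpath (\<tau> \<circ> adj i) \<tau> \<gamma>" "\<tau> = \<sigma>" for i \<gamma>
    using smaller[of i \<gamma>] that by simp
  from less.prems(1) show ?case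
  proof cases
    case refl1: refl
    from less.prems(2) show ?thesis
    proof cases
      case refl
      then show ?thesis using refl1 by simp
    next
      case (step j \<beta>')
      then show ?thesis using no_loop[of j \<beta>'] refl1 by auto
    qed
  next
    case step1: (step i \<alpha>')
    from less.prems(2) show ?thesis
    proof cases
      case refl
      then show ?thesis using no_loop[of i \<alpha>'] step1 by auto
    next
      case (step j \<beta>')
      consider "i = j" | "i < j" | "j < i" by linarith
      then show ?thesis
      proof cases
        case 1
        then show ?thesis using step1 step uniq[of i \<alpha>' \<beta>'] by simp
      next
        case 2
        then show ?thesis using ordered[of i \<alpha>' j \<beta>'] step1 step by simp
      next
        case 3
        then show ?thesis using ordered[of j \<beta>' i \<alpha>'] step1 step by simp
      qed
    qed
  qed
qed

lemma wpath_trans: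
  assumes "wpath \<sigma> \<tau> \<alpha>" "wpath \<tau> \<upsilon> \<beta>"
  shows "wpath \<sigma> \<upsilon> (Comp C \<beta> \<alpha>)"
  using assms
proof (induction)
  case (refl \<sigma>)
  then show ?case using wpath_arr[OF refl(2)] Comp_Id_right[of \<beta>] by simp
next
  case (step \<sigma> i \<tau> \<alpha>)
  have "Comp C \<beta> (Comp C \<alpha> (st \<sigma> i)) = Comp C (Comp C \<beta> \<alpha>) (st \<sigma> i)"
    using wpath_arr[OF step(5)] wpath_arr[OF step(7)] st[OF step(1-3)] by (simp add: Comp_assoc)
  then show ?case using wpath.step[OF step(1-4) step(6)[OF step(7)]] by simp
qed

lemma wpath_if_weak_order:
  assumes "(\<sigma>, \<tau>) \<in> weak_right_order n" "\<tau> \<in> symmetric_group n"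
  shows "\<exists>\<alpha>. wpath \<sigma> \<tau> \<alpha>"
  using assms(1) unfolding weak_right_order_def
proof (induction rule: converse_rtrancl_induct)
  case base
  then show ?case using refl assms(2) by blast
next
  case (step \<sigma> \<rho>)
  then obtain i \<alpha> where "\<sigma> \<in> symmetric_group n" "1 \<le> i" "i < n"
    "inversions n \<sigma> < inversions n (\<sigma> \<circ> adj i)" "wpath (\<sigma> \<circ> adj i) \<tau> \<alpha>" by auto
  then show ?case using wpath.step[of \<sigma> i \<tau> \<alpha>] inversions_less_iff by blast
qed

theorem functor_exists:
  "\<exists>Fm. cat_functor (weak_order_cat n) C Ob Fm \<and>
    (\<forall>\<sigma> \<in> symmetric_group n. \<forall>i. 1 \<le> i \<and> i < n \<and> inversions n \<sigma> < inversions n (\<sigma> \<circ> adj i) \<longrightarrow>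
      Fm (\<sigma>, \<sigma> \<circ> adj i) = st \<sigma> i)"
proof (intro exI conjI ballI allI impI)
  \<comment> \<open>The description is meaningful on arrows of the weak order: a path exists and its
    composite is unique.\<close>
  let ?Fm = "\<lambda>(\<sigma>, \<tau>). THE \<alpha>. wpath \<sigma> \<tau> \<alpha>"
  have eq: "?Fm (\<sigma>, \<tau>) = \<alpha>" if "wpath \<sigma> \<tau> \<alpha>" for \<sigma> \<tau> \<alpha>
    using the_equality[of "wpath \<sigma> \<tau>" \<alpha>, OF that wpath_unique[OF _ that]] by simp
  have ex: "wpath \<sigma> \<tau> (?Fm (\<sigma>, \<tau>))"
    if "(\<sigma>, \<tau>) \<in> weak_right_order n" "\<tau> \<in> symmetric_group n" for \<sigma> \<tau>
  proof -
    from wpath_if_weak_order[OF that] obtain \<alpha> where "wpath \<sigma> \<tau> \<alpha>" ..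
    with eq[OF this] show ?thesis by (simp only:)
  qed
  have W: "category (weak_order_cat n)"
    unfolding weak_order_cat_def weak_right_order_def
    by (rule category_order_cat[OF rtrancl_refl rtrancl_trans])
  show "cat_functor (weak_order_cat n) C Ob ?Fm"
  proof (intro cat_functor.intro cat_functor_axioms.intro W category_axioms)
    show "?Fm (Id (weak_order_cat n) \<sigma>) = Id C (Ob \<sigma>)" if "\<sigma> \<in> Obj (weak_order_cat n)" for \<sigma>
      using eq[OF refl[of \<sigma>]] that by (simp add: weak_order_cat_def order_cat_def)
    show "?Fm (Comp (weak_order_cat n) g f) = Comp C (?Fm g) (?Fm f)"
      if "f \<in> Arr (weak_order_cat n)" "g \<in> Arr (weak_order_cat n)"
        "Dom (weak_order_cat n) g = Cod (weak_order_cat n) f" for f g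
    proof -
      note hyps = that
      obtain \<sigma> \<tau> \<upsilon> where fg: "f = (\<sigma>, \<tau>)" "g = (\<tau>, \<upsilon>)"
        using hyps by (cases f; cases g) (auto simp: weak_order_cat_def order_cat_def)
      have "wpath \<sigma> \<tau> (?Fm f)" "wpath \<tau> \<upsilon> (?Fm g)"
        unfolding fg by (rule ex; use that fg in \<open>simp add: weak_order_cat_def order_cat_def\<close>)+
      from eq[OF wpath_trans[OF this]] show ?thesis
        by (simp add: fg weak_order_cat_def order_cat_def)
    qed
  qed (use Ob wpath_arr[OF ex] in \<open>auto simp: weak_order_cat_def order_cat_def\<close>)
  fix \<sigma> i assume \<sigma>: "\<sigma> \<in> symmetric_group n"
    and i: "1 \<le> i \<and> i < n \<and> inversions n \<sigma> < inversions n (\<sigma> \<circ> adj i)"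
  have i': "1 \<le> i" "i < n" using i by auto
  \<comment> \<open>The one-step path ends with the empty path, which contributes an identity to be
    cancelled.\<close>
  have "wpath \<sigma> (\<sigma> \<circ> adj i) (Comp C (Id C (Ob (\<sigma> \<circ> adj i))) (st \<sigma> i))"
    by (rule step[OF \<sigma> i' _ refl[OF group_adj[OF \<sigma> i']]]) (use i inversions_less_iff[OF \<sigma> i'] in blast)
  moreover have "Comp C (Id C (Ob (\<sigma> \<circ> adj i))) (st \<sigma> i) = st \<sigma> i"
    using st[OF \<sigma> i'] Comp_Id_left[of "st \<sigma> i"] by simp
  ultimately show "?Fm (\<sigma>, \<sigma> \<circ> adj i) = st \<sigma> i" using eq by simp
qed

end

section \<open>The functor \<open>\<Omega>\<close>\<close>

context two_category
begin

lemma category_hom_cat: "category (hom_cat K A B)"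
proof -
  interpret V: category "vert_cat K" by (rule vert_category)
  note vc = V.Comp_closed V.Dom_Comp V.Cod_Comp V.Comp_Id_right V.Comp_Id_left V.Comp_assoc
  show ?thesis
    by unfold_locales
      (use vc in \<open>auto simp: hom_cat_def vert_cat_def parallel_dom parallel_cod\<close>)
qed

text \<open>Inverses of 1-cells are unique, so a candidate for the definite description
  \<open>inv1\<close> can be verified inside the calculus of 2-cells.\<close>

lemma inv1_eqI:
  assumes f: "f \<in> arr K" and g: "g \<in> arr K" "dom1 K g = cod1 K f" "cod1 K g = dom1 K f"
    and gf: "id2 K g \<star> id2 K f = hid (dom1 K f)" and fg: "id2 K f \<star> id2 K g = hid (cod1 K f)"
  shows "inv1 K f = g"
  unfolding inv1_def
proof (rule the_equality)
  have *: "g \<odot> f = id1 K (dom1 K f)" "f \<odot> g = id1 K (cod1 K f)"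
    by (rule id2_inj; use f g gf fg in \<open>simp add: id2_comp1 hid_def\<close>)+
  then show "g \<in> arr K \<and> dom1 K g = cod1 K f \<and> cod1 K g = dom1 K f \<and>
     g \<odot> f = id1 K (dom1 K f) \<and> f \<odot> g = id1 K (cod1 K f)" using g by simp
  fix h assume h: "h \<in> arr K \<and> dom1 K h = cod1 K f \<and> cod1 K h = dom1 K f \<and>
     h \<odot> f = id1 K (dom1 K f) \<and> f \<odot> h = id1 K (cod1 K f)"
  have "(h \<odot> f) \<odot> g = h \<odot> (f \<odot> g)"
    by (rule comp1_assoc) (use f g h in auto)
  then show "h = g" using h g * by simp
qed

end

section \<open>Permutations, groupings and iterated \<open>\<omega>\<close> of the statement in the
  calculus of families\<close>

context strong_two_monad
begin

lemma id2_perm1: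
  assumes "1 \<le> n" "obs X n" "\<sigma> permutes {1..n}"
  shows "perm1 K X n \<sigma> \<in> arr K" "dom1 K (perm1 K X n \<sigma>) = nprod K (X \<circ> \<sigma>) n"
    "cod1 K (perm1 K X n \<sigma>) = nprod K X n" "id2 K (perm1 K X n \<sigma>) = perm2 X n \<sigma>"
proof -
  have "nproj K (X \<circ> \<sigma>) n (inv \<sigma> k) \<in> arr K \<and> dom1 K (nproj K (X \<circ> \<sigma>) n (inv \<sigma> k)) = nprod K (X \<circ> \<sigma>) n \<and>
      cod1 K (nproj K (X \<circ> \<sigma>) n (inv \<sigma> k)) = X k" if "1 \<le> k" "k \<le> n" for k
    using nproj_arr[OF assms(1) obs_perm[OF assms(2,3)], of "inv \<sigma> k"] permutes_range[OF assms(3) that] by simp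
  from id2_ntuple[OF assms(1) this]
  show "perm1 K X n \<sigma> \<in> arr K" "dom1 K (perm1 K X n \<sigma>) = nprod K (X \<circ> \<sigma>) n"
    "cod1 K (perm1 K X n \<sigma>) = nprod K X n" "id2 K (perm1 K X n \<sigma>) = perm2 X n \<sigma>"
    by (simp_all add: perm1_def perm2_def nproj2_def)
qed

text \<open>Position \<open>k\<close> of the codomain of the inverse holds the factor
  \<open>\<sigma> k\<close>, whose projection is therefore its component.\<close>

lemma inv1_perm1:
  assumes "1 \<le> n" "obs X n" "\<sigma> permutes {1..n}"
  shows "inv1 K (perm1 K X n \<sigma>) \<in> arr K" "dom1 K (inv1 K (perm1 K X n \<sigma>)) = nprod K X n"
    "cod1 K (inv1 K (perm1 K X n \<sigma>)) = nprod K (X \<circ> \<sigma>) n"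
    "id2 K (inv1 K (perm1 K X n \<sigma>)) = ntuple2 (nproj2 X n \<circ> \<sigma>) n"
proof -
  let ?g = "ntuple K (\<lambda>k. nproj K X n (\<sigma> k)) n" and ?r = "\<lambda>k. nproj2 X n (\<sigma> k)"
  have "nproj K X n (\<sigma> k) \<in> arr K \<and> dom1 K (nproj K X n (\<sigma> k)) = nprod K X n \<and>
      cod1 K (nproj K X n (\<sigma> k)) = (X \<circ> \<sigma>) k" if "1 \<le> k" "k \<le> n" for k
    using nproj_arr[OF assms(1,2), of "\<sigma> k"] permutes_range[OF assms(3) that] by simp
  note g = id2_ntuple[where f = "\<lambda>k. nproj K X n (\<sigma> k)" and X = "X \<circ> \<sigma>", OF assms(1) this]
  have id: "id2 K ?g = ntuple2 ?r n" using g by (simp add: nproj2_def)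
  have r: "fam (nprod K X n) (X \<circ> \<sigma>) n ?r"
    using assms(2) permutes_range[OF assms(3)] by (auto simp: fam_def)
  note f = id2_perm1[OF assms]
  have "inv1 K (perm1 K X n \<sigma>) = ?g"
  proof (rule inv1_eqI)
    show "id2 K (perm1 K X n \<sigma>) \<star> id2 K ?g = hid (cod1 K (perm1 K X n \<sigma>))"
    proof -
      have "perm2 X n \<sigma> \<star> ntuple2 ?r n = ntuple2 (\<lambda>k. ?r (inv \<sigma> k)) n"
        by (rule perm2_ntuple2[OF assms(1,3) r assms(2)])
      also have "\<dots> = ntuple2 (nproj2 X n) n"
        by (rule ntuple2_cong[OF assms(1)]) (use permutes_range[OF assms(3)] in simp)
      finally show ?thesis using assms f id by simp
    qed
    show "id2 K ?g \<star> id2 K (perm1 K X n \<sigma>) = hid (dom1 K (perm1 K X n \<sigma>))"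
    proof -
      have "ntuple2 ?r n \<star> perm2 X n \<sigma> = ntuple2 (\<lambda>k. ?r k \<star> perm2 X n \<sigma>) n"
        using ntuple2_hcomp[OF assms(1) r] perm2_cell[OF assms] by simp
      also have "\<dots> = ntuple2 (nproj2 (X \<circ> \<sigma>) n) n"
      proof (rule ntuple2_cong[OF assms(1)])
        fix k assume k: "1 \<le> k" "k \<le> n"
        show "?r k \<star> perm2 X n \<sigma> = nproj2 (X \<circ> \<sigma>) n k"
          using nproj2_ntuple2[OF assms(1) fam_perm2[OF assms(2,3)], of "\<sigma> k"] permutes_range[OF assms(3) k]
          by (simp add: perm2_def)
      qed
      finally show ?thesis using assms f id obs_perm[OF assms(2,3)] by simp
    qed
  qed (use f g in simp_all)
  then show "inv1 K (perm1 K X n \<sigma>) \<in> arr K" "dom1 K (inv1 K (perm1 K X n \<sigma>)) = nprod K X n"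
    "cod1 K (inv1 K (perm1 K X n \<sigma>)) = nprod K (X \<circ> \<sigma>) n"
    "id2 K (inv1 K (perm1 K X n \<sigma>)) = ntuple2 (nproj2 X n \<circ> \<sigma>) n"
    using g id by (simp_all add: comp_def)
qed

lemma id2_group1:
  assumes "obs X (Suc m)" "1 \<le> i" "i \<le> m"
  shows "group1 K X (Suc m) i \<in> arr K" "dom1 K (group1 K X (Suc m) i) = nprod K X (Suc m)"
    "cod1 K (group1 K X (Suc m) i) = nprod K (merge i X (X i \<otimes> X (Suc i))) m"
    "id2 K (group1 K X (Suc m) i) = group2 X (Suc m) i"
proof -
  let ?f = "merge i (nproj K X (Suc m)) (pair1 K (nproj K X (Suc m) i) (nproj K X (Suc m) (Suc i)))"
  have m: "1 \<le> m" "1 \<le> Suc m" using assms by auto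
  note a = nproj_arr[OF m(2) assms(1)]
  have "?f k \<in> arr K \<and> dom1 K (?f k) = nprod K X (Suc m) \<and> cod1 K (?f k) = merge i X (X i \<otimes> X (Suc i)) k"
    if "1 \<le> k" "k \<le> m" for k
    using a[of k] a[of i] a[of "Suc i"] a[of "Suc k"] that assms(2,3) by (auto simp: merge_def)
  note t = id2_ntuple[OF m(1) this]
  have "ntuple2 (\<lambda>k. id2 K (?f k)) m = group2 X (Suc m) i"
    unfolding group2_def diff_Suc_1
    by (rule ntuple2_cong[OF m(1)]) (use a[of i] a[of "Suc i"] assms in \<open>auto simp: merge_def nproj2_def\<close>)
  with t show "group1 K X (Suc m) i \<in> arr K" "dom1 K (group1 K X (Suc m) i) = nprod K X (Suc m)"
    "cod1 K (group1 K X (Suc m) i) = nprod K (merge i X (X i \<otimes> X (Suc i))) m"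
    "id2 K (group1 K X (Suc m) i) = group2 X (Suc m) i"
    by (simp_all add: group1_def)
qed

lemma group2_ntuple2:
  assumes "fam W X (Suc m) a" "1 \<le> i" "i \<le> m"
  shows "group2 X (Suc m) i \<star> ntuple2 a (Suc m) = ntuple2 (merge i a (pair (a i) (a (Suc i)))) m"
proof -
  have m: "1 \<le> m" "1 \<le> Suc m" and im: "i < Suc m" using assms by auto
  note o = fam_obs[OF assms(1)] and c = ntuple2_cell[OF m(2) assms(1)]
  note p = nproj2_ntuple2[OF m(2) assms(1)]
  have "group2 X (Suc m) i \<star> ntuple2 a (Suc m) =
      ntuple2 (\<lambda>k. merge i (nproj2 X (Suc m)) (pair (nproj2 X (Suc m) i) (nproj2 X (Suc m) (Suc i))) k \<star> ntuple2 a (Suc m)) m"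
    unfolding group2_def diff_Suc_1
    by (rule ntuple2_hcomp[OF m(1) fam_group2[OF o assms(2) im, unfolded diff_Suc_1]]) (use c in simp_all)
  also have "\<dots> = ntuple2 (merge i a (pair (a i) (a (Suc i)))) m"
    by (rule ntuple2_cong[OF m(1)]) (use p c o assms(2,3) in \<open>auto simp: merge_def\<close>)
  finally show ?thesis .
qed

lemma inv1_group1:
  assumes "obs X (Suc m)" "1 \<le> i" "i \<le> m" "Y = merge i X (X i \<otimes> X (Suc i))"
  shows "inv1 K (group1 K X (Suc m) i) \<in> arr K"
    "dom1 K (inv1 K (group1 K X (Suc m) i)) = nprod K Y m"
    "cod1 K (inv1 K (group1 K X (Suc m) i)) = nprod K X (Suc m)"
    "id2 K (inv1 K (group1 K X (Suc m) i)) = ntuple2 (unmerge i (X i) (X (Suc i)) (nproj2 Y m)) (Suc m)"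
proof -
  let ?u = "unmerge i (X i) (X (Suc i)) (nproj2 Y m)"
  \<comment> \<open>The 1-cell counterpart of \<open>unmerge\<close>, applied to the projections;
    splitting the grouped factor is inverse to grouping.\<close>
  let ?f = "\<lambda>j. if j < i then nproj K Y m j else if j = i then pr1 K (X i) (X (Suc i)) \<odot> nproj K Y m i
     else if j = Suc i then pr2 K (X i) (X (Suc i)) \<odot> nproj K Y m i else nproj K Y m (j - 1)"
  let ?g = "ntuple K ?f (Suc m)"
  have m: "1 \<le> m" "1 \<le> Suc m" using assms by auto
  have x: "X i \<in> ob K" "X (Suc i) \<in> ob K" using assms by (auto simp: obs_def)
  have oY: "obs Y m" using obs_merge[OF assms(1), of "X i \<otimes> X (Suc i)" i] x assms(4) by simp
  note a = nproj_arr[OF m(1) oY]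
  have Yi: "Y i = X i \<otimes> X (Suc i)" using assms(4) by (simp add: merge_def)
  have f: "?f k \<in> arr K \<and> dom1 K (?f k) = nprod K Y m \<and> cod1 K (?f k) = X k" "id2 K (?f k) = ?u k"
    if k: "1 \<le> k" "k \<le> Suc m" for k
  proof -
    have "1 \<le> k - 1 \<and> k - 1 \<le> m \<and> Y (k - 1) = X k" if "Suc i < k"
      using that k assms(2,4) by (auto simp: merge_def)
    moreover have "Y k = X k" if "k < i" using that assms(4) by (simp add: merge_def)
    ultimately show "?f k \<in> arr K \<and> dom1 K (?f k) = nprod K Y m \<and> cod1 K (?f k) = X k"
      using a[of k] a[of i] a[of "k - 1"] k assms(2,3) x Yi by auto
    show "id2 K (?f k) = ?u k"
      using a[of i] assms(2,3) x Yi by (simp add: unmerge_def id2_comp1 nproj2_def p1_def p2_def)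
  qed
  note t = id2_ntuple[OF m(2) f(1)]
  have id: "id2 K ?g = ntuple2 ?u (Suc m)" using t ntuple2_cong[OF m(2) f(2)] by simp
  note l = regrouping_unmerge[OF assms(4) assms(2,3,1) refl refl]
  note fu = linD(1)[OF l fam_nproj2[OF oY]]
  note g = id2_group1[OF assms(1-3), folded assms(4)] and c = group2_cell[OF assms(1-3), folded assms(4)]
  note cu = ntuple2_cell[OF m(2) fu]
  have "inv1 K (group1 K X (Suc m) i) = ?g"
  proof (rule inv1_eqI)
    show "id2 K ?g \<star> id2 K (group1 K X (Suc m) i) = hid (dom1 K (group1 K X (Suc m) i))"
    proof -
      have "ntuple2 ?u (Suc m) \<star> group2 X (Suc m) i = ntuple2 (\<lambda>j. ?u j \<star> group2 X (Suc m) i) (Suc m)"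
        by (rule ntuple2_hcomp[OF m(2) fu]) (use c in simp_all)
      also have "\<dots> = ntuple2 (nproj2 X (Suc m)) (Suc m)"
      proof (rule ntuple2_cong[OF m(2)])
        fix j assume j: "1 \<le> j" "j \<le> Suc m"
        have "?u j \<star> group2 X (Suc m) i = unmerge i (X i) (X (Suc i)) (\<lambda>k. nproj2 Y m k \<star> group2 X (Suc m) i) j"
          by (rule linD(3)[OF l fam_nproj2[OF oY] _ _ j]) (use c in simp_all)
        also have "\<dots> = unmerge i (X i) (X (Suc i))
            (merge i (nproj2 X (Suc m)) (pair (nproj2 X (Suc m) i) (nproj2 X (Suc m) (Suc i)))) j"
          by (rule unmerge_cong[OF assms(2,3) j]) (use nproj2_group2[OF assms(1-3)] assms(4) in simp)
        also have "\<dots> = nproj2 X (Suc m) j"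
          by (rule unmerge_merge[OF fam_nproj2[OF assms(1)] assms(2,3) j refl refl])
        finally show "?u j \<star> group2 X (Suc m) i = nproj2 X (Suc m) j" .
      qed
      finally show ?thesis using id g assms(1) m by simp
    qed
    show "id2 K (group1 K X (Suc m) i) \<star> id2 K ?g = hid (cod1 K (group1 K X (Suc m) i))"
    proof -
      have "group2 X (Suc m) i \<star> ntuple2 ?u (Suc m) = ntuple2 (merge i ?u (pair (?u i) (?u (Suc i)))) m"
        by (rule group2_ntuple2[OF fu assms(2,3)])
      also have "\<dots> = ntuple2 (nproj2 Y m) m"
        by (rule ntuple2_cong[OF m(1)]) (use x Yi oY assms(2,3) in \<open>auto simp: merge_def unmerge_def\<close>)
      finally show ?thesis using id g oY m by simp
    qed
  qed (use g t in simp_all)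
  then show "inv1 K (group1 K X (Suc m) i) \<in> arr K"
    "dom1 K (inv1 K (group1 K X (Suc m) i)) = nprod K Y m"
    "cod1 K (inv1 K (group1 K X (Suc m) i)) = nprod K X (Suc m)"
    "id2 K (inv1 K (group1 K X (Suc m) i)) = ntuple2 ?u (Suc m)"
    using t id by simp_all
qed

lemma nomega_Suc: "1 \<le> n \<Longrightarrow> nomega K M X (Suc n) =
    omega K M (nprod K X n) (X (Suc n)) \<odot> (nomega K M X n \<otimes>\<^sub>1 id1 K (T0 M (X (Suc n))))"
  by (cases n) auto

lemma nprod2_Suc: "1 \<le> n \<Longrightarrow> nprod2 K \<alpha> (Suc n) = nprod2 K \<alpha> n \<otimes>\<^sub>2 \<alpha> (Suc n)"
  by (cases n) auto

lemma nomega_arr: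
  assumes "1 \<le> n" "obs X n"
  shows "nomega K M X n \<in> arr K \<and> dom1 K (nomega K M X n) = nprod K (T0 M \<circ> X) n \<and>
    cod1 K (nomega K M X n) = T0 M (nprod K X n)"
  using assms
proof (induction n rule: nat_induct_at_least)
  case base
  then show ?case by (simp add: obs_def)
next
  case (Suc n)
  have "obs X n" "X (Suc n) \<in> ob K" using Suc.prems by (auto simp: obs_def)
  then show ?case using Suc by (simp add: nomega_Suc nprod_Suc)
qed

lemma nomega_ntuple2:
  assumes "1 \<le> n" "famT W X n b"
  shows "id2 K (nomega K M X n) \<star> ntuple2 b n = nom_el X n b"
  using assms
proof (induction n rule: nat_induct_at_least)
  case base
  then show ?case using famTD[of W X 1 b 1] by (simp flip: hid_def)
next
  case (Suc n)
  have b: "famT W X n b" using famT_mono[OF Suc.prems] by simp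
  then have "fam W (T0 M \<circ> X) n b" by (simp add: famT_def comp_def)
  note c = ntuple2_cell[OF Suc.hyps this] nprod_ob[OF fam_obs[OF this]] and N = nomega_arr[OF Suc.hyps famT_obs[OF b]]
  note d = famTD[OF Suc.prems, of "Suc n"] famT_nprod[OF b]
  show ?case
    using Suc.IH[OF b] c N d Suc.hyps
    by (simp add: nomega_Suc ntuple2_Suc nom_el_Suc id2_comp1 id2_prod1 prod2_eq om_el_def flip: hid_def)
qed

lemma nprod2_ntuple2:
  assumes "1 \<le> n" "\<And>k. 1 \<le> k \<Longrightarrow> k \<le> n \<Longrightarrow> \<alpha> k \<in> cell K \<and> src (\<alpha> k) = S k \<and> trg (\<alpha> k) = R k" "fam W S n b"
  shows "nprod2 K \<alpha> n \<in> cell K \<and> src (nprod2 K \<alpha> n) = nprod K S n \<and> trg (nprod2 K \<alpha> n) = nprod K R n \<and>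
    nprod2 K \<alpha> n \<star> ntuple2 b n = ntuple2 (\<lambda>k. \<alpha> k \<star> b k) n"
  using assms
proof (induction n rule: nat_induct_at_least)
  case (Suc n)
  have b: "fam W S n b" using fam_mono[OF Suc.prems(2)] by simp
  note c = ntuple2_cell[OF Suc.hyps b] and d = famD[OF Suc.prems(2), of "Suc n"] and a = Suc.prems(1)[of "Suc n"]
  have ob: "nprod K S n \<in> ob K" "S (Suc n) \<in> ob K"
    using fam_obs[OF b] fam_obs[OF Suc.prems(2)] by (auto simp: obs_def)
  show ?case
    using Suc.IH[OF _ b] Suc.prems(1) c d a ob Suc.hyps
    by (simp add: nprod2_Suc prod2_eq ntuple2_Suc nprod_Suc)
qed simp

text \<open>Evaluated on the projections, the inverse permutation merely reorders the list to which
  iterated \<open>\<omega>\<close> is applied.\<close>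

lemma omega_perm_eq:
  assumes "1 \<le> n" "obs A n" "\<sigma> permutes {1..n}"
  shows "omega_perm K M A n \<sigma> \<in> arr K" "dom1 K (omega_perm K M A n \<sigma>) = nprod K (T0 M \<circ> A) n"
    "cod1 K (omega_perm K M A n \<sigma>) = T0 M (nprod K A n)"
    "id2 K (omega_perm K M A n \<sigma>) = T2 M (perm2 A n \<sigma>) \<star> nom_el (A \<circ> \<sigma>) n (nproj2 (T0 M \<circ> A) n \<circ> \<sigma>)"
proof -
  have oT: "obs (T0 M \<circ> A) n" using assms(2) by (simp add: obs_def)
  note p = id2_perm1[OF assms] and i = inv1_perm1[OF assms(1) oT assms(3)]
    and N = nomega_arr[OF assms(1) obs_perm[OF assms(2,3)]]
  have f: "famT (nprod K (T0 M \<circ> A) n) (A \<circ> \<sigma>) n (nproj2 (T0 M \<circ> A) n \<circ> \<sigma>)"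
    using fam_nproj2[OF oT] assms(2) by (intro famT_perm[OF _ assms(3)]) (simp add: famT_def comp_def)
  show "omega_perm K M A n \<sigma> \<in> arr K" "dom1 K (omega_perm K M A n \<sigma>) = nprod K (T0 M \<circ> A) n"
    "cod1 K (omega_perm K M A n \<sigma>) = T0 M (nprod K A n)"
    using p i N by (simp_all add: omega_perm_def comp_assoc)
  show "id2 K (omega_perm K M A n \<sigma>) = T2 M (perm2 A n \<sigma>) \<star> nom_el (A \<circ> \<sigma>) n (nproj2 (T0 M \<circ> A) n \<circ> \<sigma>)"
    using p i N nomega_ntuple2[OF assms(1) f] by (simp add: omega_perm_def comp_assoc id2_comp1 flip: T2_id2)
qed

lemma omega_perm_id:
  assumes "1 \<le> n" "obs A n"
  shows "omega_perm K M A n id = nomega K M A n"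
proof (rule id2_inj)
  have oT: "obs (T0 M \<circ> A) n" using assms(2) by (simp add: obs_def)
  have f: "famT (nprod K (T0 M \<circ> A) n) A n (nproj2 (T0 M \<circ> A) n)"
    using fam_nproj2[OF oT] assms(2) by (simp add: famT_def comp_def)
  note e = omega_perm_eq[OF assms permutes_id] and N = nomega_arr[OF assms]
  show "omega_perm K M A n id \<in> arr K" "nomega K M A n \<in> arr K" using e N by auto
  have "perm2 A n id = hid (nprod K A n)" using assms by (simp add: perm2_def)
  then show "id2 K (omega_perm K M A n id) = id2 K (nomega K M A n)"
    using e(4) N nomega_ntuple2[OF assms(1) f] nom_el_cell[OF assms(1) f] assms oT by simp
qed

end

context pseudo_commutative_monad
begin

text \<open>On a list of elements the explicit regrouping of the domain disappears, and
  \<open>1 \<times> \<Gamma> \<times> 1\<close> becomes the insertion that \<open>plug2\<close>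
  performs.\<close>

lemma one_Gamma_one_ntuple2:
  assumes "famT W X (Suc m) a" "1 \<le> i" "i \<le> m"
  shows "one_Gamma_one K M \<Gamma> X (Suc m) i \<in> cell K"
    "src (one_Gamma_one K M \<Gamma> X (Suc m) i) = nprod K (T0 M \<circ> X) (Suc m)"
    "trg (one_Gamma_one K M \<Gamma> X (Suc m) i) = nprod K (T0 M \<circ> merge i X (X i \<otimes> X (Suc i))) m"
    "one_Gamma_one K M \<Gamma> X (Suc m) i \<star> ntuple2 a (Suc m) = ntuple2 (merge i a (gam_el (X i) (X (Suc i)) (a i) (a (Suc i)))) m"
proof -
  let ?\<alpha> = "merge i (\<lambda>k. id2 K (id1 K (T0 M (X k)))) (\<Gamma> (X i) (X (Suc i)))"
  let ?S = "merge i (T0 M \<circ> X) (T0 M (X i) \<otimes> T0 M (X (Suc i)))"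
  let ?R = "T0 M \<circ> merge i X (X i \<otimes> X (Suc i))" and ?b = "merge i a (pair (a i) (a (Suc i)))"
  have m: "1 \<le> m" "1 \<le> Suc m" using assms by auto
  note o = famT_obs[OF assms(1)]
  have oT: "obs (T0 M \<circ> X) (Suc m)" using o by (simp add: obs_def)
  have x: "X i \<in> ob K" "X (Suc i) \<in> ob K" using o assms by (auto simp: obs_def)
  have f: "fam W (T0 M \<circ> X) (Suc m) a" using assms(1) by (simp add: famT_def comp_def)
  note d = famTD[OF assms(1), of i] famTD[OF assms(1), of "Suc i"]
  have \<alpha>: "?\<alpha> k \<in> cell K \<and> src (?\<alpha> k) = ?S k \<and> trg (?\<alpha> k) = ?R k" if "1 \<le> k" "k \<le> m" for k
    using that x o by (auto simp: merge_def obs_def)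
  have b: "fam W ?S m ?b"
    using fam_merge[OF f, of "pair (a i) (a (Suc i))"] d assms(2,3) by simp
  note N = nprod2_ntuple2[where R = ?R, OF m(1) \<alpha> b]
  note g = id2_group1[OF oT assms(2,3)] and c = group2_ntuple2[OF f assms(2,3)] and t = ntuple2_cell[OF m(2) f]
  note cc = group2_cell[OF oT assms(2,3)]
  have O: "one_Gamma_one K M \<Gamma> X (Suc m) i = nprod2 K ?\<alpha> m \<star> group2 (T0 M \<circ> X) (Suc m) i"
    using g by (simp add: one_Gamma_one_def rwhisker_def)
  show "one_Gamma_one K M \<Gamma> X (Suc m) i \<in> cell K"
    "src (one_Gamma_one K M \<Gamma> X (Suc m) i) = nprod K (T0 M \<circ> X) (Suc m)"
    "trg (one_Gamma_one K M \<Gamma> X (Suc m) i) = nprod K ?R m"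
    unfolding O using N cc by simp_all
  have "one_Gamma_one K M \<Gamma> X (Suc m) i \<star> ntuple2 a (Suc m) = ntuple2 (\<lambda>k. ?\<alpha> k \<star> ?b k) m"
    unfolding O using N cc c t by simp
  also have "\<dots> = ntuple2 (merge i a (gam_el (X i) (X (Suc i)) (a i) (a (Suc i)))) m"
  proof (rule ntuple2_cong[OF m(1)])
    fix k assume k: "1 \<le> k" "k \<le> m"
    show "?\<alpha> k \<star> ?b k = merge i a (gam_el (X i) (X (Suc i)) (a i) (a (Suc i))) k"
      using k famTD[OF assms(1), of k] famTD[OF assms(1), of "Suc k"]
      by (auto simp: merge_def gam_el_def simp flip: hid_def)
  qed
  finally show "one_Gamma_one K M \<Gamma> X (Suc m) i \<star> ntuple2 a (Suc m) =
    ntuple2 (merge i a (gam_el (X i) (X (Suc i)) (a i) (a (Suc i)))) m" .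
qed

text \<open>\<open>inv1\<close> of the grouping has the components given by \<open>unmerge\<close>,
  the operator built into \<open>plug2\<close>. So the generating 2-cell at \<open>\<sigma>\<close>
  is the one at the identity for the reordered objects, followed by \<open>T\<close> of the
  permutation.\<close>

lemma Omega_step_eq:
  assumes "obs A (Suc m)" "\<sigma> permutes {1..Suc m}" "1 \<le> i" "i \<le> m"
  shows "Omega_step K M \<Gamma> A (Suc m) \<sigma> i =
    T2 M (perm2 A (Suc m) \<sigma>) \<star> gam_step (A \<circ> \<sigma>) m i (nproj2 (T0 M \<circ> A) (Suc m) \<circ> \<sigma>)"
proof -
  let ?X = "A \<circ> \<sigma>" and ?p = "nproj2 (T0 M \<circ> A) (Suc m) \<circ> \<sigma>" and ?n = "Suc m"
  let ?Y = "merge i ?X (?X i \<otimes> ?X (Suc i))"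
  let ?ga = "gam_el (?X i) (?X (Suc i)) (?p i) (?p (Suc i))"
  have m: "1 \<le> m" "1 \<le> ?n" using assms by auto
  have oT: "obs (T0 M \<circ> A) ?n" using assms(1) by (simp add: obs_def)
  note oX = obs_perm[OF assms(1,2)]
  have f: "famT (nprod K (T0 M \<circ> A) ?n) ?X ?n ?p"
    using fam_nproj2[OF oT] assms(1) by (intro famT_perm[OF _ assms(2)]) (simp add: famT_def comp_def)
  have fY: "famT (nprod K (T0 M \<circ> A) ?n) ?Y m (merge i ?p ?ga)"
    using famTD[OF f, of i] famTD[OF f, of "Suc i"] assms(3,4) by (intro famT_merge_at[OF f]) simp_all
  note P = id2_perm1[OF m(2) assms(1,2)] and I = inv1_perm1[OF m(2) oT assms(2)]
    and Gr = inv1_group1[OF oX assms(3,4) refl] and O = one_Gamma_one_ntuple2[OF f assms(3,4)]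
    and N = nomega_arr[OF m(1) famT_obs[OF fY]] and e = nomega_ntuple2[OF m(1) fY]
  let ?L = "T1 M (perm1 K A ?n \<sigma>) \<odot> T1 M (inv1 K (group1 K ?X ?n i)) \<odot> nomega K M ?Y m"
  have "Omega_step K M \<Gamma> A ?n \<sigma> i = id2 K ?L \<star> (one_Gamma_one K M \<Gamma> ?X ?n i \<star> ntuple2 ?p ?n)"
    using I(4) by (simp add: Omega_step_def Let_def lwhisker_def rwhisker_def)
  also have "one_Gamma_one K M \<Gamma> ?X ?n i \<star> ntuple2 ?p ?n = ntuple2 (merge i ?p ?ga) m" by (rule O(4))
  also have "id2 K ?L = T2 M (perm2 A ?n \<sigma>) \<star> (T2 M (ntuple2 (unmerge i (?X i) (?X (Suc i)) (nproj2 ?Y m)) ?n) \<star> id2 K (nomega K M ?Y m))"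
    using P Gr N by (simp add: id2_comp1 flip: T2_id2)
  also have "(T2 M (perm2 A ?n \<sigma>) \<star> (T2 M (ntuple2 (unmerge i (?X i) (?X (Suc i)) (nproj2 ?Y m)) ?n) \<star> id2 K (nomega K M ?Y m)))
      \<star> ntuple2 (merge i ?p ?ga) m = T2 M (perm2 A ?n \<sigma>) \<star> gam_step ?X m i ?p"
  proof -
    have "fam (nprod K (T0 M \<circ> A) ?n) (T0 M \<circ> ?Y) m (merge i ?p ?ga)"
      using fY by (simp add: famT_def comp_def)
    note t = ntuple2_cell[OF m(1) this]
    note l = regrouping_unmerge[OF refl assms(3,4) oX refl refl]
    note u = ntuple2_cell[OF m(2) linD(1)[OF l fam_nproj2[OF famT_obs[OF fY]]]]
    show ?thesis
      using t u N e perm2_cell[OF m(2) assms(1,2)]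
      by (simp add: gam_step_def plug2_def plug_def plug_with_def)
  qed
  finally show ?thesis .
qed

text \<open>Both ends are the iterated \<open>\<omega>\<close> in the order
  \<open>s \<circ> t\<close> followed by \<open>T\<close> of that permutation, by
  \<open>perm2_comp\<close>.\<close>

lemma gam_step_composable:
  assumes a: "famT W X (Suc m) a" "idfam (Suc m) a" and s: "s permutes {1..Suc m}"
    and j: "1 \<le> j" "j \<le> m" and k: "1 \<le> k" "k \<le> m" and t: "t = adj j"
  shows "vsrc (T2 M (perm2 X (Suc m) (s \<circ> t)) \<star> gam_step (X \<circ> (s \<circ> t)) m k (a \<circ> (s \<circ> t))) =
    vtrg (T2 M (perm2 X (Suc m) s) \<star> gam_step (X \<circ> s) m j (a \<circ> s))"
proof -
  have n: "1 \<le> Suc m" and tp: "t permutes {1..Suc m}" using j t transpose_permutes by simp_all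
  note st = permutes_compose[OF tp s] and o = famT_obs[OF a(1)]
  show ?thesis
    using perm2_cell[OF n o s] perm2_cell[OF n o st] perm2_cell[OF n obs_perm[OF o s] tp] perm2_comp[OF n s tp o]
      gam_step_cell[OF famT_perm[OF a(1) s] idfam_perm[OF a(2) s] j t]
      gam_step_cell[OF famT_perm[OF a(1) st] idfam_perm[OF a(2) st] k refl]
      nom_el_cell[OF n famT_perm[OF a(1) st]]
    by (simp add: comp_assoc T2_fuse)
qed

text \<open>Each relation at \<open>\<sigma>\<close> is the corresponding relation at the identity
  for the objects \<open>A \<circ> \<sigma>\<close>, whiskered by \<open>T\<close> of the
  permutation \<open>\<sigma>\<close>.\<close>

lemma Omega_diagram:
  assumes A: "obs A (Suc m)"
  shows "weak_order_diagram (hom_cat K (nprod K (T0 M \<circ> A) (Suc m)) (T0 M (nprod K A (Suc m)))) (Suc m)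
    (omega_perm K M A (Suc m)) (Omega_step K M \<Gamma> A (Suc m))"
    (is "weak_order_diagram (hom_cat K ?W ?Z) ?n ?Ob ?st")
proof -
  have n: "1 \<le> ?n" by simp
  have oT: "obs (T0 M \<circ> A) ?n" using A by (simp add: obs_def)
  let ?p = "nproj2 (T0 M \<circ> A) ?n"
  have p: "famT ?W A ?n ?p" using fam_nproj2[OF oT] A by (simp add: famT_def comp_def)
  have ip: "idfam ?n ?p" by (rule idfam_nproj2[OF oT])
  have f: "famT ?W (A \<circ> \<sigma>) ?n (?p \<circ> \<sigma>)" "idfam ?n (?p \<circ> \<sigma>)" if "\<sigma> permutes {1..?n}" for \<sigma>
    using famT_perm[OF p that] idfam_perm[OF ip that] .
  have ob: "?W \<in> ob K" "?Z \<in> ob K" using A oT by simp_all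
  have adj: "adj i permutes {1..?n}" if "1 \<le> i" "i < ?n" for i
    using that by (rule transpose_permutes)
  have steq: "?st \<sigma> i = T2 M (perm2 A ?n \<sigma>) \<star> gam_step (A \<circ> \<sigma>) m i (?p \<circ> \<sigma>)"
    if "\<sigma> permutes {1..?n}" "1 \<le> i" "i < ?n" for \<sigma> i
    using Omega_step_eq[OF A that(1,2)] that(3) by simp
  have stc: "?st \<sigma> i \<in> cell K" "src (?st \<sigma> i) = ?W" "trg (?st \<sigma> i) = ?Z"
      "vsrc (?st \<sigma> i) = id2 K (?Ob \<sigma>)" "vtrg (?st \<sigma> i) = id2 K (?Ob (\<sigma> \<circ> adj i))"
    if \<sigma>: "\<sigma> permutes {1..?n}" and i: "1 \<le> i" "i < ?n" for \<sigma> i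
  proof -
    have im: "i \<le> m" using i by simp
    have \<sigma>': "\<sigma> \<circ> adj i permutes {1..?n}" using permutes_compose[OF adj[OF i] \<sigma>] .
    note c = perm2_cell[OF n A \<sigma>] and S = gam_step_cell[OF f[OF \<sigma>] i(1) im refl]
    note N = nom_el_cell[OF n f(1)[OF \<sigma>']]
    note c' = perm2_cell[OF n obs_perm[OF A \<sigma>] adj[OF i]]
    show "?st \<sigma> i \<in> cell K" "src (?st \<sigma> i) = ?W" "trg (?st \<sigma> i) = ?Z"
      unfolding steq[OF \<sigma> i] using c S by simp_all
    show "vsrc (?st \<sigma> i) = id2 K (?Ob \<sigma>)"
      unfolding steq[OF \<sigma> i] omega_perm_eq(4)[OF n A \<sigma>] using c S by simp
    have "vtrg (?st \<sigma> i) = T2 M (perm2 A ?n \<sigma>) \<star> (T2 M (perm2 (A \<circ> \<sigma>) ?n (adj i)) \<star> nom_el (A \<circ> \<sigma> \<circ> adj i) ?n (?p \<circ> \<sigma> \<circ> adj i))"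
      unfolding steq[OF \<sigma> i] using c S by simp
    also have "\<dots> = id2 K (?Ob (\<sigma> \<circ> adj i))"
      unfolding omega_perm_eq(4)[OF n A \<sigma>'] using c c' N perm2_comp[OF n \<sigma> adj[OF i] A]
      by (simp add: comp_assoc T2_fuse)
    finally show "vtrg (?st \<sigma> i) = id2 K (?Ob (\<sigma> \<circ> adj i))" .
  qed
  \<comment> \<open>The permutation of a later step is factored through \<open>\<sigma>\<close>, so
    that all steps of a square or hexagon share one whiskering 1-cell.\<close>
  have split: "?st (\<sigma> \<circ> \<tau>) i = T2 M (perm2 A ?n \<sigma>) \<star>
      (T2 M (perm2 (A \<circ> \<sigma>) ?n \<tau>) \<star> gam_step (A \<circ> \<sigma> \<circ> \<tau>) m i (?p \<circ> \<sigma> \<circ> \<tau>))"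
    if \<sigma>: "\<sigma> permutes {1..?n}" and \<tau>: "\<tau> permutes {1..?n}" and i: "1 \<le> i" "i < ?n" for \<sigma> \<tau> i
  proof -
    have im: "i \<le> m" using i by simp
    have \<sigma>\<tau>: "\<sigma> \<circ> \<tau> permutes {1..?n}" using permutes_compose[OF \<tau> \<sigma>] .
    show ?thesis
      unfolding steq[OF \<sigma>\<tau> i]
      using perm2_cell[OF n A \<sigma>] perm2_cell[OF n obs_perm[OF A \<sigma>] \<tau>] gam_step_cell[OF f[OF \<sigma>\<tau>] i(1) im refl]
        perm2_comp[OF n \<sigma> \<tau> A]
      by (simp add: comp_assoc T2_fuse)
  qed
  show ?thesis
  proof (intro weak_order_diagram.intro weak_order_diagram_axioms.intro category_hom_cat)
    fix \<sigma> assume "\<sigma> \<in> symmetric_group ?n"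
    then have \<sigma>: "\<sigma> permutes {1..?n}" by (simp add: symmetric_group_def)
    show "?Ob \<sigma> \<in> Obj (hom_cat K ?W ?Z)"
      using omega_perm_eq[OF n A \<sigma>] by (simp add: hom_cat_def)
  next
    fix \<sigma> i assume "\<sigma> \<in> symmetric_group ?n" and i: "1 \<le> i" "i < ?n"
    then have \<sigma>: "\<sigma> permutes {1..?n}" by (simp add: symmetric_group_def)
    have \<sigma>': "\<sigma> \<circ> adj i permutes {1..?n}" using permutes_compose[OF adj[OF i] \<sigma>] .
    \<comment> \<open>\<open>stc\<close> knows the ends only as identity 2-cells;
      \<open>hom_cat\<close> asks for the 1-cells themselves.\<close>
    have "dom2 K (?st \<sigma> i) = ?Ob \<sigma>"
      by (rule id2_inj) (use stc[OF \<sigma> i] omega_perm_eq[OF n A \<sigma>] in \<open>simp_all add: vsrc_def\<close>)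
    moreover have "cod2 K (?st \<sigma> i) = ?Ob (\<sigma> \<circ> adj i)"
      by (rule id2_inj) (use stc[OF \<sigma> i] omega_perm_eq[OF n A \<sigma>'] in \<open>simp_all add: vtrg_def\<close>)
    ultimately show "?st \<sigma> i \<in> Arr (hom_cat K ?W ?Z) \<and> Dom (hom_cat K ?W ?Z) (?st \<sigma> i) = ?Ob \<sigma> \<and>
        Cod (hom_cat K ?W ?Z) (?st \<sigma> i) = ?Ob (\<sigma> \<circ> adj i)"
      using stc[OF \<sigma> i] omega_perm_eq[OF n A \<sigma>] by (simp add: hom_cat_def)
  next
    fix \<sigma> i j assume "\<sigma> \<in> symmetric_group ?n" and ij: "1 \<le> i" "Suc i < j" "j < ?n"
    then have \<sigma>: "\<sigma> permutes {1..?n}" by (simp add: symmetric_group_def)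
    \<comment> \<open>\<open>gam_step_square\<close> is stated for \<open>Suc (Suc m)\<close>
      factors, and two disjoint pairs leave room for that.\<close>
    obtain l where l: "m = Suc l" using ij by (cases m) auto
    have b: "i < ?n" "1 \<le> j" "i \<le> m" "j \<le> m" using ij by auto
    note ai = adj[OF ij(1) b(1)] and aj = adj[OF b(2) ij(3)]
    note c = perm2_cell[OF n A \<sigma>]
    note Si = gam_step_cell[OF f[OF \<sigma>] ij(1) b(3) refl] and Sj = gam_step_cell[OF f[OF \<sigma>] b(2,4) refl]
    note Sij = gam_step_cell[OF famT_perm[OF f(1)[OF \<sigma>] ai] idfam_perm[OF f(2)[OF \<sigma>] ai] b(2,4) refl]
      and Sji = gam_step_cell[OF famT_perm[OF f(1)[OF \<sigma>] aj] idfam_perm[OF f(2)[OF \<sigma>] aj] ij(1) b(3) refl]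
    note ci = perm2_cell[OF n obs_perm[OF A \<sigma>] ai] and cj = perm2_cell[OF n obs_perm[OF A \<sigma>] aj]
    have sq: "(T2 M (perm2 (A \<circ> \<sigma>) ?n (adj i)) \<star> gam_step (A \<circ> \<sigma> \<circ> adj i) m j (?p \<circ> \<sigma> \<circ> adj i)) \<bullet> gam_step (A \<circ> \<sigma>) m i (?p \<circ> \<sigma>) =
        (T2 M (perm2 (A \<circ> \<sigma>) ?n (adj j)) \<star> gam_step (A \<circ> \<sigma> \<circ> adj j) m i (?p \<circ> \<sigma> \<circ> adj j)) \<bullet> gam_step (A \<circ> \<sigma>) m j (?p \<circ> \<sigma>)"
      using gam_step_square[OF f(1)[OF \<sigma>, unfolded l] f(2)[OF \<sigma>, unfolded l] ij(1,2) _ refl refl] ij(3)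
      unfolding l by simp
    have "?st (\<sigma> \<circ> adj i) j \<bullet> ?st \<sigma> i = T2 M (perm2 A ?n \<sigma>) \<star>
      ((T2 M (perm2 (A \<circ> \<sigma>) ?n (adj i)) \<star> gam_step (A \<circ> \<sigma> \<circ> adj i) m j (?p \<circ> \<sigma> \<circ> adj i)) \<bullet> gam_step (A \<circ> \<sigma>) m i (?p \<circ> \<sigma>))"
      unfolding split[OF \<sigma> ai b(2) ij(3)] steq[OF \<sigma> ij(1) b(1)]
      by (rule hcomp_vcomp[symmetric]) (use c Si Sij ci in simp_all)
    also have "\<dots> = ?st (\<sigma> \<circ> adj j) i \<bullet> ?st \<sigma> j"
      unfolding sq split[OF \<sigma> aj ij(1) b(1)] steq[OF \<sigma> b(2) ij(3)]
      by (rule hcomp_vcomp) (use c Sj Sji cj in simp_all)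
    finally show "Comp (hom_cat K ?W ?Z) (?st (\<sigma> \<circ> adj i) j) (?st \<sigma> i) =
      Comp (hom_cat K ?W ?Z) (?st (\<sigma> \<circ> adj j) i) (?st \<sigma> j)"
      by (simp add: hom_cat_def)
  next
    fix \<sigma> i assume "\<sigma> \<in> symmetric_group ?n" and i: "1 \<le> i" "Suc i < ?n"
    then have \<sigma>: "\<sigma> permutes {1..?n}" by (simp add: symmetric_group_def)
    obtain l where l: "m = Suc l" using i by (cases m) auto
    let ?s = "adj i" and ?t = "adj (Suc i)"
    let ?X = "A \<circ> \<sigma>" and ?a = "?p \<circ> \<sigma>"
    have b: "i < ?n" "1 \<le> Suc i" "i \<le> m" "Suc i \<le> m" "i \<le> l" using i l by auto
    note s = adj[OF i(1) b(1)] and t = adj[OF b(2) i(2)]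
    note st = permutes_compose[OF t s] and ts = permutes_compose[OF s t]
    note \<sigma>s = permutes_compose[OF s \<sigma>] and \<sigma>t = permutes_compose[OF t \<sigma>]
    note c = perm2_cell[OF n A \<sigma>]
    note cX = perm2_cell[OF n obs_perm[OF A \<sigma>]]
    let ?S1 = "gam_step ?X m i ?a" and ?S2 = "T2 M (perm2 ?X ?n ?s) \<star> gam_step (?X \<circ> ?s) m (Suc i) (?a \<circ> ?s)"
      and ?S3 = "T2 M (perm2 ?X ?n (?s \<circ> ?t)) \<star> gam_step (?X \<circ> (?s \<circ> ?t)) m i (?a \<circ> (?s \<circ> ?t))"
      and ?R1 = "gam_step ?X m (Suc i) ?a" and ?R2 = "T2 M (perm2 ?X ?n ?t) \<star> gam_step (?X \<circ> ?t) m i (?a \<circ> ?t)"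
      and ?R3 = "T2 M (perm2 ?X ?n (?t \<circ> ?s)) \<star> gam_step (?X \<circ> (?t \<circ> ?s)) m (Suc i) (?a \<circ> (?t \<circ> ?s))"
    let ?c = "T2 M (perm2 A ?n \<sigma>)"
    have br: "?S3 \<bullet> (?S2 \<bullet> ?S1) = ?R3 \<bullet> (?R2 \<bullet> ?R1)"
      using gam_step_braid[OF f(1)[OF \<sigma>, unfolded l] f(2)[OF \<sigma>, unfolded l] i(1) b(5) refl refl] unfolding l .
    have e: "?st \<sigma> i = ?c \<star> ?S1" "?st (\<sigma> \<circ> ?s) (Suc i) = ?c \<star> ?S2" "?st (\<sigma> \<circ> ?s \<circ> ?t) i = ?c \<star> ?S3"
      "?st \<sigma> (Suc i) = ?c \<star> ?R1" "?st (\<sigma> \<circ> ?t) i = ?c \<star> ?R2" "?st (\<sigma> \<circ> ?t \<circ> ?s) (Suc i) = ?c \<star> ?R3"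
      using steq[OF \<sigma> i(1) b(1)] split[OF \<sigma> s b(2) i(2)] split[OF \<sigma> st i(1) b(1)]
        steq[OF \<sigma> b(2) i(2)] split[OF \<sigma> t i(1) b(1)] split[OF \<sigma> ts b(2) i(2)]
      by (simp_all add: comp_assoc)
    note a = f[OF \<sigma>]
    note S1 = gam_step_cell[OF a i(1) b(3) refl] and R1 = gam_step_cell[OF a b(2,4) refl]
      and S2 = gam_step_cell[OF famT_perm[OF a(1) s] idfam_perm[OF a(2) s] b(2,4) refl]
      and R2 = gam_step_cell[OF famT_perm[OF a(1) t] idfam_perm[OF a(2) t] i(1) b(3) refl]
      and S3 = gam_step_cell[OF famT_perm[OF a(1) st] idfam_perm[OF a(2) st] i(1) b(3) refl]
      and R3 = gam_step_cell[OF famT_perm[OF a(1) ts] idfam_perm[OF a(2) ts] b(2,4) refl]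
    have cells: "?S1 \<in> cell K" "?S2 \<in> cell K" "?S3 \<in> cell K" "?R1 \<in> cell K" "?R2 \<in> cell K" "?R3 \<in> cell K"
      "trg ?S1 = T0 M (nprod K ?X ?n)" "trg ?R1 = T0 M (nprod K ?X ?n)"
      using S1 S2 S3 R1 R2 R3 cX[OF s] cX[OF t] cX[OF st] cX[OF ts] by simp_all
    show "Comp (hom_cat K ?W ?Z) (?st (\<sigma> \<circ> ?s \<circ> ?t) i) (Comp (hom_cat K ?W ?Z) (?st (\<sigma> \<circ> ?s) (Suc i)) (?st \<sigma> i)) =
      Comp (hom_cat K ?W ?Z) (?st (\<sigma> \<circ> ?t \<circ> ?s) (Suc i)) (Comp (hom_cat K ?W ?Z) (?st (\<sigma> \<circ> ?t) i) (?st \<sigma> (Suc i)))"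
    proof -
      have v: "vsrc ?S2 = vtrg ?S1" "vsrc ?R2 = vtrg ?R1"
        using S1 S2 R1 R2 cX[OF s] cX[OF t] by simp_all
      have v': "vsrc ?S3 = vtrg ?S2" "vsrc ?R3 = vtrg ?R2"
        by (rule gam_step_composable[OF a s b(2,4) i(1) b(3) refl], rule gam_step_composable[OF a t i(1) b(3) b(2,4) refl])
      \<comment> \<open>Whiskering distributes only over composable factors, which is what
        \<open>v\<close> and \<open>v'\<close> provide.\<close>
      have c3: "?c \<star> (\<gamma> \<bullet> (\<beta> \<bullet> \<alpha>)) = (?c \<star> \<gamma>) \<bullet> ((?c \<star> \<beta>) \<bullet> (?c \<star> \<alpha>))"
        if "\<alpha> \<in> cell K" "\<beta> \<in> cell K" "\<gamma> \<in> cell K" "trg \<alpha> = T0 M (nprod K ?X ?n)"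
          "vsrc \<beta> = vtrg \<alpha>" "vsrc \<gamma> = vtrg \<beta>" for \<alpha> \<beta> \<gamma>
        using that c by (simp add: hcomp_vcomp)
      show ?thesis
        unfolding e using c3[OF cells(1-3,7) v(1) v'(1)] c3[OF cells(4-6,8) v(2) v'(2)] br
        by (simp add: hom_cat_def)
    qed
  qed
qed

end

theorem mainTheorem3:
  fixes K :: "('o, 'f, 'c) fp_two_cat"
    and M :: "('o, 'f, 'c) strong_monad"
    and \<Gamma> :: "'o \<Rightarrow> 'o \<Rightarrow> 'c"
    and A :: "nat \<Rightarrow> 'o"
    and n :: nat
  assumes "pseudo_commutative_monad K M \<Gamma>"
    and "n \<ge> 1"
    and "\<And>k. k \<in> {1..n} \<Longrightarrow> A k \<in> ob K"
  shows "\<exists>\<Omega>o \<Omega>m.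
    cat_functor (weak_order_cat n)
      (hom_cat K (nprod K (T0 M \<circ> A) n) (T0 M (nprod K A n))) \<Omega>o \<Omega>m \<and>
    \<Omega>o id = nomega K M A n \<and>
    (\<forall>\<sigma> \<in> symmetric_group n. \<Omega>o \<sigma> = omega_perm K M A n \<sigma>) \<and>
    (\<forall>\<sigma> \<in> symmetric_group n. \<forall>i. 1 \<le> i \<and> i < n \<and>
       inversions n \<sigma> < inversions n (\<sigma> \<circ> transpose i (Suc i)) \<longrightarrow>
       \<Omega>m (\<sigma>, \<sigma> \<circ> transpose i (Suc i)) = Omega_step K M \<Gamma> A n \<sigma> i)"
proof -
  interpret pseudo_commutative_monad K M \<Gamma> by (rule assms(1))
  have o: "obs A n" using assms(3) by (simp add: obs_def)
  obtain m where n: "n = Suc m" using assms(2) by (cases n) auto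
  interpret D: weak_order_diagram "hom_cat K (nprod K (T0 M \<circ> A) n) (T0 M (nprod K A n))" n
    "omega_perm K M A n" "Omega_step K M \<Gamma> A n"
    unfolding n by (rule Omega_diagram[OF o[unfolded n]])
  from D.functor_exists omega_perm_id[OF assms(2) o] show ?thesis by blast
qed

end
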